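(* Let $y^{(k+1)}=f(x,y,y',\dots,y^{(k)})$ be an ordinary differential equation of order $k+1\ge3$ with generalized Wilczynski invariants $\Theta_3,\dots,\Theta_{k+1}$. Its solution space admits a natural: 1. pseudo-conformal structure if and only if $k$ is even and all generalized Wilczynski invariants $\Theta_{2i+1}$ ($i\ge 1$, $2i+1\le k+1$) vanish identically; 2. pseudo-symplectic structure if and only if $k$ is odd and all generalized Wilczynski invariants $\Theta_{2i+1}$ ($i\ge1$, $2i+1\le k+1$) vanish identically; 3. $G_2$-structure (here $k+1=7$) if and only if $\Theta_3=\Theta_4=\Theta_5=\Theta_7=0$. In all these cases such a structure is uniquely defined.
   Context: Non-degenerate projective curves. Let $V$ be a real vector space of dimension $k+1$ and $\gamma\subset P(V)$ a smooth curve. Write locally $\gamma(t)=\langle v_0(t)\rangle$ and $\gamma^{(i)}=\langle v_0,v_0',\dots,v_0^{(i)}\rangle$, with $\gamma^{(0)}=\gamma$. The curve is non-degenerate if $v_0,\dots,v_0^{(k)}$ is a basis of $V$ for all $t$. Its dual curve in $P(V^* )$ is the curve of annihilators of the osculating hyperplanes $\gamma^{(k-1)}$. Wilczynski invariants. Let $x,h,y$ be the $(k+1)\times(k+1)$ matrices (indices $0,\dots,k$) with non-zero entries $x_{i,i-1}=1$, $y_{i-1,i}=i(k+1-i)$ for $1\le i\le k$, and $h=\operatorname{diag}(k,k-2,\dots,-k)$; they span the irreducible $\mathfrak{sl}(2,\mathbb R)\subset\mathfrak{sl}(k+1,\mathbb R)$. For any local parameter $t$ on a non-degenerate curve $\gamma$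 there is a smooth family of bases $(e_0(t),\dots,e_k(t))$ of $V$ with $\gamma^{(i)}=\langle e_0,\dots,e_i\rangle$ such that $(e_0',\dots,e_k')=(e_0,\dots,e_k)A(t)$ with $A(t)\in x+\sum_{i=2}^k\theta_{i+1}(t)\,y^i+\langle h,y\rangle$. The functions $\theta_3,\dots,\theta_{k+1}$ are the Wilczynski invariants of $\gamma$; whether $\theta_i$ vanishes identically does not depend on the choices. Linearization. Let $M$ be the solution space of the ODE, a $(k+1)$-dimensional manifold (considered locally). For a solution $\bar y\in M$, $T_{\bar y}M$ is the solution space of the linearized equation $z^{(k+1)}=\sum_{i=0}^k\frac{\partial f}{\partial y^{(i)}}z^{(i)}$, with coefficients evaluated along $\bar y$. The evaluation functionals $z\mapsto z(x)$ define a non-degenerate curve $x\mapsto\langle\mathrm{ev}_x\rangle$ in $P(T^*_{\bar y}M)$. Its dual curve in $P(T_{\bar y}M)$, namely $x\mapsto\{z: z(x)=z'(x)=\dots=z^{(k-1)}(x)=0\}$, is the linearization curve $\gamma_{\bar y}$. Dual curves have the same Wilczynski invariants up to sign, $\theta_i\mapsto(-1)^i\theta_i$. The generalized Wilczynski invariants $\Theta_i$ of the ODE are the Wilczynski invariants $\theta_i$ of the linearizations along all solutions $\bar y$; "$\Theta_i$ vanishes identically" means that $\theta_i\equiv0$ for the linearization along every solution. Structures. A pseudo-conformal structure on $M$ is a family of pseudo-Riemannian metrics on $M$ proportional to each other by non-zero functional factors. A pseudo-symplectic structure on $M$ is a family of non-degenerate differential 2-forms on $M$ proportional to each other by non-zero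 functional factors. A $G_2$-structure on a 7-dimensional vector space is a 3-form in the $GL(7,\mathbb R)$-orbit of the 3-form given by the multiplication of imaginary split octonions (equivalently, a 3-form whose stabilizer is conjugate to the split real form of $G_2$). A $G_2$-structure on $M$ is a differential 3-form $\Omega$ on $M$ such that each $\Omega_p$ is a $G_2$-structure on $T_pM$. Compatibility. A non-degenerate curve $\gamma\subset P(V)$, $\dim V=k+1$, is compatible with a non-degenerate bilinear form $b$ on $V$ if $b(\gamma^{(i)},\gamma^{(k-1-i)})=0$ for all $i=0,\dots,k-1$. If $\dim V=7$, it is compatible with a $G_2$-structure $\Omega$ on $V$ if $\Omega(\gamma,\gamma^{(2)},\cdot)=0$ for all points of the curve. A pseudo-conformal, pseudo-symplectic or $G_2$-structure on $M$ is natural if for each solution $\bar y\in M$ it is compatible, on $T_{\bar y}M$, with the linearization curve $\gamma_{\bar y}\subset P(T_{\bar y}M)$.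
   Formalization: In item 3, the G_2-structure is shown to be unique only up to a smooth nowhere-zero functional factor, since literal uniqueness of the 3-form fails: if Ω is natural, so is cΩ for every non-zero constant c. *)

theory Defs
  imports "HOL-Analysis.Analysis"
begin

text \<open>
  Smoothness of maps between normed spaces, via iterated directional derivatives. It is only used
  on open subsets of finite-dimensional spaces.
\<close>

primrec times_differentiable_on ::
  "nat \<Rightarrow> 'a::real_normed_vector set \<Rightarrow> ('a \<Rightarrow> 'b::real_normed_vector) \<Rightarrow> bool" where
  "times_differentiable_on 0 S F \<longleftrightarrow> continuous_on S F"
| "times_differentiable_on (Suc n) S F \<longleftrightarrow>
     (\<forall>x\<in>S. F differentiable (at x)) \<and>
     (\<forall>v. times_differentiable_on n S (\<lambda>x. frechet_derivative F (at x) v))"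

definition smooth_on :: "'a::real_normed_vector set \<Rightarrow> ('a \<Rightarrow> 'b::real_normed_vector) \<Rightarrow> bool" where
  "smooth_on S F \<longleftrightarrow> (\<forall>n. times_differentiable_on n S F)"


section \<open>Non-degenerate projective curves\<close>

text \<open>
  A curve in \<open>P(V)\<close> is a map from the parameter to one-dimensional subspaces of \<open>V\<close>.
  Throughout, \<open>DIM(V) = k + 1\<close>.
\<close>

definition vderiv :: "(real \<Rightarrow> 'v::real_normed_vector) \<Rightarrow> real \<Rightarrow> 'v" where
  "vderiv v t = vector_derivative v (at t)"

definition curve_lift :: "real set \<Rightarrow> (real \<Rightarrow> 'v::euclidean_space set) \<Rightarrow> (real \<Rightarrow> 'v) \<Rightarrow> bool" where
  "curve_lift J \<gamma> v \<longleftrightarrow> open J \<and> smooth_on J v \<and> (\<forall>t\<in>J. v t \<noteq> 0 \<and> \<gamma> t = span {v t})"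

text \<open>
  The osculating space \<open>\<gamma>\<^sup>(\<^sup>i\<^sup>)(t)\<close>. All lifts of \<open>\<gamma>\<close> near \<open>t\<close> give the same
  span, so the union over lifts below is this common subspace.
\<close>

definition osculating :: "(real \<Rightarrow> 'v::euclidean_space set) \<Rightarrow> nat \<Rightarrow> real \<Rightarrow> 'v set" where
  "osculating \<gamma> i t =
     {w. \<exists>J v. t \<in> J \<and> curve_lift J \<gamma> v \<and> w \<in> span ((\<lambda>j. (vderiv ^^ j) v t) ` {..i})}"

definition is_basis :: "nat \<Rightarrow> (nat \<Rightarrow> 'v::euclidean_space) \<Rightarrow> bool" where
  "is_basis k e \<longleftrightarrow> inj_on e {..k} \<and> independent (e ` {..k}) \<and> span (e ` {..k}) = UNIV"

definition nondegenerate_curve :: "nat \<Rightarrow> real set \<Rightarrow> (real \<Rightarrow> 'v::euclidean_space set) \<Rightarrow> bool" where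
  "nondegenerate_curve k I \<gamma> \<longleftrightarrow>
     (\<forall>t\<in>I. \<exists>J v. t \<in> J \<and> curve_lift J \<gamma> v \<and> is_basis k (\<lambda>j. (vderiv ^^ j) v t))"


section \<open>Wilczynski invariants\<close>

text \<open>Matrices of size \<open>k + 1\<close> are functions of a row and a column index in \<open>{0..k}\<close>.\<close>

definition mat_x :: "nat \<Rightarrow> nat \<Rightarrow> real" where
  "mat_x i j = (if i = j + 1 then 1 else 0)"

definition mat_h :: "nat \<Rightarrow> nat \<Rightarrow> nat \<Rightarrow> real" where
  "mat_h k i j = (if i = j then real k - 2 * real i else 0)"

definition mat_y :: "nat \<Rightarrow> nat \<Rightarrow> nat \<Rightarrow> real" where
  "mat_y k i j = (if j = i + 1 then real j * (real k + 1 - real j) else 0)"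

primrec mat_power :: "nat \<Rightarrow> (nat \<Rightarrow> nat \<Rightarrow> real) \<Rightarrow> nat \<Rightarrow> nat \<Rightarrow> nat \<Rightarrow> real" where
  "mat_power k B 0 = (\<lambda>i j. if i = j then 1 else 0)"
| "mat_power k B (Suc p) = (\<lambda>i j. \<Sum>l\<le>k. mat_power k B p i l * B l j)"

definition wilczynski_matrix ::
  "nat \<Rightarrow> (nat \<Rightarrow> real) \<Rightarrow> real \<Rightarrow> real \<Rightarrow> nat \<Rightarrow> nat \<Rightarrow> real" where
  "wilczynski_matrix k \<theta> a b i j =
     mat_x i j + (\<Sum>p=2..k. \<theta> (p + 1) * mat_power k (mat_y k) p i j)
       + a * mat_h k i j + b * mat_y k i j"

definition wilczynski_frame ::
  "nat \<Rightarrow> real set \<Rightarrow> (real \<Rightarrow> 'v::euclidean_space set) \<Rightarrow> (nat \<Rightarrow> real \<Rightarrow> 'v)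
     \<Rightarrow> (nat \<Rightarrow> real \<Rightarrow> real) \<Rightarrow> bool" where
  "wilczynski_frame k J \<gamma> e \<theta> \<longleftrightarrow>
     (\<forall>i\<le>k. smooth_on J (e i)) \<and>
     (\<forall>t\<in>J. is_basis k (\<lambda>i. e i t)) \<and>
     (\<forall>t\<in>J. \<forall>i\<le>k. osculating \<gamma> i t = span ((\<lambda>j. e j t) ` {..i})) \<and>
     (\<exists>a b. \<forall>t\<in>J. \<forall>j\<le>k.
        (e j has_vector_derivative
           (\<Sum>i\<le>k. wilczynski_matrix k (\<lambda>m. \<theta> m t) (a t) (b t) i j *\<^sub>R e i t)) (at t))"

text \<open>
  The identical vanishing of \<open>\<theta>\<^sub>m\<close>, for \<open>m \<in> {3..k+1}\<close>, along the non-degenerate curve \<open>\<gamma>\<close> over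
  \<open>I\<close>, with respect to the given parameter. Frames of this kind exist, at least locally, and the
  vanishing does not depend on their choice; it is required of all frames over open subintervals.
\<close>

definition wilczynski_vanishes :: "nat \<Rightarrow> real set \<Rightarrow> (real \<Rightarrow> 'v::euclidean_space set) \<Rightarrow> nat \<Rightarrow> bool" where
  "wilczynski_vanishes k I \<gamma> m \<longleftrightarrow>
     (\<forall>J e \<theta>. open J \<longrightarrow> is_interval J \<longrightarrow> J \<subseteq> I \<longrightarrow> wilczynski_frame k J \<gamma> e \<theta> \<longrightarrow>
        (\<forall>t\<in>J. \<theta> m t = 0))"


section \<open>The equation, its local solution space and its linearizations\<close>

text \<open>
  \<open>'n\<close> has \<open>k + 1\<close> elements and indexes the jet coordinates \<open>y, y', \<dots>, y\<^sup>(\<^sup>k\<^sup>)\<close>. The coordinate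
  with index \<open>i\<close> is the derivative of order \<open>jet_order i\<close>, for a fixed enumeration of \<open>'n\<close>.
\<close>

definition jet_order :: "'n::finite \<Rightarrow> nat" where
  "jet_order = (SOME h. bij_betw h (UNIV :: 'n set) {..<CARD('n)})"

lemma bij_betw_jet_order: "bij_betw (jet_order :: 'n::finite \<Rightarrow> nat) UNIV {..<CARD('n)}"
proof -
  have "\<exists>h. bij_betw h (UNIV :: 'n set) {..<CARD('n)}"
    using ex_bij_betw_finite_nat[of "UNIV :: 'n set"] by (simp add: atLeast0LessThan)
  then show ?thesis
    unfolding jet_order_def by (rule someI_ex)
qed

definition jet :: "(real \<Rightarrow> real) \<Rightarrow> real \<Rightarrow> real ^ 'n::finite" where
  "jet y x = (\<chi> i. (deriv ^^ jet_order i) y x)"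

definition ode_solution ::
  "(real \<times> (real ^ 'n::finite) \<Rightarrow> real) \<Rightarrow> (real \<times> (real ^ 'n)) set \<Rightarrow> real set \<Rightarrow> (real \<Rightarrow> real) \<Rightarrow> bool" where
  "ode_solution f D I y \<longleftrightarrow>
     (\<forall>x\<in>I. (\<forall>i<CARD('n). (deriv ^^ i) y field_differentiable (at x)) \<and>
        (x, jet y x) \<in> D \<and> (deriv ^^ CARD('n)) y x = f (x, jet y x))"

text \<open>
  The local solution space \<open>M\<close>: solutions over the interval \<open>I\<close> with initial jet at \<open>x0\<close>
  in the open set \<open>U\<close>. The map \<open>y \<mapsto> jet y x0\<close> is the chart of \<open>M\<close>, with image \<open>U\<close>; its
  differential identifies a solution \<open>z\<close> of the linearized equation, i.e. a tangent vector of
  \<open>M\<close>, with \<open>jet z x0\<close>. Tensor fields on \<open>M\<close> are written in this chart.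
\<close>

definition solution_space ::
  "(real \<times> (real ^ 'n::finite) \<Rightarrow> real) \<Rightarrow> (real \<times> (real ^ 'n)) set \<Rightarrow> real set \<Rightarrow> real
     \<Rightarrow> (real ^ 'n) set \<Rightarrow> (real \<Rightarrow> real) set" where
  "solution_space f D I x0 U = {y. ode_solution f D I y \<and> jet y x0 \<in> U}"

definition linearized_solution ::
  "(real \<times> (real ^ 'n::finite) \<Rightarrow> real) \<Rightarrow> real set \<Rightarrow> (real \<Rightarrow> real) \<Rightarrow> (real \<Rightarrow> real) \<Rightarrow> bool" where
  "linearized_solution f I y z \<longleftrightarrow>
     (\<forall>x\<in>I. (\<forall>i<CARD('n). (deriv ^^ i) z field_differentiable (at x)) \<and>
        (deriv ^^ CARD('n)) z x =
          (\<Sum>i\<in>(UNIV :: 'n set).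
             frechet_derivative f (at (x, jet y x)) (0, axis i 1) * (deriv ^^ jet_order i) z x))"

definition linearization_curve ::
  "(real \<times> (real ^ 'n::finite) \<Rightarrow> real) \<Rightarrow> real set \<Rightarrow> real \<Rightarrow> (real \<Rightarrow> real) \<Rightarrow> real \<Rightarrow> (real ^ 'n) set" where
  "linearization_curve f I x0 y x =
     {jet z x0 | z. linearized_solution f I y z \<and> (\<forall>i<CARD('n) - 1. (deriv ^^ i) z x = 0)}"

definition generalized_wilczynski_vanishes ::
  "nat \<Rightarrow> (real \<times> (real ^ 'n::finite) \<Rightarrow> real) \<Rightarrow> (real \<times> (real ^ 'n)) set \<Rightarrow> real set \<Rightarrow> real
     \<Rightarrow> (real ^ 'n) set \<Rightarrow> nat \<Rightarrow> bool" where
  "generalized_wilczynski_vanishes k f D I x0 U m \<longleftrightarrow>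
     (\<forall>y\<in>solution_space f D I x0 U. wilczynski_vanishes k I (linearization_curve f I x0 y) m)"


section \<open>Pseudo-conformal and pseudo-symplectic structures\<close>

definition nondegenerate_form :: "('v::euclidean_space \<Rightarrow> 'v \<Rightarrow> real) \<Rightarrow> bool" where
  "nondegenerate_form b \<longleftrightarrow> bilinear b \<and> (\<forall>v. (\<forall>w. b v w = 0) \<longrightarrow> v = 0)"

definition pseudo_riemannian_metric ::
  "'v::euclidean_space set \<Rightarrow> ('v \<Rightarrow> 'v \<Rightarrow> 'v \<Rightarrow> real) \<Rightarrow> bool" where
  "pseudo_riemannian_metric U g \<longleftrightarrow>
     (\<forall>v w. smooth_on U (\<lambda>u. g u v w)) \<and>
     (\<forall>u\<in>U. nondegenerate_form (g u) \<and> (\<forall>v w. g u v w = g u w v))"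

definition nondegenerate_two_form ::
  "'v::euclidean_space set \<Rightarrow> ('v \<Rightarrow> 'v \<Rightarrow> 'v \<Rightarrow> real) \<Rightarrow> bool" where
  "nondegenerate_two_form U \<omega> \<longleftrightarrow>
     (\<forall>v w. smooth_on U (\<lambda>u. \<omega> u v w)) \<and>
     (\<forall>u\<in>U. nondegenerate_form (\<omega> u) \<and> (\<forall>v. \<omega> u v v = 0))"

definition proportional_on ::
  "'v set \<Rightarrow> ('v \<Rightarrow> 'v \<Rightarrow> 'v \<Rightarrow> real) \<Rightarrow> ('v \<Rightarrow> 'v \<Rightarrow> 'v \<Rightarrow> real) \<Rightarrow> bool" where
  "proportional_on U g h \<longleftrightarrow>
     (\<exists>c :: 'v \<Rightarrow> real. \<forall>u\<in>U. c u \<noteq> 0 \<and> (\<forall>v w. h u v w = c u * g u v w))"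

text \<open>
  The structures are full proportionality classes. Only values over \<open>U\<close> matter, so that a class
  contains all extensions of its members outside \<open>U\<close>; the factors are automatically smooth.
\<close>

definition pseudo_conformal_structure ::
  "'v::euclidean_space set \<Rightarrow> ('v \<Rightarrow> 'v \<Rightarrow> 'v \<Rightarrow> real) set \<Rightarrow> bool" where
  "pseudo_conformal_structure U C \<longleftrightarrow>
     (\<exists>g. pseudo_riemannian_metric U g \<and>
        C = {h. pseudo_riemannian_metric U h \<and> proportional_on U g h})"

definition pseudo_symplectic_structure ::
  "'v::euclidean_space set \<Rightarrow> ('v \<Rightarrow> 'v \<Rightarrow> 'v \<Rightarrow> real) set \<Rightarrow> bool" where
  "pseudo_symplectic_structure U C \<longleftrightarrow>
     (\<exists>\<omega>. nondegenerate_two_form U \<omega> \<and>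
        C = {h. nondegenerate_two_form U h \<and> proportional_on U \<omega> h})"

definition compatible_form ::
  "nat \<Rightarrow> real set \<Rightarrow> (real \<Rightarrow> 'v::euclidean_space set) \<Rightarrow> ('v \<Rightarrow> 'v \<Rightarrow> real) \<Rightarrow> bool" where
  "compatible_form k I \<gamma> b \<longleftrightarrow>
     nondegenerate_curve k I \<gamma> \<and> nondegenerate_form b \<and>
     (\<forall>t\<in>I. \<forall>i\<le>k - 1. \<forall>v\<in>osculating \<gamma> i t. \<forall>w\<in>osculating \<gamma> (k - 1 - i) t. b v w = 0)"

definition natural_pseudo_conformal ::
  "nat \<Rightarrow> (real \<times> (real ^ 'n::finite) \<Rightarrow> real) \<Rightarrow> (real \<times> (real ^ 'n)) set \<Rightarrow> real set \<Rightarrow> real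
     \<Rightarrow> (real ^ 'n) set \<Rightarrow> (real ^ 'n \<Rightarrow> real ^ 'n \<Rightarrow> real ^ 'n \<Rightarrow> real) set \<Rightarrow> bool" where
  "natural_pseudo_conformal k f D I x0 U C \<longleftrightarrow>
     pseudo_conformal_structure U C \<and>
     (\<forall>g\<in>C. \<forall>y\<in>solution_space f D I x0 U.
        compatible_form k I (linearization_curve f I x0 y) (g (jet y x0)))"

definition natural_pseudo_symplectic ::
  "nat \<Rightarrow> (real \<times> (real ^ 'n::finite) \<Rightarrow> real) \<Rightarrow> (real \<times> (real ^ 'n)) set \<Rightarrow> real set \<Rightarrow> real
     \<Rightarrow> (real ^ 'n) set \<Rightarrow> (real ^ 'n \<Rightarrow> real ^ 'n \<Rightarrow> real ^ 'n \<Rightarrow> real) set \<Rightarrow> bool" where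
  "natural_pseudo_symplectic k f D I x0 U C \<longleftrightarrow>
     pseudo_symplectic_structure U C \<and>
     (\<forall>\<omega>\<in>C. \<forall>y\<in>solution_space f D I x0 U.
        compatible_form k I (linearization_curve f I x0 y) (\<omega> (jet y x0)))"


section \<open>Split \<open>G\<^sub>2\<close>-structures\<close>

text \<open>
  Split octonions in Zorn's vector-matrix form: \<open>(\<alpha>, a, b, \<beta>)\<close> is the matrix with scalar diagonal
  entries \<open>\<alpha>, \<beta>\<close> and off-diagonal entries \<open>a\<close> (upper right), \<open>b\<close> (lower left) in \<open>\<real>\<^sup>3\<close>.
\<close>

type_synonym split_octonion = "real \<times> (real ^ 3) \<times> (real ^ 3) \<times> real"

fun soct_mult :: "split_octonion \<Rightarrow> split_octonion \<Rightarrow> split_octonion" where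
  "soct_mult (\<alpha>, a, b, \<beta>) (\<alpha>', a', b', \<beta>') =
     (\<alpha> * \<alpha>' + a \<bullet> b',
      \<alpha> *\<^sub>R a' + \<beta>' *\<^sub>R a + cross3 b b',
      \<alpha>' *\<^sub>R b + \<beta> *\<^sub>R b' - cross3 a a',
      \<beta> * \<beta>' + b \<bullet> a')"

text \<open>The polarization of the multiplicative quadratic form \<open>\<alpha>\<beta> - a \<bullet> b\<close>.\<close>

fun soct_inner :: "split_octonion \<Rightarrow> split_octonion \<Rightarrow> real" where
  "soct_inner (\<alpha>, a, b, \<beta>) (\<alpha>', a', b', \<beta>') =
     (\<alpha> * \<beta>' + \<alpha>' * \<beta> - a \<bullet> b' - a' \<bullet> b) / 2"

lemma soct_inner_mult:
  "soct_inner (soct_mult p q) (soct_mult p q) = soct_inner p p * soct_inner q q"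
  by (cases p; cases q)
    (simp add: cross3_simps inner_vec_def sum_3 field_simps)

text \<open>The imaginary split octonions are those orthogonal to the unit \<open>(1, 0, 0, 1)\<close>.\<close>

fun soct_imaginary :: "real \<times> (real ^ 3) \<times> (real ^ 3) \<Rightarrow> split_octonion" where
  "soct_imaginary (\<alpha>, a, b) = (\<alpha>, a, b, - \<alpha>)"

definition soct_three_form ::
  "real \<times> (real ^ 3) \<times> (real ^ 3) \<Rightarrow> real \<times> (real ^ 3) \<times> (real ^ 3)
     \<Rightarrow> real \<times> (real ^ 3) \<times> (real ^ 3) \<Rightarrow> real" where
  "soct_three_form p q r =
     soct_inner (soct_mult (soct_imaginary p) (soct_imaginary q)) (soct_imaginary r)"

definition G2_form :: "('v::euclidean_space \<Rightarrow> 'v \<Rightarrow> 'v \<Rightarrow> real) \<Rightarrow> bool" where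
  "G2_form \<Omega> \<longleftrightarrow>
     (\<exists>\<phi>. linear \<phi> \<and> bij \<phi> \<and> (\<forall>u v w. \<Omega> u v w = soct_three_form (\<phi> u) (\<phi> v) (\<phi> w)))"

definition G2_structure ::
  "'v::euclidean_space set \<Rightarrow> ('v \<Rightarrow> 'v \<Rightarrow> 'v \<Rightarrow> 'v \<Rightarrow> real) \<Rightarrow> bool" where
  "G2_structure U \<Omega> \<longleftrightarrow>
     (\<forall>v w z. smooth_on U (\<lambda>u. \<Omega> u v w z)) \<and> (\<forall>u\<in>U. G2_form (\<Omega> u))"

definition compatible_G2 ::
  "real set \<Rightarrow> (real \<Rightarrow> 'v::euclidean_space set) \<Rightarrow> ('v \<Rightarrow> 'v \<Rightarrow> 'v \<Rightarrow> real) \<Rightarrow> bool" where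
  "compatible_G2 I \<gamma> \<Omega> \<longleftrightarrow>
     nondegenerate_curve 6 I \<gamma> \<and> G2_form \<Omega> \<and>
     (\<forall>t\<in>I. \<forall>v\<in>\<gamma> t. \<forall>w\<in>osculating \<gamma> 2 t. \<forall>z. \<Omega> v w z = 0)"

definition natural_G2 ::
  "(real \<times> (real ^ 'n::finite) \<Rightarrow> real) \<Rightarrow> (real \<times> (real ^ 'n)) set \<Rightarrow> real set \<Rightarrow> real
     \<Rightarrow> (real ^ 'n) set \<Rightarrow> (real ^ 'n \<Rightarrow> real ^ 'n \<Rightarrow> real ^ 'n \<Rightarrow> real ^ 'n \<Rightarrow> real) \<Rightarrow> bool" where
  "natural_G2 f D I x0 U \<Omega> \<longleftrightarrow>
     G2_structure U \<Omega> \<and>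
     (\<forall>y\<in>solution_space f D I x0 U.
        compatible_G2 I (linearization_curve f I x0 y) (\<Omega> (jet y x0)))"

end

theory Submission
  imports Defs
begin

text \<open>
  Along a single solution everything is computed in a moving frame. In a Wilczynski frame with matrix
  \<open>W\<close> the Gram matrix \<open>B\<close> of a compatible form satisfies \<open>B' = W\<^sup>T B + B W\<close> and vanishes for
  \<open>i + j < k\<close>. Comparing the antidiagonals \<open>i + j = k + p\<close> one after the other, an alternating sum
  telescopes; this forces \<open>B\<close> to be a constant multiple of \<open>(-1)\<^sup>i\<close> on the main antidiagonal and zero
  elsewhere, and \<open>\<theta>\<close> with index \<open>p + 1\<close> to vanish for even \<open>p\<close>. For a compatible 3-form in dimension 7
  the same argument runs over the levels \<open>i + j + l\<close>. This yields necessity and uniqueness.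
  Conversely, if the invariants in question vanish, the model form is invariant under \<open>W\<close>, so it does not
  depend on the point of the curve at which the frame is evaluated.

  The frame itself comes from a basis \<open>w\<close> with \<open>w\<^sub>j' = w\<^sub>j\<^sub>+\<^sub>1 + \<alpha>\<^sub>j w\<^sub>0\<close>, dual up to signs to the jets of
  the linearized solutions. A unitriangular change of frame brings it to normal form. Its entries are
  functions on the jet space and are found degree by degree, with the total derivative as derivation. Hence
  the frame at \<open>x0\<close> is a smooth function of the initial jet, and no theorem on the smooth dependence of
  solutions on initial values is needed.
\<close>

subsection \<open>Smooth functions\<close>

text \<open>One fact about the irreducible sl(2) is behind the telescoping sums, both for the normal
  form and for the Gram matrix: in degree p the commutators with \<open>x\<close> miss exactly one
  dimension. The sum of the entries along the p-th superdiagonal detects it, as this sum vanishes on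
  commutators and is positive on \<open>y^p\<close>. So a change of frame removes all but a multiple
  of \<open>y^p\<close>, and that multiple is an obstruction unless \<open>y^p\<close> preserves the
  model form. For the bilinear form these are the odd p; for the 3-form in dimension 7 they are p =
  1 and p = 5, which is why \<theta> with index 6 stays free there. The obstacle is smoothness over
  the solution space, since frames are built along one solution at a time. The change of frame uses
  only algebra and the total derivative and so lives on the jet space. Degree 0 leaves a multiple of
  the identity that only an integration along the solution can remove; the factor obtained is
  normalized to 1 at \<open>x0\<close> and leaves no trace there.\<close>

lemma times_differentiable_on_cong_imp:
  assumes "open S"
  shows "times_differentiable_on n S F \<Longrightarrow> (\<And>x. x \<in> S \<Longrightarrow> F x = G x) \<Longrightarrow> times_differentiable_on n S G"
proof (induction n arbitrary: F G)
  case 0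
  then show ?case by (metis continuous_on_cong times_differentiable_on.simps(1))
next
  case (Suc n)
  have d: "G differentiable at x" if "x \<in> S" for x
  proof -
    obtain F' where "(F has_derivative F') (at x)"
      using Suc.prems(1) \<open>x \<in> S\<close> unfolding times_differentiable_on.simps differentiable_def by metis
    then have "(G has_derivative F') (at x)"
      by (rule has_derivative_transform_within_open[OF _ assms that Suc.prems(2)])
    then show ?thesis unfolding differentiable_def by blast
  qed
  have "frechet_derivative F (at x) = frechet_derivative G (at x)" if "x \<in> S" for x
    using Suc.prems that assms by (intro frechet_derivative_transform_within_open[where X = S]) auto
  moreover have "times_differentiable_on n S (\<lambda>x. frechet_derivative F (at x) v)" for v
    using Suc.prems(1) by simp
  ultimately have "times_differentiable_on n S (\<lambda>x. frechet_derivative G (at x) v)" for v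
    using Suc.IH[of "\<lambda>x. frechet_derivative F (at x) v" "\<lambda>x. frechet_derivative G (at x) v"] by simp
  with d show ?case by simp
qed

lemma smooth_on_cong:
  assumes "open S" "\<And>x. x \<in> S \<Longrightarrow> F x = G x" "smooth_on S F"
  shows "smooth_on S G"
  using times_differentiable_on_cong_imp[OF assms(1), where F = F and G = G] assms(2,3)
  unfolding smooth_on_def by auto

lemma times_differentiable_on_Suc_imp:
  "times_differentiable_on (Suc n) S F \<Longrightarrow> times_differentiable_on n S F"
proof (induction n arbitrary: F)
  case 0
  then show ?case
    by (auto intro!: continuous_at_imp_continuous_on differentiable_imp_continuous_within)
next
  case (Suc n)
  then show ?case by (metis times_differentiable_on.simps(2))
qed

lemma smooth_on_imp_differentiable: "smooth_on S F \<Longrightarrow> x \<in> S \<Longrightarrow> F differentiable at x"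
  unfolding smooth_on_def by (metis times_differentiable_on.simps(2))

lemma smooth_on_has_derivative:
  "smooth_on S F \<Longrightarrow> x \<in> S \<Longrightarrow> (F has_derivative frechet_derivative F (at x)) (at x)"
  using smooth_on_imp_differentiable frechet_derivative_works by blast

lemma smooth_on_frechet_derivative:
  "smooth_on S F \<Longrightarrow> smooth_on S (\<lambda>x. frechet_derivative F (at x) v)"
  unfolding smooth_on_def by (metis times_differentiable_on.simps(2))

text \<open>Smoothness is the greatest property closed under directional derivatives, so an
  invariant \<open>P\<close> with this closure suffices. The derivatives need to lie in
  \<open>P\<close> only up to equality on \<open>S\<close>, since \<open>S\<close> is open.\<close>

lemma smooth_on_coinduct:
  assumes "open S" "P F"
    and step: "\<And>F x. P F \<Longrightarrow> x \<in> S \<Longrightarrow> F differentiable at x"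
      "\<And>F v. P F \<Longrightarrow> \<exists>G. P G \<and> (\<forall>x\<in>S. frechet_derivative F (at x) v = G x)"
  shows "smooth_on S F"
proof -
  have "times_differentiable_on n S F" if "P F" for n F
    using that
  proof (induction n arbitrary: F)
    case 0
    then show ?case
      using step(1) by (auto intro!: continuous_at_imp_continuous_on differentiable_imp_continuous_within)
  next
    case (Suc n)
    have "times_differentiable_on n S (\<lambda>x. frechet_derivative F (at x) v)" for v
    proof -
      obtain G where "P G" "\<forall>x\<in>S. frechet_derivative F (at x) v = G x"
        using step(2) Suc.prems by blast
      show ?thesis
        by (rule times_differentiable_on_cong_imp[OF assms(1) Suc.IH[OF \<open>P G\<close>]])
          (simp add: \<open>\<forall>x\<in>S. frechet_derivative F (at x) v = G x\<close>)
    qed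
    then show ?case using step(1) Suc.prems by simp
  qed
  then show ?thesis using assms(2) unfolding smooth_on_def by blast
qed

lemma smooth_on_const [simp]: "smooth_on S (\<lambda>x. c)"
proof -
  have "times_differentiable_on n S (\<lambda>x. c)" for n
    by (induction n arbitrary: c) auto
  then show ?thesis unfolding smooth_on_def by blast
qed

lemma smooth_on_bounded_linear:
  assumes "bounded_linear F" shows "smooth_on S F"
proof -
  have "frechet_derivative F (at x) = F" for x
    using assms by (metis bounded_linear_imp_has_derivative frechet_derivative_at)
  moreover have "times_differentiable_on n S (\<lambda>x. F v)" for n v
    using smooth_on_const unfolding smooth_on_def by blast
  ultimately have "times_differentiable_on n S F" for n
    using assms bounded_linear_imp_differentiable linear_continuous_on[of F S] by (cases n) auto
  then show ?thesis unfolding smooth_on_def by blast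
qed

lemma frechet_derivative_eqI: "(F has_derivative F') (at x) \<Longrightarrow> frechet_derivative F (at x) v = F' v"
  using frechet_derivative_at by metis

lemma times_differentiable_on_add:
  assumes "open S"
  shows "times_differentiable_on n S F \<Longrightarrow> times_differentiable_on n S G \<Longrightarrow>
    times_differentiable_on n S (\<lambda>x. F x + G x)"
proof (induction n arbitrary: F G)
  case 0
  then show ?case by (simp add: continuous_on_add)
next
  case (Suc n)
  have *: "frechet_derivative (\<lambda>x. F x + G x) (at x) v =
      frechet_derivative F (at x) v + frechet_derivative G (at x) v" if "x \<in> S" for x v
    using Suc.prems that
    by (intro frechet_derivative_eqI derivative_intros) (auto simp: frechet_derivative_works)
  have "times_differentiable_on n S (\<lambda>x. frechet_derivative (\<lambda>x. F x + G x) (at x) v)" for v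
    by (rule times_differentiable_on_cong_imp[OF assms Suc.IH[of "\<lambda>x. frechet_derivative F (at x) v"
          "\<lambda>x. frechet_derivative G (at x) v"]])
      (use Suc.prems * in auto)
  then show ?case using Suc.prems by simp
qed

lemma smooth_on_add [intro]:
  "open S \<Longrightarrow> smooth_on S F \<Longrightarrow> smooth_on S G \<Longrightarrow> smooth_on S (\<lambda>x. F x + G x)"
  unfolding smooth_on_def by (blast intro: times_differentiable_on_add)

lemma times_differentiable_on_scaleR:
  assumes "open S"
  shows "times_differentiable_on n S F \<Longrightarrow> times_differentiable_on n S G \<Longrightarrow>
    times_differentiable_on n S (\<lambda>x. F x *\<^sub>R G x)"
proof (induction n arbitrary: F G)
  case 0
  then show ?case by (simp add: continuous_on_scaleR)
next
  case (Suc n)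
  have "frechet_derivative (\<lambda>x. F x *\<^sub>R G x) (at x) v =
      F x *\<^sub>R frechet_derivative G (at x) v + frechet_derivative F (at x) v *\<^sub>R G x" if "x \<in> S" for x v
    using Suc.prems that
    by (intro frechet_derivative_eqI has_derivative_scaleR) (auto simp: frechet_derivative_works)
  moreover have "times_differentiable_on n S
      (\<lambda>x. F x *\<^sub>R frechet_derivative G (at x) v + frechet_derivative F (at x) v *\<^sub>R G x)" for v
    using Suc.prems Suc.prems[THEN times_differentiable_on_Suc_imp]
    by (rule_tac times_differentiable_on_add[OF assms]; rule_tac Suc.IH) auto
  ultimately have "times_differentiable_on n S (\<lambda>x. frechet_derivative (\<lambda>x. F x *\<^sub>R G x) (at x) v)" for v
    by (rule_tac times_differentiable_on_cong_imp[OF assms]) (assumption | simp)+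
  then show ?case using Suc.prems by (auto intro: differentiable_scaleR)
qed

lemma smooth_on_scaleR [intro]:
  "open S \<Longrightarrow> smooth_on S F \<Longrightarrow> smooth_on S G \<Longrightarrow> smooth_on S (\<lambda>x. F x *\<^sub>R G x)"
  unfolding smooth_on_def by (blast intro: times_differentiable_on_scaleR)

lemma smooth_on_mult [intro]:
  fixes F G :: "'a::real_normed_vector \<Rightarrow> real"
  shows "open S \<Longrightarrow> smooth_on S F \<Longrightarrow> smooth_on S G \<Longrightarrow> smooth_on S (\<lambda>x. F x * G x)"
  using smooth_on_scaleR[of S F G] by simp

lemma smooth_on_minus:
  fixes F :: "'a::real_normed_vector \<Rightarrow> real"
  shows "open S \<Longrightarrow> smooth_on S F \<Longrightarrow> smooth_on S (\<lambda>x. - F x)"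
  using smooth_on_mult[of S "\<lambda>x. -1" F] by simp

lemma smooth_on_diff:
  fixes F G :: "'a::real_normed_vector \<Rightarrow> real"
  shows "open S \<Longrightarrow> smooth_on S F \<Longrightarrow> smooth_on S G \<Longrightarrow> smooth_on S (\<lambda>x. F x - G x)"
  using smooth_on_add[of S F "\<lambda>x. - G x"] smooth_on_minus[of S G] by simp

lemma smooth_on_sum:
  assumes "open S" "\<And>i. i \<in> A \<Longrightarrow> smooth_on S (F i)"
  shows "smooth_on S (\<lambda>x. \<Sum>i\<in>A. F i x)"
  using assms(2) by (induction A rule: infinite_finite_induct) (auto intro: assms(1))

lemma times_differentiable_on_inverse:
  fixes F :: "'a::real_normed_vector \<Rightarrow> real"
  assumes "open S" and nz: "\<And>x. x \<in> S \<Longrightarrow> F x \<noteq> 0"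
  shows "times_differentiable_on n S F \<Longrightarrow> times_differentiable_on n S (\<lambda>x. inverse (F x))"
proof (induction n)
  case 0
  then show ?case using nz by (auto intro!: continuous_on_inverse)
next
  case (Suc n)
  let ?G = "\<lambda>x. inverse (F x)"
  have "(?G has_derivative (\<lambda>v. - (?G x * frechet_derivative F (at x) v * ?G x))) (at x)" if "x \<in> S" for x
    using Suc.prems that nz
    by (intro Deriv.has_derivative_inverse) (auto simp: frechet_derivative_works)
  note D = this
  have "?G differentiable at x" if "x \<in> S" for x
    using D[OF that] unfolding differentiable_def by blast
  moreover have E: "frechet_derivative ?G (at x) v = - (?G x * frechet_derivative F (at x) v * ?G x)"
    if "x \<in> S" for x v
    by (rule frechet_derivative_eqI[OF D[OF that]])
  \<comment> \<open>The derivative of 1/F is written with \<open>scaleR\<close> alone, so that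
    closure under \<open>scaleR\<close> and the induction hypothesis for 1/F cover it.\<close>
  moreover have T: "times_differentiable_on n S (\<lambda>x. (- 1) *\<^sub>R ((?G x *\<^sub>R frechet_derivative F (at x) v) *\<^sub>R ?G x))" for v
  proof -
    have G: "times_differentiable_on n S ?G"
      by (rule Suc.IH[OF times_differentiable_on_Suc_imp[OF Suc.prems]])
    have "times_differentiable_on n S (\<lambda>x. - 1 :: real)"
      using smooth_on_const unfolding smooth_on_def by blast
    moreover have "times_differentiable_on n S (\<lambda>x. frechet_derivative F (at x) v)"
      using Suc.prems by simp
    ultimately show ?thesis
      using times_differentiable_on_scaleR[OF assms(1)] G by blast
  qed
  ultimately have "times_differentiable_on n S (\<lambda>x. frechet_derivative ?G (at x) v)" for v
    by (intro times_differentiable_on_cong_imp[OF assms(1) T[of v]]) (simp add: E)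
  with \<open>\<And>x. x \<in> S \<Longrightarrow> ?G differentiable at x\<close> show ?case
    by (simp del: differentiable_inverse)
qed

lemma smooth_on_inverse:
  fixes F :: "'a::real_normed_vector \<Rightarrow> real"
  assumes "open S" "\<And>x. x \<in> S \<Longrightarrow> F x \<noteq> 0" "smooth_on S F"
  shows "smooth_on S (\<lambda>x. inverse (F x))"
  using assms unfolding smooth_on_def by (blast intro: times_differentiable_on_inverse)

text \<open>The invariant of the coinduction is the set of restrictions to the slice: the derivative
  of a restriction in direction \<open>v\<close> is the restriction of the derivative in direction
  \<open>(0, v)\<close>. With \<open>x = x0\<close> it turns smooth functions on the jet space into
  smooth functions of the initial jet.\<close>

lemma smooth_on_slice:
  fixes F :: "'a::real_normed_vector \<times> 'b::real_normed_vector \<Rightarrow> 'c::real_normed_vector"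
  assumes "open D" "open U" "smooth_on D F" "\<And>u. u \<in> U \<Longrightarrow> (x, u) \<in> D"
  shows "smooth_on U (\<lambda>u. F (x, u))"
proof (rule smooth_on_coinduct[where P = "\<lambda>G. \<exists>F. smooth_on D F \<and> G = (\<lambda>u. F (x, u))"])
  have *: "((\<lambda>u. F (x, u)) has_derivative (\<lambda>v. frechet_derivative F (at (x, u)) (0, v))) (at u)"
    if "smooth_on D F" "u \<in> U" for F :: "'a \<times> 'b \<Rightarrow> 'c" and u
    using that assms(4)
    by (intro has_derivative_compose[where f = "\<lambda>u. (x, u)", OF _ smooth_on_has_derivative] derivative_eq_intros) auto
  show "G differentiable at u" if "\<exists>F. smooth_on D F \<and> G = (\<lambda>u. F (x, u))" "u \<in> U" for u and G :: "'b \<Rightarrow> 'c"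
    using * that unfolding differentiable_def by blast
  show "\<exists>H. (\<exists>F. smooth_on D F \<and> H = (\<lambda>u. F (x, u))) \<and> (\<forall>u\<in>U. frechet_derivative G (at u) v = H u)"
    if "\<exists>F. smooth_on D F \<and> G = (\<lambda>u. F (x, u))" for G :: "'b \<Rightarrow> 'c" and v
  proof -
    from that obtain F where F: "smooth_on D F" "G = (\<lambda>u. F (x, u))" by (elim exE conjE)
    have "\<forall>u\<in>U. frechet_derivative G (at u) v = frechet_derivative F (at (x, u)) (0, v)"
      unfolding F(2) using frechet_derivative_eqI[OF *[OF F(1)]] by simp
    then show ?thesis
      using smooth_on_frechet_derivative[OF F(1), of "(0, v)"]
      by (intro exI[of _ "\<lambda>u. frechet_derivative F (at (x, u)) (0, v)"]) auto
  qed
qed (use assms in auto)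

text \<open>A curve has one derivative, but \<open>smooth_on\<close> asks for the derivative in
  every direction \<open>v\<close>, which is \<open>v\<close> times that one. Hence the coinduction
  runs over scalar multiples of members of \<open>P\<close>.\<close>

lemma smooth_on_curve_coinduct:
  fixes F :: "real \<Rightarrow> 'v::real_normed_vector"
  assumes "open I" "P F"
    and step: "\<And>F. P F \<Longrightarrow> \<exists>G. P G \<and> (\<forall>x\<in>I. (F has_vector_derivative G x) (at x))"
  shows "smooth_on I F"
proof (rule smooth_on_coinduct[where P = "\<lambda>F. \<exists>G c. P G \<and> F = (\<lambda>x. c *\<^sub>R G x)"])
  show "\<exists>G c. P G \<and> F = (\<lambda>x. c *\<^sub>R G x)" using assms(2) by (intro exI[of _ F] exI[of _ 1]) simp
  fix F :: "real \<Rightarrow> 'v" assume "\<exists>G c. P G \<and> F = (\<lambda>x. c *\<^sub>R G x)"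
  then obtain G c where G: "P G" "F = (\<lambda>x. c *\<^sub>R G x)" by blast
  from step[OF G(1)] obtain H where H: "P H" "\<And>x. x \<in> I \<Longrightarrow> (G has_vector_derivative H x) (at x)" by blast
  have F: "(F has_derivative (\<lambda>v. (v * c) *\<^sub>R H x)) (at x)" if "x \<in> I" for x
    using has_vector_derivative_scaleR[OF DERIV_const H(2)[OF that], of c] unfolding G(2)
    by (simp add: has_vector_derivative_def)
  then show "F differentiable at x" if "x \<in> I" for x
    using that F[OF that] unfolding differentiable_def by auto
  show "\<exists>G. (\<exists>Ga c. P Ga \<and> G = (\<lambda>x. c *\<^sub>R Ga x)) \<and> (\<forall>x\<in>I. frechet_derivative F (at x) v = G x)" for v
    using frechet_derivative_eqI[OF F] H(1) by (intro exI[of _ "\<lambda>x. (v * c) *\<^sub>R H x"]) auto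
qed (use assms in auto)

lemma smooth_on_vderiv:
  fixes F :: "real \<Rightarrow> 'v::real_normed_vector"
  assumes "open J" "smooth_on J F"
  shows "smooth_on J (vderiv F)"
    and "\<And>x. x \<in> J \<Longrightarrow> (F has_vector_derivative vderiv F x) (at x)"
proof -
  have "vderiv F x = frechet_derivative F (at x) 1" if "x \<in> J" for x
    using smooth_on_imp_differentiable[OF assms(2) that] unfolding vderiv_def
    by (simp add: frechet_derivative_eq_vector_derivative)
  then show "smooth_on J (vderiv F)"
    using smooth_on_cong[OF assms(1) _ smooth_on_frechet_derivative[OF assms(2), of 1]] by simp
  show "(F has_vector_derivative vderiv F x) (at x)" if "x \<in> J" for x
    using smooth_on_imp_differentiable[OF assms(2) that] unfolding vderiv_def
    by (simp add: vector_derivative_works)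
qed

lemma smooth_on_vderiv_funpow:
  fixes F :: "real \<Rightarrow> 'v::real_normed_vector"
  assumes "open J" "smooth_on J F"
  shows "smooth_on J ((vderiv ^^ i) F)"
  by (induction i) (auto simp: assms smooth_on_vderiv)

subsection \<open>Linear differential equations\<close>

text \<open>Integrals and estimates are taken over a compact interval. Base point and current point
  are interior to it, so that derivatives within the interval are full derivatives.\<close>

lemma open_interval_surround:
  fixes I :: "real set"
  assumes "open I" "is_interval I" "s \<in> I" "t \<in> I"
  obtains a b where "{a..b} \<subseteq> I" "a < s" "s < b" "a < t" "t < b"
proof -
  have ex: "\<exists>e>0. r - e \<in> I \<and> r + e \<in> I" if r: "r \<in> I" for r
  proof -
    obtain e where e: "e > 0" "ball r e \<subseteq> I" using assms(1) r openE by blast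
    then have "r - e/2 \<in> ball r e" "r + e/2 \<in> ball r e" by (auto simp: dist_norm)
    then show ?thesis using e by (intro exI[of _ "e/2"]) auto
  qed
  define p q where "p = min s t" and "q = max s t"
  have "p \<in> I" "q \<in> I" using assms(3,4) unfolding p_def q_def by (auto simp: min_def max_def)
  then obtain d e where de: "d > 0" "p - d \<in> I" "e > 0" "q + e \<in> I" using ex by metis
  then have "{p - d..q + e} \<subseteq> I"
    using assms(2) by (meson atLeastAtMost_iff is_interval_1 subsetI)
  then show ?thesis
    by (rule that) (use de in \<open>auto simp: p_def q_def min_def max_def\<close>)
qed

lemma antiderivative_on_interval:
  fixes g :: "real \<Rightarrow> 'a::banach"
  assumes "open I" "is_interval I" "x0 \<in> I" "continuous_on I g"
  shows "\<exists>F. F x0 = 0 \<and> (\<forall>t\<in>I. (F has_vector_derivative g t) (at t))"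
proof -
  \<comment> \<open>An integral over \<open>{a..b}\<close> with \<open>b < a\<close> is 0, so this
    difference is the oriented integral from \<open>x0\<close> to \<open>t\<close>.\<close>
  define F where "F t = integral {x0..t} g - integral {t..x0} g" for t
  have "(F has_vector_derivative g t) (at t)" if t: "t \<in> I" for t
  proof -
    obtain a b where sub: "{a..b} \<subseteq> I" and ab: "a < t" "t < b" "a < x0" "x0 < b"
      by (rule open_interval_surround[OF assms(1,2) t assms(3)])
    have cont: "continuous_on {a..b} g" using assms(4) sub continuous_on_subset by blast
    have int: "g integrable_on {c..d}" if "a \<le> c" "d \<le> b" for c d
      using cont that by (intro integrable_continuous_real) (auto elim: continuous_on_subset)
    have F_eq: "F s = integral {a..s} g - integral {a..x0} g" if "s \<in> {a<..<b}" for s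
    proof (cases "x0 \<le> s")
      case True
      have "integral {a..x0} g + integral {x0..s} g = integral {a..s} g"
        using True that ab by (intro Henstock_Kurzweil_Integration.integral_combine int) auto
      moreover have "integral {s..x0} g = 0" using True by (cases "s = x0") auto
      ultimately show ?thesis unfolding F_def by (simp add: algebra_simps)
    next
      case False
      have "integral {a..s} g + integral {s..x0} g = integral {a..x0} g"
        using False that ab by (intro Henstock_Kurzweil_Integration.integral_combine int) auto
      moreover have "integral {x0..s} g = 0" using False by auto
      ultimately show ?thesis unfolding F_def by (simp add: algebra_simps)
    qed
    have "((\<lambda>u. integral {a..u} g) has_vector_derivative g t) (at t within {a..b})"
      using cont ab by (intro integral_has_vector_derivative) auto
    then have "((\<lambda>u. integral {a..u} g) has_vector_derivative g t) (at t)"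
      using ab by (simp add: at_within_Icc_at)
    then have "((\<lambda>u. integral {a..u} g - integral {a..x0} g) has_vector_derivative g t) (at t)"
      by (auto intro!: derivative_eq_intros)
    then show ?thesis
      using has_vector_derivative_transform_within_open[where S = "{a<..<b}" and g = F] F_eq ab by auto
  qed
  moreover have "F x0 = 0" by (simp add: F_def)
  ultimately show ?thesis by blast
qed

text \<open>One step of the Picard estimate: integrating the n-th power of the distance to
  \<open>x0\<close> gains a factor 1/(n+1), and these factors build up the factorial.\<close>

lemma norm_le_power_Suc:
  fixes F :: "real \<Rightarrow> 'a::real_normed_vector"
  assumes I: "\<And>s. s \<in> {a..b} \<Longrightarrow> (F has_vector_derivative g s) (at s)" and x0: "F x0 = 0" "x0 \<in> {a..b}"
    and bd: "\<And>s. s \<in> {a..b} \<Longrightarrow> norm (g s) \<le> C * \<bar>s - x0\<bar> ^ n" and t: "t \<in> {a..b}"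
  shows "norm (F t) \<le> C * \<bar>t - x0\<bar> ^ Suc n / Suc n"
proof -
  have cont: "continuous_on {a..b} F"
    using I has_vector_derivative_continuous by (intro continuous_at_imp_continuous_on) blast
  consider "t = x0" | "x0 < t" | "t < x0" by linarith
  then show ?thesis
  proof cases
    case 1
    then show ?thesis using x0 by simp
  next
    case 2
    have "norm (F t - F x0) \<le> C * (t - x0) ^ Suc n / Suc n - C * (x0 - x0) ^ Suc n / Suc n"
    proof (rule differentiable_bound_general[OF 2])
      show "((\<lambda>s. C * (s - x0) ^ Suc n / Suc n) has_vector_derivative C * (s - x0) ^ n) (at s)" for s
        unfolding has_real_derivative_iff_has_vector_derivative[symmetric]
        by (auto intro!: derivative_eq_intros simp del: power_Suc)
      show "norm (g s) \<le> C * (s - x0) ^ n" if "x0 < s" "s < t" for s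
        using bd[of s] that t x0 by auto
    qed (use t x0 I in \<open>auto intro!: continuous_intros continuous_on_subset[OF cont]\<close>)
    then show ?thesis using 2 x0 by simp
  next
    case 3
    have "norm (F x0 - F t) \<le> - (C * (x0 - x0) ^ Suc n / Suc n) - - (C * (x0 - t) ^ Suc n / Suc n)"
    proof (rule differentiable_bound_general[OF 3])
      show "((\<lambda>s. - (C * (x0 - s) ^ Suc n / Suc n)) has_vector_derivative C * (x0 - s) ^ n) (at s)" for s
        unfolding has_real_derivative_iff_has_vector_derivative[symmetric]
        by (auto intro!: derivative_eq_intros simp del: power_Suc)
      show "norm (g s) \<le> C * (x0 - s) ^ n" if "t < s" "s < x0" for s
        using bd[of s] that t x0 by (auto simp: abs_minus_commute)
    qed (use t x0 I in \<open>auto intro!: continuous_intros continuous_on_subset[OF cont]\<close>)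
    then show ?thesis using 3 x0 by simp
  qed
qed

locale linear_ode =
  fixes I :: "real set" and x0 :: real and A :: "real \<Rightarrow> 'a::euclidean_space \<Rightarrow> 'a"
  assumes open_I: "open I" and int_I: "is_interval I" and x0: "x0 \<in> I"
    and lin: "\<And>t. t \<in> I \<Longrightarrow> linear (A t)" and cont: "\<And>v. continuous_on I (\<lambda>t. A t v)"
begin

text \<open>Continuity of \<open>A\<close> is assumed for each fixed vector only. Expanding in the
  standard basis extends it to moving arguments and yields a norm bound on compact
  intervals.\<close>

lemma A_expand: "t \<in> I \<Longrightarrow> A t v = (\<Sum>b\<in>Basis. (v \<bullet> b) *\<^sub>R A t b)"
  using lin[of t] by (metis (no_types, lifting) euclidean_representation linear_scale linear_sum sum.cong)

lemma continuous_on_A: "continuous_on I F \<Longrightarrow> continuous_on I (\<lambda>t. A t (F t))"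
  using cont by (subst continuous_on_cong[OF refl A_expand]) (auto intro!: continuous_intros)

definition anti :: "(real \<Rightarrow> 'a) \<Rightarrow> real \<Rightarrow> 'a" where
  "anti g = (SOME F. F x0 = 0 \<and> (\<forall>t\<in>I. (F has_vector_derivative g t) (at t)))"

lemma anti:
  assumes "continuous_on I g"
  shows "anti g x0 = 0" "t \<in> I \<Longrightarrow> (anti g has_vector_derivative g t) (at t)"
  using someI_ex[OF antiderivative_on_interval[OF open_I int_I x0 assms]] unfolding anti_def by auto

text \<open>These are the terms of the Peano-Baker series, that is, the differences of successive
  Picard iterates; the solution is their sum.\<close>

primrec picard :: "'a \<Rightarrow> nat \<Rightarrow> real \<Rightarrow> 'a" where
  "picard v 0 = (\<lambda>t. v)"
| "picard v (Suc n) = anti (\<lambda>t. A t (picard v n t))"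

lemma continuous_on_picard: "continuous_on I (picard v n)"
proof (induction n)
  case (Suc n)
  then show ?case
    using anti(2)[OF continuous_on_A[OF Suc]]
    by (intro continuous_at_imp_continuous_on) (auto intro: has_vector_derivative_continuous)
qed simp

lemma picard_Suc:
  "picard v (Suc n) x0 = 0"
  "t \<in> I \<Longrightarrow> (picard v (Suc n) has_vector_derivative A t (picard v n t)) (at t)"
  using anti[OF continuous_on_A[OF continuous_on_picard]] by auto

lemma norm_A_bound:
  assumes "{a..b} \<subseteq> I"
  obtains M where "M \<ge> 0" "\<And>t v. t \<in> {a..b} \<Longrightarrow> norm (A t v) \<le> M * norm v"
proof -
  have "\<exists>C. \<forall>t\<in>{a..b}. norm (A t v) \<le> C" for v
    using compact_imp_bounded[OF compact_continuous_image[OF continuous_on_subset[OF cont assms] compact_Icc]]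
    unfolding bounded_iff by auto
  then obtain C where C: "\<And>v t. t \<in> {a..b} \<Longrightarrow> norm (A t v) \<le> C v" by metis
  have "norm (A t v) \<le> (\<Sum>b\<in>Basis. \<bar>C b\<bar>) * norm v" if "t \<in> {a..b}" for t v
  proof -
    have "norm (A t v) \<le> (\<Sum>b\<in>Basis. norm ((v \<bullet> b) *\<^sub>R A t b))"
      unfolding A_expand[OF subsetD[OF assms that], of v] by (rule norm_sum)
    also have "\<dots> \<le> (\<Sum>b\<in>Basis. \<bar>C b\<bar> * norm v)"
    proof (rule sum_mono)
      fix b :: 'a assume "b \<in> Basis"
      then have "norm ((v \<bullet> b) *\<^sub>R A t b) \<le> norm v * \<bar>C b\<bar>"
        using C[OF that, of b] Basis_le_norm[of b v] by (auto intro!: mult_mono)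
      then show "norm ((v \<bullet> b) *\<^sub>R A t b) \<le> \<bar>C b\<bar> * norm v" by (simp add: mult.commute)
    qed
    finally show ?thesis by (simp add: sum_distrib_right)
  qed
  then show ?thesis by (intro that[of "\<Sum>b\<in>Basis. \<bar>C b\<bar>"]) (auto intro: sum_nonneg)
qed

lemma solution_on_Icc:
  assumes ab: "{a..b} \<subseteq> I" "x0 \<in> {a..b}" "t \<in> {a<..<b}"
  shows "(\<lambda>n. picard v n t) sums (\<Sum>n. picard v n t)"
    and "((\<lambda>t. \<Sum>n. picard v n t) has_vector_derivative A t (\<Sum>n. picard v n t)) (at t)"
proof -
  obtain M where M: "M \<ge> 0" "\<And>t v. t \<in> {a..b} \<Longrightarrow> norm (A t v) \<le> M * norm v"
    using norm_A_bound[OF ab(1)] by blast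
  have bd: "norm (picard v n s) \<le> norm v * M ^ n / fact n * \<bar>s - x0\<bar> ^ n" if "s \<in> {a..b}" for s n
    using that
  proof (induction n arbitrary: s)
    case (Suc n)
    have "norm (picard v (Suc n) s) \<le> (M * (norm v * M ^ n / fact n)) * \<bar>s - x0\<bar> ^ Suc n / Suc n"
    proof (rule norm_le_power_Suc[where g = "\<lambda>s. A s (picard v n s)"])
      show "norm (A r (picard v n r)) \<le> M * (norm v * M ^ n / fact n) * \<bar>r - x0\<bar> ^ n" if "r \<in> {a..b}" for r
        using order_trans[OF M(2)[OF that] mult_left_mono[OF Suc.IH[OF that] M(1)]] by (simp add: mult.assoc)
    qed (use Suc.prems ab picard_Suc in \<open>auto simp del: picard.simps\<close>)
    also have "\<dots> = norm v * M ^ Suc n / fact (Suc n) * \<bar>s - x0\<bar> ^ Suc n" by (simp add: field_simps)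
    finally show ?case .
  qed simp
  let ?m = "\<lambda>n. norm v * ((M * (b - a)) ^ n / fact n)"
  have bd': "norm (picard v n s) \<le> ?m n" if "s \<in> {a..b}" for s n
  proof -
    have "norm v * M ^ n / fact n * \<bar>s - x0\<bar> ^ n \<le> norm v * M ^ n / fact n * (b - a) ^ n"
      using that ab M(1) by (intro mult_left_mono power_mono) auto
    with bd[OF that, of n] show ?thesis by (simp add: power_mult_distrib mult.assoc)
  qed
  have sm: "summable ?m"
    using summable_exp[of "M * (b - a)"] by (intro summable_mult) (simp add: divide_inverse mult.commute)
  define S where "S s = (\<Sum>n. picard v n s)" for s
  have sums: "(\<lambda>n. picard v n s) sums S s" if "s \<in> {a..b}" for s
    unfolding S_def using bd'[OF that] by (intro summable_sums summable_comparison_test'[OF sm]) auto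
  then show "(\<lambda>n. picard v n t) sums (\<Sum>n. picard v n t)" using ab unfolding S_def by auto
  have ul: "uniform_limit {a..b} (\<lambda>n s. \<Sum>i<n. picard v i s) S sequentially"
    unfolding S_def by (rule Weierstrass_m_test[OF bd' sm])
  \<comment> \<open>The derivative of term n is \<open>A\<close> applied to term n - 1, and term 0
    is constant. The differentiated series is therefore \<open>A\<close> applied to the original
    one, shifted by one index.\<close>
  define f' where "f' n s = (case n of 0 \<Rightarrow> 0 | Suc m \<Rightarrow> A s (picard v m s))" for n s
  have "\<exists>g. \<forall>s\<in>{a..b}. (\<lambda>n. picard v n s) sums g s \<and>
      (g has_derivative (\<lambda>h. h *\<^sub>R A s (S s))) (at s within {a..b})"
  proof (rule has_derivative_series[where f' = "\<lambda>n s h. h *\<^sub>R f' n s"])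
    show "(picard v n has_derivative (\<lambda>h. h *\<^sub>R f' n s)) (at s within {a..b})" if "s \<in> {a..b}" for n s
    proof (cases n)
      case (Suc m)
      have "s \<in> I" using that ab by auto
      from has_derivative_at_withinI[OF picard_Suc(2)[OF this, of v m, unfolded has_vector_derivative_def]]
      show ?thesis unfolding Suc f'_def by simp
    qed (simp add: f'_def)
    show "\<forall>\<^sub>F n in sequentially. \<forall>s\<in>{a..b}. \<forall>h. norm ((\<Sum>i<n. h *\<^sub>R f' i s) - h *\<^sub>R A s (S s)) \<le> e * norm h"
      if "e > 0" for e
    proof -
      \<comment> \<open>The bound \<open>M\<close> may be 0, hence the division by
        \<open>M + 1\<close>.\<close>
      have "e / (M + 1) > 0" using that M by simp
      from uniform_limitD[OF ul this]
      obtain N where N: "\<And>n s. n \<ge> N \<Longrightarrow> s \<in> {a..b} \<Longrightarrow> norm ((\<Sum>i<n. picard v i s) - S s) < e / (M + 1)"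
        unfolding eventually_sequentially dist_norm by blast
      have "norm ((\<Sum>i<n. h *\<^sub>R f' i s) - h *\<^sub>R A s (S s)) \<le> e * norm h"
        if n: "n \<ge> Suc N" and s: "s \<in> {a..b}" for n s h
      proof -
        obtain m where m: "n = Suc m" "m \<ge> N" using n by (cases n) auto
        have sI: "s \<in> I" using s ab by auto
        have "(\<Sum>i<n. f' i s) = A s (\<Sum>i<m. picard v i s)"
          unfolding m(1) sum.lessThan_Suc_shift by (simp add: f'_def linear_sum[OF lin[OF sI]])
        then have "(\<Sum>i<n. h *\<^sub>R f' i s) - h *\<^sub>R A s (S s) = h *\<^sub>R A s ((\<Sum>i<m. picard v i s) - S s)"
          by (simp add: scaleR_sum_right[symmetric] linear_diff[OF lin[OF sI]] algebra_simps)
        then have "norm ((\<Sum>i<n. h *\<^sub>R f' i s) - h *\<^sub>R A s (S s)) =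
            \<bar>h\<bar> * norm (A s ((\<Sum>i<m. picard v i s) - S s))" by simp
        also have "\<dots> \<le> \<bar>h\<bar> * (M * (e / (M + 1)))"
        proof (rule mult_left_mono[OF order_trans[OF M(2)[OF s]]])
          show "M * norm ((\<Sum>i<m. picard v i s) - S s) \<le> M * (e / (M + 1))"
            using N[OF m(2) s] M(1) by (intro mult_left_mono) auto
        qed simp
        also have "M * (e / (M + 1)) \<le> e" using M(1) \<open>e > 0\<close> by (simp add: field_simps)
        then have "\<bar>h\<bar> * (M * (e / (M + 1))) \<le> \<bar>h\<bar> * e" by (rule mult_left_mono) simp
        also have "\<dots> = e * norm h" by simp
        finally show ?thesis .
      qed
      then show ?thesis unfolding eventually_sequentially by blast
    qed
    show "x0 \<in> {a..b}" "(\<lambda>n. picard v n x0) sums S x0" using sums ab by auto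
  qed auto
  then obtain g where g: "\<And>s. s \<in> {a..b} \<Longrightarrow> (\<lambda>n. picard v n s) sums g s"
      "\<And>s. s \<in> {a..b} \<Longrightarrow> (g has_derivative (\<lambda>h. h *\<^sub>R A s (S s))) (at s within {a..b})" by blast
  have "g s = S s" if "s \<in> {a..b}" for s using g(1)[OF that] sums[OF that] sums_unique2 by blast
  moreover have "(g has_vector_derivative A t (S t)) (at t)"
    using g(2)[of t] ab by (simp add: has_vector_derivative_def at_within_Icc_at)
  ultimately show "((\<lambda>t. \<Sum>n. picard v n t) has_vector_derivative A t (\<Sum>n. picard v n t)) (at t)"
    using has_vector_derivative_transform_within_open[where S = "{a<..<b}" and g = S and f = g] ab
    unfolding S_def by auto
qed

text \<open>The series does not depend on the compact interval on which it was estimated, so the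
  local statements combine to a solution on all of \<open>I\<close>.\<close>

theorem solution_exists: "\<exists>Z. Z x0 = v \<and> (\<forall>t\<in>I. (Z has_vector_derivative A t (Z t)) (at t))"
proof -
  have "((\<lambda>t. \<Sum>n. picard v n t) has_vector_derivative A t (\<Sum>n. picard v n t)) (at t)" if t: "t \<in> I" for t
  proof -
    obtain a b where "{a..b} \<subseteq> I" "a < t" "t < b" "a < x0" "x0 < b"
      by (rule open_interval_surround[OF open_I int_I t x0])
    then show ?thesis by (intro solution_on_Icc(2)) auto
  qed
  moreover have "(\<Sum>n. picard v n x0) = v"
  proof -
    have "picard v n x0 = (if n = 0 then v else 0)" for n
      by (cases n) (simp_all del: picard.simps(2) add: picard_Suc)
    then show ?thesis using suminf_finite[of "{0::nat}" "\<lambda>n. picard v n x0"] by simp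
  qed
  ultimately show ?thesis by (intro exI[of _ "\<lambda>t. \<Sum>n. picard v n t"]) auto
qed

end

subsection \<open>Moving frames and osculating spaces\<close>

text \<open>Back substitution: subtracting a multiple of \<open>b m\<close> kills the highest
  remaining functional \<open>q m\<close> without disturbing the later ones. It applies to a frame
  and equally to the derivatives of a lift, so both give the same flag.\<close>

lemma triangular_span:
  fixes b :: "nat \<Rightarrow> 'v::real_vector" and q :: "nat \<Rightarrow> 'v \<Rightarrow> real"
  assumes lin: "\<And>l. l \<le> k \<Longrightarrow> linear (q l)"
    and inj: "\<And>w. (\<And>l. l \<le> k \<Longrightarrow> q l w = 0) \<Longrightarrow> w = 0"
    and tri: "\<And>l j. j < l \<Longrightarrow> l \<le> k \<Longrightarrow> q l (b j) = 0"
    and diag: "\<And>j. j \<le> k \<Longrightarrow> q j (b j) \<noteq> 0"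
    and "i \<le> k"
  shows "span (b ` {..i}) = {w. \<forall>l\<le>k. i < l \<longrightarrow> q l w = 0}"
proof
  have "subspace {w. \<forall>l\<le>k. i < l \<longrightarrow> q l w = 0}"
    using lin by (auto simp: subspace_def linear_0 linear_add linear_scale)
  moreover have "b ` {..i} \<subseteq> {w. \<forall>l\<le>k. i < l \<longrightarrow> q l w = 0}"
    using tri by auto
  ultimately show "span (b ` {..i}) \<subseteq> {w. \<forall>l\<le>k. i < l \<longrightarrow> q l w = 0}"
    by (rule span_minimal[rotated])
  have "w \<in> span (b ` {..<m})" if "m \<le> Suc k" "\<forall>l\<le>k. m \<le> l \<longrightarrow> q l w = 0" for m w
    using that
  proof (induction m arbitrary: w)
    case 0
    then show ?case using inj[of w] by auto
  next
    case (Suc m)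
    let ?w = "w - (q m w / q m (b m)) *\<^sub>R b m"
    have "q l ?w = 0" if "l \<le> k" "m \<le> l" for l
    proof (cases "l = m")
      case True
      then show ?thesis using diag[of m] lin[of m] that by (simp add: linear_diff linear_scale)
    next
      case False
      then show ?thesis using tri[of m l] lin[of l] that Suc.prems by (simp add: linear_diff linear_scale)
    qed
    then have "?w \<in> span (b ` {..<m})" using Suc by simp
    then have "?w \<in> span (b ` {..<Suc m})"
      by (rule subsetD[OF span_mono, rotated]) auto
    moreover have "(q m w / q m (b m)) *\<^sub>R b m \<in> span (b ` {..<Suc m})"
      by (intro span_scale span_base) auto
    ultimately show ?case by (metis (no_types, lifting) diff_add_cancel span_add)
  qed
  from this[of "Suc i"] show "{w. \<forall>l\<le>k. i < l \<longrightarrow> q l w = 0} \<subseteq> span (b ` {..i})"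
    using \<open>i \<le> k\<close> by (auto simp: lessThan_Suc_atMost Suc_le_eq)
qed

lemma is_basisI:
  fixes b :: "nat \<Rightarrow> 'v::euclidean_space"
  assumes "DIM('v) = k + 1" "span (b ` {..k}) = UNIV"
  shows "is_basis k b"
proof -
  have "DIM('v) \<le> card (b ` {..k})"
    using assms(2) dim_le_card[of UNIV "b ` {..k}"] by simp
  then have c: "card (b ` {..k}) = card {..k}"
    using card_image_le[of "{..k}" b] assms(1) by simp
  have "independent (b ` {..k})"
    using card_le_dim_spanning[of "b ` {..k}" UNIV] assms c by simp
  then show ?thesis
    using c assms(2) eq_card_imp_inj_on[of "{..k}" b] unfolding is_basis_def by simp
qed

lemma dual_basis_expansion:
  fixes e :: "nat \<Rightarrow> 'v::euclidean_space" and c :: "nat \<Rightarrow> 'v \<Rightarrow> real"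
  assumes lin: "\<And>i. i \<le> k \<Longrightarrow> linear (c i)"
    and dual: "\<And>i j. i \<le> k \<Longrightarrow> j \<le> k \<Longrightarrow> c i (e j) = (if i = j then 1 else 0)"
    and "DIM('v) = k + 1"
  shows "v = (\<Sum>j\<le>k. c j v *\<^sub>R e j)"
proof -
  have ind: "independent (e ` {..k})"
  proof
    assume "dependent (e ` {..k})"
    then obtain j where j: "j \<le> k" "e j \<in> span (e ` {..k} - {e j})" unfolding dependent_def by auto
    have "subspace {w. c j w = 0}" using lin[OF j(1)] by (auto simp: subspace_def linear_0 linear_add linear_scale)
    moreover have "e ` {..k} - {e j} \<subseteq> {w. c j w = 0}" using dual j(1) by auto
    ultimately have "span (e ` {..k} - {e j}) \<subseteq> {w. c j w = 0}" by (rule span_minimal[rotated])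
    with j dual[of j j] show False by auto
  qed
  have inj: "inj_on e {..k}" using dual by (intro inj_onI) (metis atMost_iff zero_neq_one)
  have "span (e ` {..k}) = UNIV"
    using card_ge_dim_independent[of "e ` {..k}" UNIV] ind assms(3) card_image[OF inj] by auto
  then have "v \<in> range (\<lambda>u. \<Sum>w\<in>e ` {..k}. u w *\<^sub>R w)"
    using span_finite[of "e ` {..k}"] by auto
  then obtain u where "v = (\<Sum>w\<in>e ` {..k}. u w *\<^sub>R w)" by auto
  then have v: "v = (\<Sum>j\<le>k. u (e j) *\<^sub>R e j)" by (simp add: sum.reindex[OF inj])
  have "c i v = u (e i)" if "i \<le> k" for i
    using that unfolding v
    by (subst linear_sum[OF lin]) (auto simp: linear_scale[OF lin] dual if_distrib sum.delta cong: if_cong)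
  then show ?thesis using v by (metis (no_types, lifting) atMost_iff sum.cong)
qed

text \<open>Differentiation is prescribed on the coframe: \<open>e' = e W\<close> and duality amount
  to \<open>c' = - W c\<close>, and the flag as well as the invariant forms are expressed in the
  coordinates \<open>c\<close>.\<close>

locale moving_frame =
  fixes k :: nat and I :: "real set" and e :: "nat \<Rightarrow> real \<Rightarrow> 'v::euclidean_space"
    and c :: "nat \<Rightarrow> real \<Rightarrow> 'v \<Rightarrow> real" and W :: "real \<Rightarrow> nat \<Rightarrow> nat \<Rightarrow> real"
  assumes dim: "DIM('v) = k + 1" and open_I: "open I"
    and lin: "\<And>x i. x \<in> I \<Longrightarrow> i \<le> k \<Longrightarrow> linear (c i x)"
    and dual: "\<And>x i j. x \<in> I \<Longrightarrow> i \<le> k \<Longrightarrow> j \<le> k \<Longrightarrow> c i x (e j x) = (if i = j then 1 else 0)"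
    and deriv_c: "\<And>x i v. x \<in> I \<Longrightarrow> i \<le> k \<Longrightarrow>
      ((\<lambda>x. c i x v) has_real_derivative - (\<Sum>j\<le>k. W x i j * c j x v)) (at x)"
begin

lemma expand: "x \<in> I \<Longrightarrow> v = (\<Sum>j\<le>k. c j x v *\<^sub>R e j x)"
  using dual_basis_expansion[of k "\<lambda>i. c i x" "\<lambda>i. e i x"] lin dual dim by blast

lemma zeroI: "x \<in> I \<Longrightarrow> (\<And>l. l \<le> k \<Longrightarrow> c l x w = 0) \<Longrightarrow> w = 0"
  using expand[of x w] by simp

text \<open>The derivative of \<open>c\<close> is known on fixed vectors only, so the moving vector
  is expanded in the standard basis and the product rule is applied to each summand.\<close>

lemma deriv_c_comp:
  assumes "x \<in> I" "i \<le> k" "(v has_vector_derivative v') (at x)"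
  shows "((\<lambda>x. c i x (v x)) has_real_derivative c i x v' - (\<Sum>j\<le>k. W x i j * c j x (v x))) (at x)"
proof -
  have ex: "c j y w = (\<Sum>b\<in>Basis. (w \<bullet> b) * c j y b)" if "y \<in> I" "j \<le> k" for y w j
    using linear_sum[OF lin[OF that], of "\<lambda>b. (w \<bullet> b) *\<^sub>R b" Basis]
    by (simp add: linear_scale[OF lin[OF that]] euclidean_representation)
  have d: "((\<lambda>x. v x \<bullet> b) has_real_derivative v' \<bullet> b) (at x)" for b
    using has_vector_derivative_scaleR assms(3)
    unfolding has_real_derivative_iff_has_vector_derivative
    by (intro bounded_linear.has_vector_derivative[OF bounded_linear_inner_left])
  have "((\<lambda>x. \<Sum>b\<in>Basis. (v x \<bullet> b) * c i x b) has_real_derivative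
      (\<Sum>b\<in>Basis. (v' \<bullet> b) * c i x b + - (\<Sum>j\<le>k. W x i j * c j x b) * (v x \<bullet> b))) (at x)"
    using d deriv_c[OF assms(1,2)] by (intro DERIV_sum DERIV_mult)
  moreover have "(\<Sum>b\<in>Basis. (v' \<bullet> b) * c i x b + - (\<Sum>j\<le>k. W x i j * c j x b) * (v x \<bullet> b))
      = c i x v' - (\<Sum>j\<le>k. W x i j * c j x (v x))"
  proof -
    have "(\<Sum>b\<in>Basis. (\<Sum>j\<le>k. W x i j * c j x b) * (v x \<bullet> b)) =
        (\<Sum>j\<le>k. W x i j * (\<Sum>b\<in>Basis. (v x \<bullet> b) * c j x b))"
      unfolding sum_distrib_left sum_distrib_right
      by (subst sum.swap) (simp add: ac_simps)
    also have "\<dots> = (\<Sum>j\<le>k. W x i j * c j x (v x))"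
      using ex[OF assms(1)] by simp
    finally show ?thesis
      unfolding sum.distrib using ex[OF assms(1,2), of v'] by (simp add: sum_negf)
  qed
  ultimately have "((\<lambda>x. \<Sum>b\<in>Basis. (v x \<bullet> b) * c i x b) has_real_derivative
      c i x v' - (\<Sum>j\<le>k. W x i j * c j x (v x))) (at x)" by simp
  from has_field_derivative_transform_within_open[OF this open_I assms(1) ex[OF _ assms(2), symmetric]]
  show ?thesis .
qed

lemma frame_span: "x \<in> I \<Longrightarrow> i \<le> k \<Longrightarrow> span ((\<lambda>j. e j x) ` {..i}) = {w. \<forall>l\<le>k. i < l \<longrightarrow> c l x w = 0}"
  using lin dual zeroI by (intro triangular_span) auto

lemma frame_basis: "x \<in> I \<Longrightarrow> is_basis k (\<lambda>j. e j x)"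
  using dim by (intro is_basisI) (auto simp: frame_span)

end

text \<open>The conditions on \<open>W\<close> say that differentiation raises the flag by at most
  one step and does so with coefficient 1.\<close>

locale osculating_frame = moving_frame k I e c W
  for k and I :: "real set" and e :: "nat \<Rightarrow> real \<Rightarrow> 'v::euclidean_space" and c W +
  fixes \<gamma> :: "real \<Rightarrow> 'v set"
  assumes W_zero: "\<And>x i j. x \<in> I \<Longrightarrow> i \<le> k \<Longrightarrow> j + 1 < i \<Longrightarrow> W x i j = 0"
    and W_one: "\<And>x j. x \<in> I \<Longrightarrow> j < k \<Longrightarrow> W x (Suc j) j = 1"
    and smooth_e0: "smooth_on I (e 0)"
    and gamma: "\<And>x. x \<in> I \<Longrightarrow> \<gamma> x = span {e 0 x}"
begin

text \<open>If the coordinates of \<open>u\<close> above \<open>i\<close> vanish identically, so do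
  their derivatives; this expresses the same coordinates of \<open>u'\<close> through
  \<open>W\<close>. By the shape of \<open>W\<close> nothing survives above \<open>i + 1\<close>,
  and coordinate \<open>i + 1\<close> of \<open>u'\<close> equals coordinate \<open>i\<close> of
  \<open>u\<close>.\<close>

lemma lift_coord:
  assumes "curve_lift J \<gamma> v" "x \<in> J \<inter> I" "i \<le> k"
  shows "(\<forall>l\<le>k. i < l \<longrightarrow> c l x ((vderiv ^^ i) v x) = 0) \<and> c i x ((vderiv ^^ i) v x) \<noteq> 0"
  using assms(2,3)
proof (induction i arbitrary: x)
  case 0
  have "v x \<in> span {e 0 x}" "v x \<noteq> 0"
    using assms(1) 0 gamma[of x] span_base[of "v x" "{v x}"] unfolding curve_lift_def by auto
  then obtain r where "v x = r *\<^sub>R e 0 x" "r \<noteq> 0" by (auto simp: span_singleton)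
  then show ?case
    using 0 dual[of x _ 0] linear_scale[OF lin, of x] by auto
next
  case (Suc i)
  have J: "open J" "smooth_on J v" using assms(1) unfolding curve_lift_def by auto
  define u where "u = (vderiv ^^ i) v"
  have u': "(u has_vector_derivative (vderiv ^^ Suc i) v x) (at x)"
    using smooth_on_vderiv(2)[OF J(1) smooth_on_vderiv_funpow[OF J, of i], of x] Suc.prems
    by (simp add: u_def)
  have IH: "c l y (u y) = 0" if "y \<in> J \<inter> I" "l \<le> k" "i < l" for l y
    using Suc.IH[of y] that Suc.prems unfolding u_def by auto
  have eq: "c l x ((vderiv ^^ Suc i) v x) = (\<Sum>j\<le>k. W x l j * c j x (u x))" if "l \<le> k" "i < l" for l
  proof -
    have "((\<lambda>x. 0) has_real_derivative c l x ((vderiv ^^ Suc i) v x) - (\<Sum>j\<le>k. W x l j * c j x (u x))) (at x)"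
    proof (rule has_field_derivative_transform_within_open[where S = "J \<inter> I"])
      show "((\<lambda>x. c l x (u x)) has_real_derivative
          c l x ((vderiv ^^ Suc i) v x) - (\<Sum>j\<le>k. W x l j * c j x (u x))) (at x)"
        using deriv_c_comp[OF _ that(1) u'] Suc.prems by simp
    qed (use IH[OF _ that] J open_I Suc.prems in auto)
    from DERIV_unique[OF this DERIV_const] show ?thesis by simp
  qed
  have "c l x ((vderiv ^^ Suc i) v x) = 0" if "l \<le> k" "Suc i < l" for l
  proof -
    have "W x l j * c j x (u x) = 0" if "j \<le> k" for j
      using W_zero[of x l j] IH[of x j] \<open>l \<le> k\<close> \<open>Suc i < l\<close> that Suc.prems by (cases "j \<le> i") auto
    then have "(\<Sum>j\<le>k. W x l j * c j x (u x)) = 0" by (intro sum.neutral) auto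
    then show ?thesis using eq[of l] that by simp
  qed
  moreover have "c (Suc i) x ((vderiv ^^ Suc i) v x) = c i x (u x)"
  proof -
    have "W x (Suc i) j * c j x (u x) = (if j = i then c i x (u x) else 0)" if "j \<le> k" for j
      using W_zero[of x "Suc i" j] W_one[of x i] IH[of x j] that Suc.prems
      by (cases j i rule: linorder_cases) auto
    then show ?thesis using eq[of "Suc i"] Suc.prems by (simp add: sum.delta)
  qed
  ultimately show ?case using Suc.IH[of x] Suc.prems unfolding u_def by auto
qed

lemma lift_span:
  assumes "curve_lift J \<gamma> v" "x \<in> J \<inter> I" "i \<le> k"
  shows "span ((\<lambda>j. (vderiv ^^ j) v x) ` {..i}) = {w. \<forall>l\<le>k. i < l \<longrightarrow> c l x w = 0}"
  using lin zeroI lift_coord[OF assms(1,2)] assms(2,3) by (intro triangular_span) auto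

lemma curve_lift_e0: "curve_lift I \<gamma> (e 0)"
proof -
  have "e 0 x \<noteq> 0" if "x \<in> I" for x
    using dual[of x 0 0] linear_0[OF lin, of x 0] that by auto
  then show ?thesis using open_I smooth_e0 gamma unfolding curve_lift_def by auto
qed

text \<open>The right-hand side does not mention a lift, so the union over all lifts in
  \<open>osculating\<close> collapses to it.\<close>

lemma osculating_eq:
  assumes "x \<in> I" "i \<le> k"
  shows "osculating \<gamma> i x = {w. \<forall>l\<le>k. i < l \<longrightarrow> c l x w = 0}"
  using lift_span[of _ _ x i] curve_lift_e0 assms unfolding osculating_def by blast

lemma nondegenerate: "nondegenerate_curve k I \<gamma>"
  unfolding nondegenerate_curve_def
proof (intro ballI exI conjI)
  fix t assume "t \<in> I"
  then show "t \<in> I" "curve_lift I \<gamma> (e 0)" "is_basis k (\<lambda>j. (vderiv ^^ j) (e 0) t)"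
    using curve_lift_e0 lift_span[OF curve_lift_e0, of t k] dim by (auto intro!: is_basisI)
qed

end

subsection \<open>Wilczynski matrices and Gram matrices\<close>

text \<open>For \<open>i + p \<le> k\<close> this is the entry of \<open>y^p\<close> in row
  \<open>i\<close> and column \<open>i + p\<close>, the only non-zero entry of that row.\<close>

definition ycoef :: "nat \<Rightarrow> nat \<Rightarrow> nat \<Rightarrow> real" where
  "ycoef k i p = (\<Prod>m\<in>{i<..i + p}. real m * (real k + 1 - real m))"

lemma ycoef_0 [simp]: "ycoef k i 0 = 1"
  by (simp add: ycoef_def)

lemma ycoef_pos: "i + p \<le> k \<Longrightarrow> ycoef k i p > 0"
  unfolding ycoef_def by (intro prod_pos) auto

lemma ycoef_Suc: "ycoef k i (Suc p) = ycoef k i p * (real (i + p + 1) * (real k + 1 - real (i + p + 1)))"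
proof -
  have "{i<..i + Suc p} = insert (i + p + 1) {i<..i + p}" by auto
  then show ?thesis unfolding ycoef_def by simp
qed

text \<open>The factor \<open>m (k + 1 - m)\<close> is invariant under \<open>m\<close> to
  \<open>k + 1 - m\<close>. In matrix terms, \<open>y^p\<close> is symmetric about the
  antidiagonal.\<close>

lemma ycoef_sym:
  assumes "i + p \<le> k"
  shows "ycoef k (k - (i + p)) p = ycoef k i p"
  unfolding ycoef_def
  by (rule prod.reindex_bij_witness[where i = "\<lambda>m. k + 1 - m" and j = "\<lambda>m. k + 1 - m"])
    (use assms in \<open>auto simp: of_nat_diff algebra_simps\<close>)

lemma mat_power_mat_y:
  "j \<le> k \<Longrightarrow> mat_power k (mat_y k) p i j = (if j = i + p then ycoef k i p else 0)"
proof (induction p arbitrary: j)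
  case (Suc p)
  have "mat_power k (mat_y k) (Suc p) i j = (\<Sum>l\<le>k. if l = i + p then ycoef k i p * mat_y k l j else 0)"
    unfolding mat_power.simps by (intro sum.cong refl) (simp add: Suc.IH)
  also have "\<dots> = (if i + p \<le> k then ycoef k i p * mat_y k (i + p) j else 0)"
    by (simp add: sum.delta')
  also have "\<dots> = (if j = i + Suc p then ycoef k i (Suc p) else 0)"
    using Suc.prems by (auto simp: mat_y_def ycoef_Suc)
  finally show ?case .
qed auto

lemma wilczynski_matrix_eq:
  assumes "i \<le> k" "j \<le> k"
  shows "wilczynski_matrix k \<theta> a b i j =
    (if i = j + 1 then 1 else if i = j then a * (real k - 2 * real i)
     else if i < j then (if j = i + 1 then b else \<theta> (j - i + 1)) * ycoef k i (j - i) else 0)"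
proof -
  have "(\<Sum>p=2..k. \<theta> (p + 1) * mat_power k (mat_y k) p i j) =
      (\<Sum>p=2..k. if p = j - i then (if i < j then \<theta> (j - i + 1) * ycoef k i (j - i) else 0) else 0)"
    using assms by (intro sum.cong) (auto simp: mat_power_mat_y)
  also have "\<dots> = (if i + 2 \<le> j then \<theta> (j - i + 1) * ycoef k i (j - i) else 0)"
    using assms by (auto simp: sum.delta')
  finally have *: "(\<Sum>p=2..k. \<theta> (p + 1) * mat_power k (mat_y k) p i j) = \<dots>" .
  have "mat_y k i j = (if j = i + 1 then ycoef k i 1 else 0)"
    using ycoef_Suc[of k i 0] by (simp add: mat_y_def)
  then show ?thesis
    unfolding wilczynski_matrix_def * by (auto simp: mat_x_def mat_h_def)
qed

text \<open>Up to the sign \<open>(- 1) ^ i\<close>, the differences of \<open>G\<close> are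
  \<open>- r * w i\<close>. As \<open>G\<close> vanishes at both ends, \<open>r\<close> times a sum
  of positive weights is 0.\<close>

lemma alternating_telescope:
  fixes G w :: "nat \<Rightarrow> real"
  assumes "\<And>i. p \<le> i \<Longrightarrow> i \<le> k \<Longrightarrow> G i + G (Suc i) = (- 1) ^ i * r * w i"
    and w: "\<And>i. p \<le> i \<Longrightarrow> i \<le> k \<Longrightarrow> w i > 0" and "p \<le> k" "G p = 0" "G (Suc k) = 0"
  shows "r = 0" "\<And>i. p \<le> i \<Longrightarrow> i \<le> Suc k \<Longrightarrow> G i = 0"
proof -
  have *: "(- 1) ^ i * G i = - r * (\<Sum>m\<in>{p..<i}. w m)" if "p \<le> i" "i \<le> Suc k" for i
    using that
  proof (induction i rule: dec_induct)
    case base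
    then show ?case using assms(4) by simp
  next
    case (step i)
    have "(- 1) ^ Suc i * G (Suc i) = (- 1) ^ Suc i * ((- 1) ^ i * r * w i - G i)"
      using assms(1)[of i] step by simp
    also have "\<dots> = - r * w i + (- 1) ^ i * G i"
      by (simp add: algebra_simps power_mult_distrib[symmetric])
    finally show ?case using step by (simp add: algebra_simps)
  qed
  have "(\<Sum>m\<in>{p..<Suc k}. w m) > 0" using w \<open>p \<le> k\<close> by (intro sum_pos) auto
  then show "r = 0" using *[of "Suc k"] assms(3,5) by auto
  then show "G i = 0" if "p \<le> i" "i \<le> Suc k" for i using *[OF that] by simp
qed

text \<open>No symmetry of \<open>B\<close> enters. The alternating signs on the antidiagonal come
  out of the equation, so that (anti)symmetry of the form is tied to the parity of
  \<open>k\<close>.\<close>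

lemma gram_matrix_levels:
  fixes B :: "nat \<Rightarrow> nat \<Rightarrow> real \<Rightarrow> real"
  assumes J: "open J" "is_interval J"
    and B': "\<And>i j t. i \<le> k \<Longrightarrow> j \<le> k \<Longrightarrow> t \<in> J \<Longrightarrow> (B i j has_real_derivative
      (\<Sum>l\<le>k. wilczynski_matrix k (\<lambda>m. \<theta> m t) (a t) (b t) l i * B l j t) +
      (\<Sum>l\<le>k. wilczynski_matrix k (\<lambda>m. \<theta> m t) (a t) (b t) l j * B i l t)) (at t)"
    and B0: "\<And>i j t. i \<le> k \<Longrightarrow> j \<le> k \<Longrightarrow> t \<in> J \<Longrightarrow> i + j < k \<Longrightarrow> B i j t = 0"
  obtains c where "\<And>i j t. i \<le> k \<Longrightarrow> j \<le> k \<Longrightarrow> t \<in> J \<Longrightarrow> B i j t = (if i + j = k then (- 1) ^ i * c else 0)"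
    and "\<And>p t. 2 \<le> p \<Longrightarrow> p \<le> k \<Longrightarrow> even p \<Longrightarrow> t \<in> J \<Longrightarrow> \<theta> (p + 1) t * c = 0"
proof -
  define W where "W t = wilczynski_matrix k (\<lambda>m. \<theta> m t) (a t) (b t)" for t
  define S where "S i j t = (\<Sum>l\<le>k. W t l i * B l j t) + (\<Sum>l\<le>k. W t l j * B i l t)" for i j t
  have B'S: "(B i j has_real_derivative S i j t) (at t)" if "i \<le> k" "j \<le> k" "t \<in> J" for i j t
    using B'[OF that] unfolding S_def W_def .
  have const: "S i j t = d t"
    if "i \<le> k" "j \<le> k" "t \<in> J" "\<And>s. s \<in> J \<Longrightarrow> B i j s = C s" "(C has_real_derivative d t) (at t)" for i j t C d
    using has_field_derivative_transform_within_open[OF B'S[OF that(1-3)] J(1) that(3,4)] that(5)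
    by (rule DERIV_unique)
  \<comment> \<open>Column \<open>i\<close> of \<open>W\<close> has the single entry 1 below the
    diagonal. If among the rows up to \<open>i\<close> only row \<open>i - p\<close> meets a
    non-zero \<open>X\<close>, the product has just two terms.\<close>
  have col: "(\<Sum>l\<le>k. W t l i * X l) = (if i < k then X (Suc i) else 0) + W t (i - p) i * X (i - p)"
    if h: "i \<le> k" "p \<le> i" and z: "\<And>l. l \<le> i \<Longrightarrow> l \<noteq> i - p \<Longrightarrow> X l = 0" for X and t i p
  proof -
    have "(\<Sum>l\<le>k. W t l i * X l) =
        (\<Sum>l\<le>k. (if l = Suc i then X (Suc i) else 0) + (if l = i - p then W t (i - p) i * X (i - p) else 0))"
    proof (rule sum.cong)
      fix l assume "l \<in> {..k}"
      consider "l = Suc i" | "l > Suc i" | "l \<le> i" by linarith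
      then show "W t l i * X l =
          (if l = Suc i then X (Suc i) else 0) + (if l = i - p then W t (i - p) i * X (i - p) else 0)"
      proof cases
        case 3
        then show ?thesis using z[of l] by (cases "l = i - p") auto
      qed (use h \<open>l \<in> {..k}\<close> in \<open>auto simp: W_def wilczynski_matrix_eq\<close>)
    qed simp
    then show ?thesis using h by (auto simp: sum.distrib sum.delta')
  qed
  \<comment> \<open>The entries on \<open>i + j = k - 1\<close> vanish identically, and so do their
    derivatives; this links neighbours on the main antidiagonal with opposite signs.\<close>
  have anti: "B i (k - i) t = (- 1) ^ i * B 0 k t" if "i \<le> k" "t \<in> J" for i t
    using that
  proof (induction i)
    case (Suc i)
    let ?j = "k - Suc i"
    have ij: "i \<le> k" "?j \<le> k" "Suc ?j = k - i" "i < k" "?j < k" using Suc.prems by auto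
    have "S i ?j t = 0"
      using const[of i ?j t "\<lambda>s. 0" "\<lambda>s. 0"] B0 Suc.prems by auto
    moreover have z: "B l ?j t = 0" if "l \<le> i" for l
      using B0[of l ?j t] that ij Suc.prems by simp
    then have "(\<Sum>l\<le>k. W t l i * B l ?j t) = B (Suc i) ?j t"
      using col[of i 0 "\<lambda>l. B l ?j t" t] ij by simp
    moreover have z: "B i l t = 0" if "l \<le> ?j" for l
      using B0[of i l t] that ij Suc.prems by simp
    then have "(\<Sum>l\<le>k. W t l ?j * B i l t) = B i (k - i) t"
      using col[of ?j 0 "\<lambda>l. B i l t" t] ij by simp
    ultimately have "B (Suc i) ?j t + B i (k - i) t = 0"
      unfolding S_def by simp
    then show ?case using Suc by (simp add: algebra_simps)
  qed simp
  define Lev where "Lev p \<longleftrightarrow> (\<forall>t\<in>J. \<forall>i\<le>k. \<forall>j\<le>k. k < i + j \<longrightarrow> i + j \<le> k + p \<longrightarrow> B i j t = 0)" for p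
  \<comment> \<open>\<open>G p t\<close> runs along the antidiagonal
    \<open>i + j = k + p + 1\<close>, padded by 0 where \<open>j\<close> or \<open>i\<close> would
    exceed \<open>k\<close>. The paddings at \<open>i = p\<close> and \<open>i = k + 1\<close> are
    the boundary values for the telescoping.\<close>
  define G where "G p t i = (if i \<le> p \<or> k < i then 0 else B i (k + p + 1 - i) t)" for p t i
  have step: "S i j t = G p t i + G p t (Suc i) +
      (-1) ^ i * B 0 k t * ((- 1) ^ p * W t (i - p) i + W t (j - p) j)"
    if "Lev p" and h: "i \<le> k" "j \<le> k" "t \<in> J" "i + j = k + p" for p i j t
  proof -
    have "p \<le> i" "p \<le> j" using h by auto
    have "B (i - p) j t = (- 1) ^ (i - p) * B 0 k t"
      using anti[of "i - p" t] h \<open>p \<le> i\<close> by (metis add_diff_cancel_left' add_diff_cancel_right' diff_le_self le_trans Nat.add_diff_assoc2)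
    moreover have "B i (j - p) t = (- 1) ^ i * B 0 k t"
      using anti[of i t] h \<open>p \<le> j\<close> by (metis Nat.add_diff_assoc add_diff_cancel_left' add_diff_cancel_right')
    moreover have "(- 1 :: real) ^ (i - p) = (- 1) ^ i * (- 1) ^ p"
      using \<open>p \<le> i\<close> by (metis (no_types, lifting) le_add_diff_inverse2 minus_one_mult_self mult.assoc mult.right_neutral power_add)
    moreover have "(if i < k then B (Suc i) j t else 0) = G p t (Suc i)"
      using h \<open>p \<le> i\<close> by (auto simp: G_def intro!: arg_cong[where f = "\<lambda>j. B (Suc i) j t"])
    moreover have "(if j < k then B i (Suc j) t else 0) = G p t i"
      using h \<open>p \<le> i\<close> by (auto simp: G_def intro!: arg_cong[where f = "\<lambda>j. B i j t"])
    moreover have "(\<Sum>l\<le>k. W t l i * B l j t) =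
        (if i < k then B (Suc i) j t else 0) + W t (i - p) i * B (i - p) j t"
    proof (rule col[OF h(1) \<open>p \<le> i\<close>])
      show "B l j t = 0" if "l \<le> i" "l \<noteq> i - p" for l
        using \<open>Lev p\<close> h that B0[of l j t] unfolding Lev_def by (cases "l + j < k") auto
    qed
    moreover have "(\<Sum>l\<le>k. W t l j * B i l t) =
        (if j < k then B i (Suc j) t else 0) + W t (j - p) j * B i (j - p) t"
    proof (rule col[OF h(2) \<open>p \<le> j\<close>])
      show "B i l t = 0" if "l \<le> j" "l \<noteq> j - p" for l
        using \<open>Lev p\<close> h that B0[of i l t] unfolding Lev_def by (cases "i + l < k") auto
    qed
    ultimately show ?thesis unfolding S_def by (simp add: algebra_simps)
  qed
  have LevI: "Lev (Suc p)" if "Lev p" "\<And>t i. t \<in> J \<Longrightarrow> p \<le> i \<Longrightarrow> i \<le> Suc k \<Longrightarrow> G p t i = 0" for p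
    unfolding Lev_def
  proof (intro ballI allI impI)
    fix t i j assume h: "t \<in> J" "i \<le> k" "j \<le> k" "k < i + j" "i + j \<le> k + Suc p"
    show "B i j t = 0"
    proof (cases "i + j = k + Suc p")
      case True
      then have "k + p + 1 - i = j" "p < i" using h by auto
      then show ?thesis using that(2)[of t i] h unfolding G_def by auto
    qed (use h that(1) in \<open>auto simp: Lev_def\<close>)
  qed
  have "Lev 0" unfolding Lev_def by auto
  \<comment> \<open>On the main antidiagonal the unknown \<open>r\<close> is the derivative of
    \<open>B 0 k\<close>. The two contributions of \<open>h\<close> cancel because its entries at
    \<open>i\<close> and \<open>k - i\<close> are opposite.\<close>
  have S0: "S 0 k t = 0 \<and> (\<forall>i. 0 \<le> i \<longrightarrow> i \<le> Suc k \<longrightarrow> G 0 t i = 0)" if "t \<in> J" for t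
  proof -
    have eq: "G 0 t i + G 0 t (Suc i) = (- 1) ^ i * S 0 k t * 1" if "i \<le> k" for i
    proof -
      have "S i (k - i) t = (- 1) ^ i * S 0 k t"
        using \<open>t \<in> J\<close> that anti B'S[of 0 k t]
        by (intro const[where C = "\<lambda>s. (- 1) ^ i * B 0 k s" and d = "\<lambda>t. (- 1) ^ i * S 0 k t"])
          (auto intro!: DERIV_cmult)
      moreover have "W t i i + W t (k - i) (k - i) = 0"
        using that by (simp add: W_def wilczynski_matrix_eq of_nat_diff algebra_simps)
      ultimately show ?thesis
        using step[OF \<open>Lev 0\<close>, of i "k - i" t] that \<open>t \<in> J\<close> by simp
    qed
    show ?thesis
      using alternating_telescope[of 0 k "G 0 t" "S 0 k t" "\<lambda>_. 1"] eq by (auto simp: G_def)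
  qed
  then have "Lev 1" using LevI[OF \<open>Lev 0\<close>] by simp
  obtain c where c: "\<And>t. t \<in> J \<Longrightarrow> B 0 k t = c"
  proof -
    have d: "(B 0 k has_real_derivative 0) (at t within J)" if "t \<in> J" for t
      using B'S[of 0 k t] S0[OF that] that by (simp add: has_field_derivative_at_within)
    have "convex J" using J(2) by (simp add: is_interval_convex)
    from has_field_derivative_zero_constant[OF this d] have "\<exists>c. \<forall>t\<in>J. B 0 k t = c" .
    then show ?thesis using that by auto
  qed
  \<comment> \<open>\<open>b\<close> is treated as the coefficient in degree 1, where no Wilczynski
    invariant exists. As 1 is odd, it meets no constraint.\<close>
  define \<tau> where "\<tau> p t = (if p = 1 then b t else \<theta> (p + 1) t)" for p t
  have W\<tau>: "W t (l - p) l = \<tau> p t * ycoef k (l - p) p" if "1 \<le> p" "p \<le> l" "l \<le> k" for t l p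
  proof -
    have "l - p < l" "l = l - p + 1 \<longleftrightarrow> p = 1" "l - (l - p) = p" "l - p \<noteq> l + 1" "l - p \<noteq> l" using that by auto
    then show ?thesis using that by (simp add: W_def \<tau>_def wilczynski_matrix_eq)
  qed
  have Levs: "Lev (Suc p) \<and> (\<forall>t\<in>J. even p \<longrightarrow> \<theta> (p + 1) t * c = 0)" if "Lev p" "1 \<le> p" "p \<le> k" for p
  proof -
    have main: "\<tau> p t * c * ((- 1) ^ p + 1) = 0 \<and> (\<forall>i. p \<le> i \<longrightarrow> i \<le> Suc k \<longrightarrow> G p t i = 0)" if t: "t \<in> J" for t
    proof -
      have eq: "G p t i + G p t (Suc i) = (- 1) ^ i * (- (\<tau> p t * c * ((- 1) ^ p + 1))) * ycoef k (i - p) p"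
        if i: "p \<le> i" "i \<le> k" for i
      proof -
        let ?j = "k + p - i"
        have "S i ?j t = 0"
          using \<open>Lev p\<close> \<open>1 \<le> p\<close> i t by (intro const[where C = "\<lambda>s. 0" and d = "\<lambda>s. 0"]) (auto simp: Lev_def)
        moreover have "W t (i - p) i = \<tau> p t * ycoef k (i - p) p"
          using i \<open>1 \<le> p\<close> W\<tau>[of p i] by simp
        moreover have "W t (?j - p) ?j = \<tau> p t * ycoef k (i - p) p"
          using i \<open>1 \<le> p\<close> ycoef_sym[of "i - p" p k] W\<tau>[of p ?j] by simp
        ultimately show ?thesis
          using step[OF \<open>Lev p\<close>, of i ?j t] i t c[OF t] by (simp add: algebra_simps)
      qed
      have "ycoef k (i - p) p > 0" if "p \<le> i" "i \<le> k" for i using ycoef_pos[of "i - p" p k] that by simp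
      with alternating_telescope[of p k "G p t" "- (\<tau> p t * c * ((- 1) ^ p + 1))" "\<lambda>i. ycoef k (i - p) p"] eq \<open>p \<le> k\<close>
      show ?thesis by (auto simp: G_def)
    qed
    have "\<theta> (p + 1) t * c = 0" if "t \<in> J" "even p" for t
      using main[OF that(1)] that(2) by (cases "p = 1") (auto simp: \<tau>_def)
    then show ?thesis using LevI[OF \<open>Lev p\<close>] main by auto
  qed
  have Lev_all: "Lev p" if "p \<le> Suc k" for p
    using that
  proof (induction p)
    case (Suc p)
    then show ?case
      using \<open>Lev 1\<close> Levs[of p] by (cases "p = 0") auto
  qed (use \<open>Lev 0\<close> in simp)
  show ?thesis
  proof (rule that[of c])
    fix i j t assume h: "i \<le> k" "j \<le> k" "t \<in> J"
    consider "i + j < k" | "i + j = k" | "k < i + j" by linarith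
    then show "B i j t = (if i + j = k then (- 1) ^ i * c else 0)"
    proof cases
      case 2
      then have "j = k - i" by simp
      then show ?thesis using anti[of i t] c h by auto
    next
      case 3
      then show ?thesis using Lev_all[of "Suc k"] Lev_all[of k] h unfolding Lev_def by auto
    qed (use B0 h in auto)
  next
    fix p t assume "2 \<le> p" "p \<le> k" "even p" "t \<in> J"
    then show "\<theta> (p + 1) t * c = 0" using Levs[of p] Lev_all[of p] by auto
  qed
qed

subsection \<open>The normal form of a connection\<close>

text \<open>Recursion along the columns exhibits the entries of the inverse as polynomials in those
  of \<open>M\<close>, from which their smoothness follows.\<close>

fun unitriangular_inverse :: "(nat \<Rightarrow> nat \<Rightarrow> real) \<Rightarrow> nat \<Rightarrow> nat \<Rightarrow> real" where
  "unitriangular_inverse M i j =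
    (if j < i then 0 else if i = j then 1 else - (\<Sum>l<j. unitriangular_inverse M i l * M l j))"

declare unitriangular_inverse.simps [simp del]

lemma unitriangular_inverse_mult:
  assumes "\<And>i. i \<le> k \<Longrightarrow> M i i = 1" "\<And>i j. j < i \<Longrightarrow> M i j = 0" "i \<le> k" "j \<le> k"
  shows "(\<Sum>l\<le>k. unitriangular_inverse M i l * M l j) = (if i = j then 1 else 0)"
proof -
  have "(\<Sum>l\<le>k. unitriangular_inverse M i l * M l j) = (\<Sum>l\<in>{..j}. unitriangular_inverse M i l * M l j)"
    using assms by (intro sum.mono_neutral_right) auto
  also have "\<dots> = (\<Sum>l<j. unitriangular_inverse M i l * M l j) + unitriangular_inverse M i j"
    using assms by (simp add: lessThan_Suc_atMost[symmetric])
  also have "\<dots> = (if i = j then 1 else 0)"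
  proof -
    have "(\<Sum>l<j. unitriangular_inverse M i l * M l j) = 0" if "j \<le> i"
      using that by (intro sum.neutral) (auto simp: unitriangular_inverse.simps[of M i])
    then show ?thesis by (cases i j rule: linorder_cases) (auto simp: unitriangular_inverse.simps[of M i j] unitriangular_inverse.simps[of M j j])
  qed
  finally show ?thesis .
qed

text \<open>
  \<open>T\<close> stands for the total derivative and \<open>\<phi>\<close> for the change of frame; the last equation says that \<open>\<phi>\<close>
  turns the matrix with ones below the diagonal and first row \<open>\<alpha>\<close> into \<open>x + \<Sum> \<tau>\<^sub>r y\<^sup>r\<close>. In degree
  \<open>j - i = d\<close> it is a recursion for the entries of degree \<open>d + 1\<close>, and \<open>\<tau>\<^sub>d\<close> is fixed by the condition
  that the recursion ends with zero.
\<close>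

lemma wilczynski_normal_form:
  fixes T :: "('p \<Rightarrow> real) \<Rightarrow> 'p \<Rightarrow> real" and R :: "('p \<Rightarrow> real) \<Rightarrow> bool"
  assumes Rc: "\<And>r. R (\<lambda>_. r)" and Ra: "\<And>g h. R g \<Longrightarrow> R h \<Longrightarrow> R (\<lambda>p. g p + h p)"
    and Rm: "\<And>g h. R g \<Longrightarrow> R h \<Longrightarrow> R (\<lambda>p. g p * h p)" and RT: "\<And>g. R g \<Longrightarrow> R (T g)"
    and T0: "\<And>r. T (\<lambda>_. r) = (\<lambda>_. 0)" and R\<alpha>: "\<And>j. j \<le> k \<Longrightarrow> R (\<alpha> j)"
  obtains \<phi> \<tau> where "\<And>i j. R (\<phi> i j)" "\<And>r. R (\<tau> r)" "\<And>i p. \<phi> i i p = 1" "\<And>i j p. j < i \<Longrightarrow> \<phi> i j p = 0"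
    "\<And>i j p. i \<le> k \<Longrightarrow> j \<le> k \<Longrightarrow> (if j < k then \<phi> i (j + 1) p else 0) =
      (if 0 < i then \<phi> (i - 1) j p else 0) + T (\<phi> i j) p + (if i = 0 then \<Sum>l\<le>k. \<alpha> l p * \<phi> l j p else 0)
      - (\<Sum>r\<le>j. \<tau> r p * ycoef k (j - r) r * \<phi> i (j - r) p)"
proof -
  have Rs: "R (\<lambda>p. \<Sum>i\<in>A. g i p)" if "\<And>i. i \<in> A \<Longrightarrow> R (g i)" for A :: "nat set" and g
    using that by (induction A rule: infinite_finite_induct) (auto intro: Rc Ra)
  have Rd: "R (\<lambda>p. g p - h p)" if "R g" "R h" for g h
    using Ra[OF that(1) Rm[OF Rc[of "-1"] that(2)]] by simp
  define rhs where "rhs \<phi> \<tau> i j p =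
      (if 0 < i then \<phi> (i - 1) j p else 0) + T (\<phi> i j) p + (if i = 0 then \<Sum>l\<le>k. \<alpha> l p * \<phi> l j p else 0)
      - (\<Sum>r\<le>j. \<tau> r p * ycoef k (j - r) r * \<phi> i (j - r) p)" for \<phi> \<tau> i j p
  define Q where "Q d \<phi> \<tau> \<longleftrightarrow> (\<forall>i j. R (\<phi> i j)) \<and> (\<forall>r. R (\<tau> r)) \<and> (\<forall>i. \<phi> i i = (\<lambda>_. 1)) \<and>
      (\<forall>i j. j < i \<longrightarrow> \<phi> i j = (\<lambda>_. 0)) \<and>
      (\<forall>i j p. i \<le> k \<longrightarrow> j \<le> k \<longrightarrow> j < i + d \<longrightarrow> (if j < k then \<phi> i (j + 1) p else 0) = rhs \<phi> \<tau> i j p)"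
    for d \<phi> \<tau>
  have "\<exists>\<phi> \<tau>. Q d \<phi> \<tau>" if "d \<le> Suc k" for d
    using that
  proof (induction d)
    case 0
    \<comment> \<open>The identity with \<tau> = 0 solves the equations strictly below the diagonal;
      \<open>T0\<close> removes the derivative terms there.\<close>
    have "Q 0 (\<lambda>i j _. if i = j then 1 else 0) (\<lambda>_ _. 0)"
      unfolding Q_def rhs_def using Rc by (auto simp: T0 fun_eq_iff)
    then show ?case by blast
  next
    case (Suc d)
    then obtain \<phi> \<tau> where Q: "Q d \<phi> \<tau>" and d: "d \<le> k" by auto
    have diag: "\<phi> i i = (\<lambda>_. 1)" and low: "j < i \<Longrightarrow> \<phi> i j = (\<lambda>_. 0)" and R\<phi>: "R (\<phi> i j)" and R\<tau>: "R (\<tau> r)"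
      for i j r using Q unfolding Q_def by auto
    \<comment> \<open>\<open>K l\<close> collects the terms of row \<open>l\<close> in degree
      \<open>d\<close> that are already determined. The entry still to be found is then a partial
      sum of \<open>K\<close> minus the contribution of \<open>y^d\<close>.\<close>
    define K where "K l p = T (\<phi> l (l + d)) p + (if l = 0 then \<Sum>m\<le>k. \<alpha> m p * \<phi> m d p else 0)
        - (\<Sum>r<d. \<tau> r p * ycoef k (l + d - r) r * \<phi> l (l + d - r) p)" for l p
    define Y where "Y = (\<Sum>l\<le>k - d. ycoef k l d)"
    have "Y > 0" unfolding Y_def using d by (intro sum_pos ycoef_pos) auto
    \<comment> \<open>Chosen so that the partial sums \<open>s\<close> return to 0 in the last row
      \<open>k - d\<close>, where column \<open>k + 1\<close> would begin. The divisor is positive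
      because all entries of \<open>y^d\<close> on its superdiagonal are.\<close>
    define t where "t p = (\<Sum>l\<le>k - d. K l p) * inverse Y" for p
    define s where "s i p = (\<Sum>m\<le>i. K m p - t p * ycoef k m d)" for i p
    define \<phi>' where "\<phi>' i j = (if j = i + d + 1 then s i else \<phi> i j)" for i j
    define \<tau>' where "\<tau>' = \<tau>(d := t)"
    have s_last: "s (k - d) p = 0" for p
      using \<open>Y > 0\<close> unfolding s_def t_def Y_def sum_subtractf sum_distrib_left[symmetric] by simp
    have RK: "R (K l)" for l
    proof -
      have "R (\<lambda>p. if l = 0 then \<Sum>m\<le>k. \<alpha> m p * \<phi> m d p else 0)"
        using Rs[of "{..k}"] Rm R\<alpha> R\<phi> Rc by (cases "l = 0") auto
      then show ?thesis unfolding K_def by (intro Rd Ra RT Rs Rm R\<phi> R\<tau> Rc)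
    qed
    have Rt: "R t" unfolding t_def by (intro Rm Rs RK Rc)
    have Rs': "R (s i)" for i unfolding s_def by (intro Rs Rd Rm RK Rt Rc)
    have keep: "\<phi>' i j = \<phi> i j" if "j \<noteq> i + d + 1" for i j using that by (simp add: \<phi>'_def)
    have "(if j < k then \<phi>' i (j + 1) p else 0) = rhs \<phi>' \<tau>' i j p"
      if h: "i \<le> k" "j \<le> k" "j < i + Suc d" for i j p
    proof (cases "j < i + d")
      case True
      \<comment> \<open>In degree below \<open>d\<close> the new coefficient is multiplied by an
        entry of \<phi> below the diagonal, so equations already solved are preserved.\<close>
      have "(\<Sum>r\<le>j. \<tau>' r p * ycoef k (j - r) r * \<phi>' i (j - r) p) =
          (\<Sum>r\<le>j. \<tau> r p * ycoef k (j - r) r * \<phi> i (j - r) p)"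
      proof (rule sum.cong)
        fix r assume "r \<in> {..j}"
        then show "\<tau>' r p * ycoef k (j - r) r * \<phi>' i (j - r) p = \<tau> r p * ycoef k (j - r) r * \<phi> i (j - r) p"
          using True low[of "j - d" i] by (cases "r = d") (auto simp: keep \<tau>'_def)
      qed simp
      moreover have "(\<Sum>l\<le>k. \<alpha> l p * \<phi>' l j p) = (\<Sum>l\<le>k. \<alpha> l p * \<phi> l j p)" if "i = 0"
        using True that by (intro sum.cong refl) (auto simp: keep)
      moreover have "0 < i \<Longrightarrow> \<phi>' (i - 1) j = \<phi> (i - 1) j" "\<phi>' i j = \<phi> i j" "\<phi>' i (j + 1) = \<phi> i (j + 1)"
        using True by (auto intro!: keep)
      ultimately have "rhs \<phi>' \<tau>' i j p = rhs \<phi> \<tau> i j p" "\<phi>' i (j + 1) = \<phi> i (j + 1)"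
        unfolding rhs_def by auto
      moreover have "(if j < k then \<phi> i (j + 1) p else 0) = rhs \<phi> \<tau> i j p"
        using Q True h unfolding Q_def by blast
      ultimately show ?thesis by (auto split: if_splits)
    next
      case False
      then have j: "j = i + d" using h by auto
      have split: "(\<Sum>r\<le>j. g r) = (\<Sum>r<d. g r) + g d + (\<Sum>r\<in>{d<..j}. g r)" for g :: "nat \<Rightarrow> real"
      proof -
        have "{..j} = {..<d} \<union> {d..j}" "{d..j} = insert d {d<..j}" using j by auto
        moreover have "sum g ({..<d} \<union> {d..j}) = sum g {..<d} + sum g {d..j}"
          by (rule sum.union_disjoint) auto
        ultimately show ?thesis by simp
      qed
      have "(\<Sum>r\<le>j. \<tau>' r p * ycoef k (j - r) r * \<phi>' i (j - r) p) =
          (\<Sum>r<d. \<tau>' r p * ycoef k (j - r) r * \<phi>' i (j - r) p) + \<tau>' d p * ycoef k i d * \<phi>' i i p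
          + (\<Sum>r\<in>{d<..j}. \<tau>' r p * ycoef k (j - r) r * \<phi>' i (j - r) p)"
        unfolding split using j by simp
      also have "(\<Sum>r\<in>{d<..j}. \<tau>' r p * ycoef k (j - r) r * \<phi>' i (j - r) p) = 0"
        using j low by (intro sum.neutral) (auto simp: keep)
      also have "(\<Sum>r<d. \<tau>' r p * ycoef k (j - r) r * \<phi>' i (j - r) p) =
          (\<Sum>r<d. \<tau> r p * ycoef k (i + d - r) r * \<phi> i (i + d - r) p)"
        using j by (intro sum.cong refl) (auto simp: keep \<tau>'_def)
      finally have sum: "(\<Sum>r\<le>j. \<tau>' r p * ycoef k (j - r) r * \<phi>' i (j - r) p) =
          (\<Sum>r<d. \<tau> r p * ycoef k (i + d - r) r * \<phi> i (i + d - r) p) + t p * ycoef k i d"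
        by (simp add: keep \<tau>'_def diag)
      have "(\<Sum>l\<le>k. \<alpha> l p * \<phi>' l j p) = (\<Sum>l\<le>k. \<alpha> l p * \<phi> l d p)" if "i = 0"
        using j that by (intro sum.cong refl) (auto simp: keep)
      then have "rhs \<phi>' \<tau>' i j p = (if 0 < i then \<phi>' (i - 1) j p else 0) + (K i p - t p * ycoef k i d)"
        unfolding rhs_def sum K_def using j by (simp add: keep)
      also have "(if 0 < i then \<phi>' (i - 1) j p else 0) = (if 0 < i then s (i - 1) p else 0)"
        using j by (simp add: \<phi>'_def)
      also have "\<dots> + (K i p - t p * ycoef k i d) = s i p"
        by (cases i) (simp_all add: s_def)
      also have "\<dots> = (if j < k then \<phi>' i (j + 1) p else 0)"
      proof (cases "j < k")
        case False
        then have "i = k - d" using j h by auto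
        then show ?thesis using s_last False by simp
      qed (simp add: \<phi>'_def j)
      finally show ?thesis by simp
    qed
    then have "Q (Suc d) \<phi>' \<tau>'"
      using R\<phi> R\<tau> Rt Rs' diag low unfolding Q_def by (simp add: \<phi>'_def \<tau>'_def)
    then show ?case by blast
  qed
  then obtain \<phi> \<tau> where "Q (Suc k) \<phi> \<tau>" by blast
  then show ?thesis
    using that[of \<phi> \<tau>] unfolding Q_def rhs_def by auto
qed

subsection \<open>The linearized equation\<close>

text \<open>The expansion shows that the \<open>k + 1\<close> vectors span, hence are independent;
  comparing coefficients in the expansion of \<open>e j\<close> gives duality.\<close>

lemma dual_basis_from_expansion:
  fixes e :: "nat \<Rightarrow> 'v::euclidean_space"
  assumes ex: "\<And>v. v = (\<Sum>j\<le>k. c j v *\<^sub>R e j)" and "DIM('v) = k + 1" "i \<le> k" "j \<le> k"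
  shows "c i (e j) = (if i = j then 1 else 0)"
proof -
  have "v \<in> span (e ` {..k})" for v
    by (subst ex, intro span_sum span_scale span_base) auto
  then have b: "inj_on e {..k}" "independent (e ` {..k})"
    using is_basisI[of k e] assms(2) unfolding is_basis_def by auto
  define g where "g l = c l (e j) - (if l = j then 1 else 0)" for l
  have "(\<Sum>l\<le>k. g l *\<^sub>R e l) = (\<Sum>l\<le>k. c l (e j) *\<^sub>R e l) - (\<Sum>l\<le>k. if l = j then e j else 0)"
    unfolding g_def scaleR_diff_left sum_subtractf by (intro arg_cong2[where f = minus] sum.cong) auto
  also have "\<dots> = 0" using ex[of "e j"] \<open>j \<le> k\<close> by simp
  finally have "(\<Sum>w\<in>e ` {..k}. g (the_inv_into {..k} e w) *\<^sub>R w) = 0"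
    by (simp add: sum.reindex[OF b(1)] the_inv_into_f_f[OF b(1)])
  from independentD[OF b(2) _ subset_refl this, of "e i"] have "g i = 0"
    using \<open>i \<le> k\<close> by (simp add: the_inv_into_f_f[OF b(1)])
  then show ?thesis by (auto simp: g_def split: if_splits)
qed

text \<open>Differentiate the constant vector \<open>v = \<Sum> c_j v e_j\<close> and take
  coordinate \<open>i\<close>: once the coframe is known to be differentiable, its derivative is
  forced.\<close>

lemma moving_frameI:
  fixes e :: "nat \<Rightarrow> real \<Rightarrow> 'v::euclidean_space"
  assumes dim: "DIM('v) = k + 1" and I: "open I"
    and lin: "\<And>x i. x \<in> I \<Longrightarrow> i \<le> k \<Longrightarrow> linear (c i x)"
    and dual: "\<And>x i j. x \<in> I \<Longrightarrow> i \<le> k \<Longrightarrow> j \<le> k \<Longrightarrow> c i x (e j x) = (if i = j then 1 else 0)"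
    and e': "\<And>x j. x \<in> I \<Longrightarrow> j \<le> k \<Longrightarrow> (e j has_vector_derivative (\<Sum>i\<le>k. W x i j *\<^sub>R e i x)) (at x)"
    and dc: "\<And>x i v. x \<in> I \<Longrightarrow> i \<le> k \<Longrightarrow> (\<lambda>x. c i x v) differentiable (at x)"
  shows "moving_frame k I e c W"
proof (rule moving_frame.intro)
  fix x i v assume x: "x \<in> I" and i: "i \<le> k"
  have "\<exists>d. ((\<lambda>x. c j x v) has_real_derivative d) (at x)" if "j \<le> k" for j
    using dc[OF x that] real_differentiable_def by blast
  then obtain d where d: "\<And>j. j \<le> k \<Longrightarrow> ((\<lambda>x. c j x v) has_real_derivative d j) (at x)" by metis
  let ?d = "\<Sum>j\<le>k. c j x v *\<^sub>R (\<Sum>i\<le>k. W x i j *\<^sub>R e i x) + d j *\<^sub>R e j x"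
  have A: "((\<lambda>x. \<Sum>j\<le>k. c j x v *\<^sub>R e j x) has_vector_derivative ?d) (at x)"
    using x by (intro has_vector_derivative_sum has_vector_derivative_scaleR d e') auto
  have B: "(\<Sum>j\<le>k. c j y v *\<^sub>R e j y) = v" if "y \<in> I" for y
    using dual_basis_expansion[of k "\<lambda>i. c i y" "\<lambda>i. e i y" v] lin dual dim that by simp
  have "((\<lambda>x. v) has_vector_derivative ?d) (at x)"
    by (rule has_vector_derivative_transform_within_open[OF A I x B])
  from vector_derivative_unique_at[OF this has_vector_derivative_const] have "?d = 0" .
  then have "c i x ?d = 0" using linear_0[OF lin[OF x i]] by simp
  moreover have "c i x ?d = (\<Sum>j\<le>k. W x i j * c j x v) + d i"
  proof -
    have col: "c i x (\<Sum>l\<le>k. W x l j *\<^sub>R e l x) = W x i j" for j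
    proof -
      have "c i x (\<Sum>l\<le>k. W x l j *\<^sub>R e l x) = (\<Sum>l\<le>k. if l = i then W x i j else 0)"
        unfolding linear_sum[OF lin[OF x i]]
        by (intro sum.cong refl) (auto simp: linear_scale[OF lin[OF x i]] dual[OF x i])
      then show ?thesis using i by simp
    qed
    have "c i x ?d = (\<Sum>j\<le>k. W x i j * c j x v + (if j = i then d i else 0))"
      unfolding linear_sum[OF lin[OF x i], of "\<lambda>j. c j x v *\<^sub>R (\<Sum>i\<le>k. W x i j *\<^sub>R e i x) + d j *\<^sub>R e j x"]
      by (intro sum.cong refl)
        (simp add: linear_scale[OF lin[OF x i]] linear_add[OF lin[OF x i]] col dual[OF x i])
    then show ?thesis using i by (simp add: sum.distrib)
  qed
  ultimately have "d i = - (\<Sum>j\<le>k. W x i j * c j x v)" by simp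
  with d[OF i] show "((\<lambda>x. c i x v) has_real_derivative - (\<Sum>j\<le>k. W x i j * c j x v)) (at x)" by simp
qed (use assms in auto)

lemma has_vector_derivative_vec_lambda:
  fixes g :: "'n::finite \<Rightarrow> real \<Rightarrow> real"
  assumes "\<And>i. ((\<lambda>x. g i x) has_vector_derivative g' i) (at x)"
  shows "((\<lambda>x. \<chi> i. g i x) has_vector_derivative (\<chi> i. g' i)) (at x)"
proof -
  have "(\<chi> i. g i x) = (\<Sum>i\<in>UNIV. g i x *\<^sub>R axis i (1::real))" for g :: "'n \<Rightarrow> real \<Rightarrow> real" and x
    using basis_expansion[of "\<chi> i. g i x"] by (simp add: scalar_mult_eq_scaleR)
  moreover have "((\<lambda>x. \<Sum>i\<in>UNIV. g i x *\<^sub>R axis i (1::real)) has_vector_derivative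
      (\<Sum>i\<in>UNIV. g i x *\<^sub>R 0 + g' i *\<^sub>R axis i 1)) (at x)"
    using assms unfolding has_real_derivative_iff_has_vector_derivative[symmetric]
    by (intro has_vector_derivative_sum has_vector_derivative_scaleR has_vector_derivative_const) auto
  moreover have "(\<chi> i. g' i) = (\<Sum>i\<in>UNIV. g' i *\<^sub>R axis i (1::real))"
    using basis_expansion[of "\<chi> i. g' i"] by (simp add: scalar_mult_eq_scaleR)
  ultimately show ?thesis by simp
qed

section \<open>Jet coordinates and the total derivative\<close>

definition jet_index :: "nat \<Rightarrow> 'n::finite" where
  "jet_index = inv_into UNIV jet_order"

lemma jet_order_less: "jet_order (i :: 'n::finite) < CARD('n)"
  using bij_betw_jet_order[where 'n = 'n] unfolding bij_betw_def by auto

lemma jet_index_order [simp]: "jet_index (jet_order (i :: 'n::finite)) = i"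
  using bij_betw_jet_order[where 'n = 'n] unfolding bij_betw_def jet_index_def by (auto intro: inv_into_f_f)

lemma jet_order_index: "j < CARD('n::finite) \<Longrightarrow> jet_order (jet_index j :: 'n::finite) = j"
  using bij_betw_jet_order[where 'n = 'n] unfolding bij_betw_def jet_index_def by (auto intro: f_inv_into_f)

locale jet_ode =
  fixes f :: "real \<times> (real ^ 'n::finite) \<Rightarrow> real" and D :: "(real \<times> (real ^ 'n)) set"
    and I :: "real set" and x0 :: real and k :: nat
  assumes card: "CARD('n) = k + 1" and open_D: "open D" and smooth_f: "smooth_on D f"
    and open_I: "open I" and int_I: "is_interval I" and x0: "x0 \<in> I"
begin

lemma order_index [simp]: "j \<le> k \<Longrightarrow> jet_order (jet_index j :: 'n) = j"
  by (rule jet_order_index) (simp add: card)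

lemma order_le: "jet_order (i :: 'n) \<le> k"
  using jet_order_less[of i] card by simp

lemma sum_index: "(\<Sum>i\<in>UNIV. g (i :: 'n)) = (\<Sum>j\<le>k. g (jet_index j))"
  by (rule sum.reindex_bij_witness[where i = jet_index and j = jet_order]) (auto simp: order_le)

lemma sum_index_rev: "(\<Sum>i\<in>UNIV. g (i :: 'n)) = (\<Sum>j\<le>k. g (jet_index (k - j)))"
  unfolding sum_index
  by (rule sum.reindex_bij_witness[where i = "\<lambda>j. k - j" and j = "\<lambda>j. k - j"]) auto

text \<open>\<open>(1, field p)\<close> is the vector field on the jet space whose integral curves
  are the jets of solutions.\<close>

definition field :: "real \<times> (real ^ 'n) \<Rightarrow> real ^ 'n" where
  "field p = (\<chi> i. if jet_order i < k then snd p $ jet_index (jet_order i + 1) else f p)"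

definition total_deriv :: "(real \<times> (real ^ 'n) \<Rightarrow> real) \<Rightarrow> real \<times> (real ^ 'n) \<Rightarrow> real" where
  "total_deriv g p = frechet_derivative g (at p) (1, field p)"

definition fcoef :: "'n \<Rightarrow> real \<times> (real ^ 'n) \<Rightarrow> real" where
  "fcoef m p = frechet_derivative f (at p) (0, axis m 1)"

text \<open>The sign and the reversal of the order are those of \<open>pairing\<close>: the equation
  for the top derivative takes the form \<open>c' = - W c\<close> with these coefficients as first
  row of \<open>W\<close>.\<close>

definition base_coef :: "nat \<Rightarrow> real \<times> (real ^ 'n) \<Rightarrow> real" where
  "base_coef j p = (- 1) ^ (j + 1) * fcoef (jet_index (k - j)) p"

lemma smooth_fcoef: "smooth_on D (fcoef m)"
  unfolding fcoef_def using smooth_on_frechet_derivative[OF smooth_f] .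

lemma smooth_base_coef: "smooth_on D (base_coef j)"
  unfolding base_coef_def by (intro smooth_on_mult open_D smooth_on_const smooth_fcoef)

lemma smooth_field: "smooth_on D (\<lambda>p. field p $ i)"
proof (cases "jet_order i < k")
  case True
  have "bounded_linear (\<lambda>p :: real \<times> (real ^ 'n). snd p $ jet_index (jet_order i + 1))"
    by (intro bounded_linear_compose[OF bounded_linear_vec_nth] bounded_linear_snd)
  then show ?thesis using True smooth_on_bounded_linear by (simp add: field_def)
qed (simp add: field_def smooth_f)

text \<open>The direction \<open>(1, field p)\<close> moves with \<open>p\<close>, whereas
  smoothness provides derivatives in fixed directions; hence the expansion over the coordinate
  directions.\<close>

lemma smooth_total_deriv:
  assumes "smooth_on D g" shows "smooth_on D (total_deriv g)"
proof -
  have E: "frechet_derivative g (at p) (1, 0) + (\<Sum>i\<in>UNIV. field p $ i * frechet_derivative g (at p) (0, axis i 1))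
      = total_deriv g p" if "p \<in> D" for p
  proof -
    have lin: "linear (frechet_derivative g (at p))"
      using smooth_on_has_derivative[OF assms that] has_derivative_linear by blast
    have *: "(1, field p) = (1, 0) + (\<Sum>i\<in>UNIV. field p $ i *\<^sub>R (0 :: real, axis i 1 :: real ^ 'n))"
    proof -
      have "(\<Sum>i\<in>UNIV. field p $ i *\<^sub>R axis i (1::real)) = field p"
        using basis_expansion[of "field p"] by (simp add: scalar_mult_eq_scaleR)
      then show ?thesis by (intro prod_eqI) (simp_all add: fst_sum snd_sum)
    qed
    show ?thesis
      unfolding total_deriv_def * by (simp only: linear_add[OF lin] linear_sum[OF lin] linear_scale[OF lin] real_scaleR_def)
  qed
  have "smooth_on D (\<lambda>p. frechet_derivative g (at p) (1, 0) +
      (\<Sum>i\<in>UNIV. field p $ i * frechet_derivative g (at p) (0, axis i 1)))"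
    by (intro smooth_on_add smooth_on_sum smooth_on_mult open_D smooth_on_frechet_derivative assms smooth_field)
  from smooth_on_cong[OF open_D E this] show ?thesis by simp
qed

lemma jet_deriv:
  assumes "\<And>i. i \<le> k \<Longrightarrow> (deriv ^^ i) z field_differentiable at x"
  shows "((jet z :: real \<Rightarrow> real ^ 'n) has_vector_derivative
    (\<chi> i. if jet_order i < k then (jet z x :: real ^ 'n) $ jet_index (jet_order i + 1) else (deriv ^^ Suc k) z x)) (at x)"
  unfolding jet_def[abs_def]
proof (rule has_vector_derivative_vec_lambda)
  fix i :: 'n
  have "((deriv ^^ jet_order i) z has_real_derivative (deriv ^^ Suc (jet_order i)) z x) (at x)"
    using field_differentiable_derivI[OF assms[OF order_le]] by simp
  moreover have "jet_order i = k" if "\<not> jet_order i < k"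
    using that order_le[of i] by simp
  moreover have "jet_order (jet_index (Suc (jet_order i)) :: 'n) = Suc (jet_order i)" if "jet_order i < k"
    using that by (intro order_index) simp
  ultimately show "((deriv ^^ jet_order i) z has_vector_derivative
      (if jet_order i < k then (\<chi> i. (deriv ^^ jet_order i) z x) $ (jet_index (jet_order i + 1) :: 'n)
       else (deriv ^^ Suc k) z x)) (at x)"
    unfolding has_real_derivative_iff_has_vector_derivative by (cases "jet_order i < k") auto
qed

lemma jet_has_vector_derivative:
  assumes "ode_solution f D I y" "x \<in> I"
  shows "((jet y :: real \<Rightarrow> real ^ 'n) has_vector_derivative field (x, jet y x)) (at x)"
proof -
  have d: "(deriv ^^ i) y field_differentiable at x" if "i \<le> k" for i
    using assms card that unfolding ode_solution_def by simp
  have "(deriv ^^ Suc k) y x = f (x, jet y x)"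
    using assms card unfolding ode_solution_def by simp
  from jet_deriv[OF d, unfolded this] show ?thesis unfolding field_def snd_conv .
qed

lemma along_solution:
  fixes g :: "real \<times> (real ^ 'n) \<Rightarrow> real"
  assumes "ode_solution f D I y" "x \<in> I" "smooth_on D g"
  shows "((\<lambda>x. g (x, jet y x)) has_real_derivative total_deriv g (x, jet y x)) (at x)"
proof -
  have p: "(x, jet y x) \<in> D" using assms(1,2) unfolding ode_solution_def by blast
  note dg = smooth_on_has_derivative[OF assms(3) p]
  have "((\<lambda>x. (x, jet y x :: real ^ 'n)) has_derivative (\<lambda>h. (h, h *\<^sub>R field (x, jet y x)))) (at x)"
    using jet_has_vector_derivative[OF assms(1,2)] unfolding has_vector_derivative_def
    by (intro has_derivative_Pair) auto
  from has_derivative_compose[OF this dg]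
  have "((\<lambda>x. g (x, jet y x)) has_derivative
      (\<lambda>h. frechet_derivative g (at (x, jet y x)) (h, h *\<^sub>R field (x, jet y x)))) (at x)" .
  moreover have "frechet_derivative g (at (x, jet y x)) (h, h *\<^sub>R field (x, jet y x)) =
      h * total_deriv g (x, jet y x)" for h
    using linear_scale[OF has_derivative_linear[OF dg], of h "(1, field (x, jet y x))"]
    by (simp add: total_deriv_def)
  ultimately show ?thesis
    unfolding has_field_derivative_def by (simp add: mult.commute[of _ "total_deriv g (x, jet y x)"])
qed

lemma continuous_along:
  fixes g :: "real \<times> (real ^ 'n) \<Rightarrow> real"
  assumes "ode_solution f D I y" "smooth_on D g"
  shows "continuous_on I (\<lambda>x. g (x, jet y x))"
proof (intro continuous_at_imp_continuous_on ballI)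
  fix x assume "x \<in> I"
  from DERIV_isCont[OF along_solution[OF assms(1) this assms(2)]] show "isCont (\<lambda>x. g (x, jet y x)) x" .
qed

section \<open>The frame dual to the linearized jets\<close>

definition base_matrix :: "(real \<Rightarrow> real) \<Rightarrow> real \<Rightarrow> nat \<Rightarrow> nat \<Rightarrow> real" where
  "base_matrix y x i j = (if i = Suc j then 1 else 0) + (if i = 0 then base_coef j (x, jet y x) else 0)"

definition jet_matrix :: "(real \<Rightarrow> real) \<Rightarrow> real \<Rightarrow> real ^ 'n \<Rightarrow> real ^ 'n" where
  "jet_matrix y x z = (\<chi> i. if jet_order i < k then z $ jet_index (jet_order i + 1)
     else \<Sum>m\<in>UNIV. fcoef m (x, jet y x) * z $ m)"

text \<open>The rows of \<open>X\<close> are the frame vectors \<open>w j\<close>, so that one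
  linear equation for a matrix produces the whole frame.\<close>

definition frame_matrix :: "(real \<Rightarrow> real) \<Rightarrow> real \<Rightarrow> real ^ 'n ^ 'n \<Rightarrow> real ^ 'n ^ 'n" where
  "frame_matrix y x X = (\<chi> i. (if jet_order i < k then X $ jet_index (jet_order i + 1) else 0)
     + base_coef (jet_order i) (x, jet y x) *\<^sub>R X $ jet_index 0)"

text \<open>The coordinates of a jet in the frame \<open>w\<close>. Index 0 is the top derivative,
  because the linearization curve at \<open>x\<close> consists of the solutions all of whose lower
  derivatives vanish at \<open>x\<close>.\<close>

definition pairing :: "nat \<Rightarrow> real ^ 'n \<Rightarrow> real" where
  "pairing j z = (- 1) ^ j * z $ jet_index (k - j)"

lemma base_matrix_row:
  "i \<le> k \<Longrightarrow> (\<Sum>j\<le>k. base_matrix y x i j * g j) =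
    (if 0 < i then g (i - 1) else 0) + (if i = 0 then \<Sum>j\<le>k. base_coef j (x, jet y x) * g j else 0)"
proof -
  assume i: "i \<le> k"
  have "(\<Sum>j\<le>k. (if i = Suc j then 1 else 0) * g j) = (\<Sum>j\<le>k. if j = i - 1 then (if 0 < i then g j else 0) else 0)"
    by (intro sum.cong) auto
  also have "\<dots> = (if 0 < i then g (i - 1) else 0)"
    using i by (simp add: sum.delta)
  finally show ?thesis unfolding base_matrix_def distrib_right sum.distrib by auto
qed

lemma jet_linear_ode:
  assumes "ode_solution f D I y"
  shows "linear_ode I x0 (jet_matrix y)" "linear_ode I x0 (frame_matrix y)"
proof -
  note cont = continuous_along[OF assms smooth_fcoef] continuous_along[OF assms smooth_base_coef]
  show "linear_ode I x0 (jet_matrix y)"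
  proof (rule linear_ode.intro)
    show "linear (jet_matrix y t)" for t
      by (rule linearI) (auto simp: jet_matrix_def vec_eq_iff algebra_simps sum.distrib sum_distrib_left)
    show "continuous_on I (\<lambda>t. jet_matrix y t v)" for v
      unfolding jet_matrix_def
    proof (rule continuous_on_vec_lambda)
      show "continuous_on I (\<lambda>t. if jet_order i < k then v $ jet_index (jet_order i + 1)
         else \<Sum>m\<in>UNIV. fcoef m (t, jet y t) * v $ m)" for i :: 'n
        by (cases "jet_order i < k") (auto intro!: continuous_intros cont)
    qed
  qed (rule open_I int_I x0)+
  show "linear_ode I x0 (frame_matrix y)"
  proof (rule linear_ode.intro)
    show "linear (frame_matrix y t)" for t
      by (rule linearI) (auto simp: frame_matrix_def vec_eq_iff algebra_simps)
    show "continuous_on I (\<lambda>t. frame_matrix y t v)" for v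
      unfolding frame_matrix_def
      by (intro continuous_on_vec_lambda continuous_intros cont)
  qed (rule open_I int_I x0)+
qed

lemma pairing_deriv:
  assumes "(Z has_vector_derivative jet_matrix y x (Z x)) (at x)" "j \<le> k"
  shows "((\<lambda>x. pairing j (Z x)) has_real_derivative - (\<Sum>l\<le>k. base_matrix y x j l * pairing l (Z x))) (at x)"
proof -
  have "((\<lambda>x. Z x $ i) has_real_derivative jet_matrix y x (Z x) $ i) (at x)" for i
    using bounded_linear.has_vector_derivative[OF bounded_linear_vec_nth assms(1)]
    by (simp add: has_real_derivative_iff_has_vector_derivative)
  then have "((\<lambda>x. pairing j (Z x)) has_real_derivative (- 1) ^ j * jet_matrix y x (Z x) $ jet_index (k - j)) (at x)"
    unfolding pairing_def by (rule DERIV_cmult)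
  moreover have "(- 1) ^ j * jet_matrix y x (Z x) $ jet_index (k - j) = - (\<Sum>l\<le>k. base_matrix y x j l * pairing l (Z x))"
  proof (cases "j = 0")
    case True
    have "jet_matrix y x (Z x) $ jet_index k = (\<Sum>m\<in>UNIV. fcoef m (x, jet y x) * Z x $ m)"
      by (simp add: jet_matrix_def)
    also have "\<dots> = (\<Sum>l\<le>k. - (base_coef l (x, jet y x) * pairing l (Z x)))"
      unfolding sum_index_rev by (intro sum.cong refl) (simp add: base_coef_def pairing_def)
    finally show ?thesis using True by (simp add: base_matrix_row sum_negf)
  next
    case False
    then have "Suc (k - j) = k - (j - 1)" using assms(2) by simp
    then have "jet_matrix y x (Z x) $ jet_index (k - j) = Z x $ jet_index (k - (j - 1))"
      using False assms(2) by (simp add: jet_matrix_def)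
    then show ?thesis
      using False assms(2) by (cases j) (simp_all add: base_matrix_row pairing_def)
  qed
  ultimately show ?thesis by simp
qed

text \<open>Tangent vectors are jets at \<open>x0\<close>, while the curve is defined by conditions
  on jets at \<open>x\<close>. The frame \<open>w\<close> transports the latter to the former:
  evolving a jet as a linearized solution and pairing it with \<open>w\<close> recovers its value at
  \<open>x0\<close>.\<close>

lemma base_frame:
  assumes y: "ode_solution f D I y"
  obtains w q where "moving_frame k I w q (base_matrix y)"
    "\<And>x j. x \<in> I \<Longrightarrow> j \<le> k \<Longrightarrow> (w j has_vector_derivative (\<Sum>i\<le>k. base_matrix y x i j *\<^sub>R w i x)) (at x)"
    "\<And>j. j \<le> k \<Longrightarrow> w j x0 = (- 1) ^ j *\<^sub>R axis (jet_index (k - j)) 1"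
    "\<And>j v. q j x0 v = pairing j v"
    "\<And>x. x \<in> I \<Longrightarrow> linearization_curve f I x0 y x = span {w 0 x}"
proof -
  obtain X where X: "X x0 = (\<chi> i. (- 1) ^ jet_order i *\<^sub>R axis (jet_index (k - jet_order i)) 1)"
      "\<And>x. x \<in> I \<Longrightarrow> (X has_vector_derivative frame_matrix y x (X x)) (at x)"
    using linear_ode.solution_exists[OF jet_linear_ode(2)[OF y]] by metis
  define w where "w j x = X x $ jet_index j" for j x
  have w0: "w j x0 = (- 1) ^ j *\<^sub>R axis (jet_index (k - j)) 1" if "j \<le> k" for j
    using that by (simp add: w_def X(1))
  have w': "(w j has_vector_derivative (\<Sum>i\<le>k. base_matrix y x i j *\<^sub>R w i x)) (at x)"
    if "x \<in> I" "j \<le> k" for x j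
  proof -
    have "(w j has_vector_derivative frame_matrix y x (X x) $ jet_index j) (at x)"
      unfolding w_def using bounded_linear.has_vector_derivative[OF bounded_linear_vec_nth X(2)[OF that(1)]] .
    moreover have "(\<Sum>i\<le>k. base_matrix y x i j *\<^sub>R w i x) =
        (\<Sum>i\<le>k. (if i = Suc j then w (Suc j) x else 0) + (if i = 0 then base_coef j (x, jet y x) *\<^sub>R w 0 x else 0))"
      by (intro sum.cong) (auto simp: base_matrix_def algebra_simps)
    then have "(\<Sum>i\<le>k. base_matrix y x i j *\<^sub>R w i x) = frame_matrix y x (X x) $ jet_index j"
      using that(2) by (auto simp: sum.distrib frame_matrix_def w_def)
    ultimately show ?thesis by simp
  qed
  have "\<exists>Z. Z x0 = axis m 1 \<and> (\<forall>x\<in>I. (Z has_vector_derivative jet_matrix y x (Z x)) (at x))" for m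
    using linear_ode.solution_exists[OF jet_linear_ode(1)[OF y]] by metis
  then obtain Z where Z: "\<And>m. Z m x0 = axis m (1 :: real)"
      "\<And>m x. x \<in> I \<Longrightarrow> (Z m has_vector_derivative jet_matrix y x (Z m x)) (at x)" by metis
  define S where "S v x = (\<Sum>m\<in>UNIV. (v $ m) *\<^sub>R Z m x)" for v x
  have S0: "S v x0 = v" for v
    using basis_expansion[of v] by (simp add: S_def Z(1) scalar_mult_eq_scaleR)
  have S': "(S v has_vector_derivative jet_matrix y x (S v x)) (at x)" if "x \<in> I" for x v
  proof -
    have "(S v has_vector_derivative (\<Sum>m\<in>UNIV. (v $ m) *\<^sub>R jet_matrix y x (Z m x))) (at x)"
      unfolding S_def using Z(2)[OF that]
      by (intro has_vector_derivative_sum bounded_linear.has_vector_derivative[OF bounded_linear_scaleR_right])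
    moreover have "linear (jet_matrix y x)" using linear_ode.lin[OF jet_linear_ode(1)[OF y] that] .
    ultimately show ?thesis unfolding S_def by (simp add: linear_sum linear_scale)
  qed
  \<comment> \<open>The derivatives of \<open>pairing\<close> and of \<open>w\<close> involve the
    same matrix with opposite signs and cancel; at \<open>x0\<close> the sum is the expansion of
    \<open>s x0\<close> in the signed standard basis.\<close>
  have const: "(\<Sum>j\<le>k. pairing j (s x) *\<^sub>R w j x) = s x0"
    if x: "x \<in> I" and s: "\<And>x. x \<in> I \<Longrightarrow> (s has_vector_derivative jet_matrix y x (s x)) (at x)" for x s
  proof -
    define g where "g x = (\<Sum>j\<le>k. pairing j (s x) *\<^sub>R w j x)" for x
    have "(g has_vector_derivative 0) (at x)" if x: "x \<in> I" for x
    proof -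
      have "(g has_vector_derivative (\<Sum>j\<le>k. pairing j (s x) *\<^sub>R (\<Sum>i\<le>k. base_matrix y x i j *\<^sub>R w i x)
          + (- (\<Sum>l\<le>k. base_matrix y x j l * pairing l (s x))) *\<^sub>R w j x)) (at x)"
        unfolding g_def
        by (intro has_vector_derivative_sum has_vector_derivative_scaleR w'[OF x] pairing_deriv[OF s[OF x]]) auto
      moreover have "(\<Sum>j\<le>k. pairing j (s x) *\<^sub>R (\<Sum>i\<le>k. base_matrix y x i j *\<^sub>R w i x)) =
          (\<Sum>j\<le>k. (\<Sum>l\<le>k. base_matrix y x j l * pairing l (s x)) *\<^sub>R w j x)"
        unfolding scaleR_sum_right scaleR_sum_left by (subst sum.swap) (simp add: mult.commute)
      ultimately show ?thesis by (simp add: sum_subtractf)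
    qed
    then have "\<And>x. x \<in> I \<Longrightarrow> (g has_vector_derivative 0) (at x within I)"
      by (rule has_vector_derivative_at_within)
    moreover have "convex I" using int_I by (simp add: is_interval_convex)
    ultimately obtain d where "\<And>x. x \<in> I \<Longrightarrow> g x = d"
      using has_vector_derivative_zero_constant by metis
    then have "g x = g x0" using x x0 by simp
    also have "g x0 = (\<Sum>j\<le>k. (s x0 $ jet_index (k - j)) *\<^sub>R axis (jet_index (k - j)) 1)"
      unfolding g_def by (intro sum.cong refl) (simp add: w0 pairing_def)
    also have "\<dots> = s x0"
      using basis_expansion[of "s x0"] unfolding sum_index_rev by (simp add: scalar_mult_eq_scaleR)
    finally show ?thesis by (simp add: g_def)
  qed
  define q where "q j x v = pairing j (S v x)" for j x v
  have ex: "v = (\<Sum>j\<le>k. q j x v *\<^sub>R w j x)" if "x \<in> I" for x v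
    using const[OF that S', of v] S0[of v] by (simp add: q_def)
  have mf: "moving_frame k I w q (base_matrix y)"
  proof (rule moving_frame.intro)
    show "DIM(real ^ 'n) = k + 1" using card by simp
    show "linear (q i x)" for i x
      by (rule linearI)
        (auto simp: q_def S_def pairing_def algebra_simps sum.distrib sum_distrib_left scaleR_sum_right)
    show "((\<lambda>x. q i x v) has_real_derivative - (\<Sum>j\<le>k. base_matrix y x i j * q j x v)) (at x)"
      if "x \<in> I" "i \<le> k" for x i v
      unfolding q_def by (rule pairing_deriv[OF S'[OF that(1)] that(2)])
    show "q i x (w j x) = (if i = j then 1 else 0)" if "x \<in> I" "i \<le> k" "j \<le> k" for x i j
      using dual_basis_from_expansion[where k = k and c = "\<lambda>j. q j x" and e = "\<lambda>j. w j x" and i = i and j = j] ex[OF that(1)] card that by simp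
  qed (rule open_I)
  have curve: "linearization_curve f I x0 y x = span {w 0 x}" if x: "x \<in> I" for x
  proof
    show "linearization_curve f I x0 y x \<subseteq> span {w 0 x}"
    proof
      fix v assume "v \<in> linearization_curve f I x0 y x"
      then obtain z where z: "v = jet z x0" "linearized_solution f I y z" "\<forall>i<CARD('n) - 1. (deriv ^^ i) z x = 0"
        unfolding linearization_curve_def by auto
      have jz: "((jet z :: real \<Rightarrow> real ^ 'n) has_vector_derivative jet_matrix y t (jet z t)) (at t)" if t: "t \<in> I" for t
      proof -
        have d: "(deriv ^^ i) z field_differentiable at t" if "i \<le> k" for i
          using z(2) t card that unfolding linearized_solution_def by simp
        have "(deriv ^^ Suc k) z t = (\<Sum>m\<in>UNIV. fcoef m (t, jet y t) * (jet z t :: real ^ 'n) $ m)"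
          using z(2) t card unfolding linearized_solution_def fcoef_def jet_def by simp
        from jet_deriv[OF d, unfolded this] show ?thesis unfolding jet_matrix_def .
      qed
      \<comment> \<open>\<open>const\<close> holds for every solution of the first-order system and
        applies to \<open>jet z\<close> itself. The vanishing lower derivatives at \<open>x\<close>
        leave only the term \<open>j = 0\<close>.\<close>
      have "v = (\<Sum>j\<le>k. pairing j (jet z x) *\<^sub>R w j x)"
        using const[OF x jz] z(1) by simp
      also have "\<dots> = (\<Sum>j\<le>k. if j = 0 then pairing 0 (jet z x) *\<^sub>R w 0 x else 0)"
        using z(3) card by (intro sum.cong refl) (auto simp: pairing_def jet_def)
      also have "\<dots> = pairing 0 (jet z x) *\<^sub>R w 0 x" by simp
      finally show "v \<in> span {w 0 x}" by (simp add: span_base span_scale)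
    qed
    show "span {w 0 x} \<subseteq> linearization_curve f I x0 y x"
    proof
      fix v assume "v \<in> span {w 0 x}"
      then obtain r where v: "v = r *\<^sub>R w 0 x" by (auto simp: span_singleton)
      \<comment> \<open>The scalar solution is the lowest component of the first-order solution with
        initial jet \<open>v\<close>; its derivatives are then the other components.\<close>
      define z where "z t = S v t $ jet_index 0" for t
      have S_nth: "((\<lambda>t. S v t $ i) has_real_derivative jet_matrix y t (S v t) $ i) (at t)" if "t \<in> I" for i t
        using bounded_linear.has_vector_derivative[OF bounded_linear_vec_nth S'[OF that]]
        by (simp add: has_real_derivative_iff_has_vector_derivative)
      have zi: "(deriv ^^ i) z t = S v t $ jet_index i" if "i \<le> k" "t \<in> I" for i t
        using that
      proof (induction i arbitrary: t)
        case (Suc i)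
        have "((deriv ^^ i) z has_real_derivative jet_matrix y t (S v t) $ jet_index i) (at t)"
          by (rule has_field_derivative_transform_within_open[OF S_nth[OF Suc.prems(2)] open_I Suc.prems(2)])
            (use Suc in simp)
        moreover have "jet_matrix y t (S v t) $ jet_index i = S v t $ jet_index (Suc i)"
          using Suc.prems by (simp add: jet_matrix_def)
        ultimately show ?case by (simp add: DERIV_imp_deriv)
      qed (simp add: z_def)
      have dz: "((deriv ^^ i) z has_real_derivative jet_matrix y t (S v t) $ jet_index i) (at t)" if "i \<le> k" "t \<in> I" for i t
        by (rule has_field_derivative_transform_within_open[OF S_nth[OF that(2)] open_I that(2)])
          (simp add: zi[OF that(1)])
      have "linearized_solution f I y z"
        unfolding linearized_solution_def
      proof (intro ballI conjI allI impI)
        fix t i assume "t \<in> I" "i < CARD('n)"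
        then show "(deriv ^^ i) z field_differentiable at t"
          using dz[of i t] card unfolding field_differentiable_def by auto
      next
        fix t assume t: "t \<in> I"
        have "(deriv ^^ CARD('n)) z t = jet_matrix y t (S v t) $ jet_index k"
          using DERIV_imp_deriv[OF dz[OF _ t, of k]] card by simp
        also have "\<dots> = (\<Sum>i\<in>UNIV. fcoef i (t, jet y t) * (deriv ^^ jet_order i) z t)"
          using zi[OF order_le t] by (simp add: jet_matrix_def)
        finally show "(deriv ^^ CARD('n)) z t =
            (\<Sum>i\<in>UNIV. frechet_derivative f (at (t, jet y t)) (0, axis i 1) * (deriv ^^ jet_order i) z t)"
          unfolding fcoef_def .
      qed
      moreover have "jet z x0 = v"
        using zi[OF order_le x0] S0[of v] by (simp add: jet_def vec_eq_iff)
      moreover have "(deriv ^^ i) z x = 0" if "i < CARD('n) - 1" for i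
      proof -
        have "q (k - i) x v = 0"
          using that card x v moving_frame.dual[OF mf x, of "k - i" 0] linear_scale[OF moving_frame.lin[OF mf x]] by auto
        then show ?thesis using zi[of i x] that card x by (simp add: q_def pairing_def)
      qed
      ultimately show "v \<in> linearization_curve f I x0 y x" unfolding linearization_curve_def by blast
    qed
  qed
  show ?thesis
    by (rule that[OF mf w' w0 _ curve]) (simp_all add: q_def S0)
qed

lemma smooth_unitriangular_inverse:
  assumes "\<And>i j. smooth_on D (\<phi> i j)"
  shows "smooth_on D (\<lambda>p. unitriangular_inverse (\<lambda>i j. \<phi> i j p) i j)"
proof (induction j rule: less_induct)
  case (less j)
  show ?case
  proof (cases "i < j")
    case True
    have "smooth_on D (\<lambda>p. - (\<Sum>l<j. unitriangular_inverse (\<lambda>i j. \<phi> i j p) i l * \<phi> l j p))"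
      by (intro smooth_on_minus smooth_on_sum smooth_on_mult open_D less assms) simp
    then show ?thesis using True by (subst unitriangular_inverse.simps) simp
  next
    case False
    then show ?thesis by (subst unitriangular_inverse.simps) (cases "i = j", auto)
  qed
qed

text \<open>The derivative of such a combination is again one, with new coefficients on the jet
  space. This closure yields both the smoothness of the frame and its structure equation.\<close>

lemma section_deriv:
  assumes y: "ode_solution f D I y" and x: "x \<in> I"
    and w: "\<And>j. j \<le> k \<Longrightarrow> (w j has_vector_derivative (\<Sum>i\<le>k. base_matrix y x i j *\<^sub>R w i x)) (at x)"
    and \<rho>: "(\<rho> has_real_derivative - (t (x, jet y x) * \<rho> x)) (at x)"
    and g: "\<And>l. smooth_on D (g l)"
  shows "((\<lambda>x. \<rho> x *\<^sub>R (\<Sum>l\<le>k. g l (x, jet y x) *\<^sub>R w l x)) has_vector_derivative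
    \<rho> x *\<^sub>R (\<Sum>l\<le>k. (total_deriv (g l) (x, jet y x) + (if 0 < l then g (l - 1) (x, jet y x) else 0)
      + (if l = 0 then \<Sum>m\<le>k. base_coef m (x, jet y x) * g m (x, jet y x) else 0)
      - t (x, jet y x) * g l (x, jet y x)) *\<^sub>R (w l x :: real ^ 'n))) (at x)"
proof -
  let ?p = "(x, jet y x)"
  let ?s = "\<Sum>l\<le>k. g l ?p *\<^sub>R (\<Sum>i\<le>k. base_matrix y x i l *\<^sub>R w i x) + total_deriv (g l) ?p *\<^sub>R w l x"
  have "((\<lambda>x. \<rho> x *\<^sub>R (\<Sum>l\<le>k. g l (x, jet y x) *\<^sub>R w l x)) has_vector_derivative
      \<rho> x *\<^sub>R ?s + (- (t ?p * \<rho> x)) *\<^sub>R (\<Sum>l\<le>k. g l ?p *\<^sub>R w l x)) (at x)"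
    by (intro has_vector_derivative_scaleR has_vector_derivative_sum \<rho> along_solution[OF y x g] w) auto
  moreover have "?s = (\<Sum>l\<le>k. (total_deriv (g l) ?p + (\<Sum>m\<le>k. base_matrix y x l m * g m ?p)) *\<^sub>R w l x)"
  proof -
    have "(\<Sum>l\<le>k. g l ?p *\<^sub>R (\<Sum>i\<le>k. base_matrix y x i l *\<^sub>R w i x)) =
        (\<Sum>l\<le>k. (\<Sum>m\<le>k. base_matrix y x l m * g m ?p) *\<^sub>R w l x)"
      unfolding scaleR_sum_right scaleR_sum_left by (subst sum.swap) (simp add: mult.commute)
    then show ?thesis by (simp add: sum.distrib scaleR_add_left add.commute)
  qed
  moreover have "\<rho> x *\<^sub>R (\<Sum>l\<le>k. (total_deriv (g l) ?p + (\<Sum>m\<le>k. base_matrix y x l m * g m ?p)) *\<^sub>R w l x)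
      + (- (t ?p * \<rho> x)) *\<^sub>R (\<Sum>l\<le>k. g l ?p *\<^sub>R w l x) =
      \<rho> x *\<^sub>R (\<Sum>l\<le>k. (total_deriv (g l) ?p + (if 0 < l then g (l - 1) ?p else 0)
      + (if l = 0 then \<Sum>m\<le>k. base_coef m ?p * g m ?p else 0) - t ?p * g l ?p) *\<^sub>R w l x)"
    unfolding scaleR_sum_right sum.distrib[symmetric]
    by (intro sum.cong refl) (simp add: base_matrix_row algebra_simps)
  ultimately show ?thesis by simp
qed

text \<open>\<tau> with index 0 multiplies \<open>y^0\<close>, the identity, so a scalar factor
  removes it. The value 1 at \<open>x0\<close> keeps the frame at the base point a function of the
  initial jet.\<close>

lemma integrating_factor:
  assumes "ode_solution f D I y" "smooth_on D t"
  obtains \<rho> where "\<rho> x0 = 1" "\<And>x. \<rho> x > 0"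
    "\<And>x. x \<in> I \<Longrightarrow> (\<rho> has_real_derivative - (t (x, jet y x) * \<rho> x)) (at x)"
proof -
  obtain F where F: "F x0 = 0" "\<And>x. x \<in> I \<Longrightarrow> (F has_vector_derivative t (x, jet y x)) (at x)"
    using antiderivative_on_interval[OF open_I int_I x0 continuous_along[OF assms]] by blast
  show ?thesis
  proof (rule that[of "\<lambda>x. exp (- F x)"])
    show "((\<lambda>x. exp (- F x)) has_real_derivative - (t (x, jet y x) * exp (- F x))) (at x)" if "x \<in> I" for x
      using F(2)[OF that] unfolding has_real_derivative_iff_has_vector_derivative[symmetric]
      by (auto intro!: derivative_eq_intros)
  qed (simp_all add: F)
qed

text \<open>
  \<open>E\<close> and \<open>C\<close> give the frame and the coframe at the base point \<open>x0\<close> as functions of the initial jet alone.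
\<close>

definition has_adapted_frame ::
  "(nat \<Rightarrow> real ^ 'n \<Rightarrow> real ^ 'n) \<Rightarrow> (nat \<Rightarrow> real ^ 'n \<Rightarrow> real ^ 'n \<Rightarrow> real) \<Rightarrow> (real \<Rightarrow> real) \<Rightarrow> bool" where
  "has_adapted_frame E C y \<longleftrightarrow> (\<exists>e c \<theta> b.
      osculating_frame k I e c (\<lambda>x. wilczynski_matrix k (\<lambda>m. \<theta> m x) 0 (b x)) (linearization_curve f I x0 y)
      \<and> wilczynski_frame k I (linearization_curve f I x0 y) e \<theta>
      \<and> (\<forall>i\<le>k. e i x0 = E i (jet y x0)) \<and> (\<forall>i\<le>k. c i x0 = C i (jet y x0)))"

text \<open>The frame \<open>w\<close> is fixed at \<open>x0\<close> by its initial values, the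
  scalar factor is 1 there, and the change of frame is a function on the jet space. Evaluating at
  \<open>(x0, u)\<close> therefore gives the frame at \<open>x0\<close> without solving any
  equation.\<close>

lemma natural_frame:
  obtains E :: "nat \<Rightarrow> real ^ 'n \<Rightarrow> real ^ 'n" and C :: "nat \<Rightarrow> real ^ 'n \<Rightarrow> real ^ 'n \<Rightarrow> real" where
    "\<And>U i m. open U \<Longrightarrow> (\<And>u. u \<in> U \<Longrightarrow> (x0, u) \<in> D) \<Longrightarrow> smooth_on U (\<lambda>u. E i u $ m)"
    "\<And>U i v. open U \<Longrightarrow> (\<And>u. u \<in> U \<Longrightarrow> (x0, u) \<in> D) \<Longrightarrow> smooth_on U (\<lambda>u. C i u v)"
    "\<And>y. ode_solution f D I y \<Longrightarrow> has_adapted_frame E C y"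
proof -
  have T0: "total_deriv (\<lambda>_. r) = (\<lambda>_. 0)" for r
    by (simp add: total_deriv_def fun_eq_iff)
  obtain \<phi> \<tau> where sm: "\<And>i j. smooth_on D (\<phi> i j)" "\<And>r. smooth_on D (\<tau> r)"
    and diag: "\<And>i p. \<phi> i i p = 1" and low: "\<And>i j p. j < i \<Longrightarrow> \<phi> i j p = 0"
    and eq: "\<And>i j p. i \<le> k \<Longrightarrow> j \<le> k \<Longrightarrow> (if j < k then \<phi> i (j + 1) p else 0) =
      (if 0 < i then \<phi> (i - 1) j p else 0) + total_deriv (\<phi> i j) p
      + (if i = 0 then \<Sum>l\<le>k. base_coef l p * \<phi> l j p else 0)
      - (\<Sum>r\<le>j. \<tau> r p * ycoef k (j - r) r * \<phi> i (j - r) p)"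
  proof (rule wilczynski_normal_form[where R = "smooth_on D" and T = total_deriv and k = k and \<alpha> = base_coef],
      goal_cases)
    case (7 \<phi> \<tau>)
    show ?case by (rule 7(1)[OF 7(2-)])
  qed (simp_all add: T0 smooth_total_deriv smooth_base_coef smooth_on_add smooth_on_mult open_D)
  define \<psi> where "\<psi> i j p = unitriangular_inverse (\<lambda>i j. \<phi> i j p) i j" for i j p
  have sm\<psi>: "smooth_on D (\<psi> i j)" for i j
    unfolding \<psi>_def[abs_def] by (rule smooth_unitriangular_inverse[OF sm(1)])
  define E where "E i u = (\<Sum>l\<le>k. \<phi> l i (x0, u) *\<^sub>R (- 1) ^ l *\<^sub>R (axis (jet_index (k - l)) 1 :: real ^ 'n))" for i u
  define C where "C i u v = (\<Sum>m\<le>k. \<psi> i m (x0, u) * pairing m v)" for i u v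
  show ?thesis
  proof (rule that[of E C])
    fix U :: "(real ^ 'n) set" and i m v assume U: "open U" "\<And>u. u \<in> U \<Longrightarrow> (x0, u) \<in> D"
    note slice = smooth_on_slice[OF open_D U(1) _ U(2)]
    show "smooth_on U (\<lambda>u. C i u v)"
      unfolding C_def by (intro smooth_on_sum smooth_on_mult slice U sm\<psi> smooth_on_const)
    have "smooth_on U (\<lambda>u. \<Sum>l\<le>k. \<phi> l i (x0, u) * ((- 1) ^ l * (axis (jet_index (k - l)) 1 :: real ^ 'n) $ m))"
      by (intro smooth_on_sum smooth_on_mult slice U sm smooth_on_const)
    then show "smooth_on U (\<lambda>u. E i u $ m)" by (simp add: E_def mult.assoc)
  next
    fix y assume y: "ode_solution f D I y"
    obtain w q where mf: "moving_frame k I w q (base_matrix y)"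
      and w': "\<And>x j. x \<in> I \<Longrightarrow> j \<le> k \<Longrightarrow> (w j has_vector_derivative (\<Sum>i\<le>k. base_matrix y x i j *\<^sub>R w i x)) (at x)"
      and w0: "\<And>j. j \<le> k \<Longrightarrow> w j x0 = (- 1) ^ j *\<^sub>R axis (jet_index (k - j)) 1"
      and q0: "\<And>j v. q j x0 v = pairing j v"
      and curve: "\<And>x. x \<in> I \<Longrightarrow> linearization_curve f I x0 y x = span {w 0 x}"
    proof (rule base_frame[OF y], goal_cases)
      case 1
      show ?case by (rule 1(1)[OF 1(2-)])
    qed
    obtain \<rho> where \<rho>: "\<rho> x0 = 1" "\<And>x. \<rho> x > 0"
        "\<And>x. x \<in> I \<Longrightarrow> (\<rho> has_real_derivative - (\<tau> 0 (x, jet y x) * \<rho> x)) (at x)"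
    proof (rule integrating_factor[OF y sm(2)[of 0]], goal_cases)
      case 1
      show ?case by (rule 1(1)[OF 1(2-)])
    qed
    define P where "P x = (x, jet y x :: real ^ 'n)" for x
    define sec where "sec g x = \<rho> x *\<^sub>R (\<Sum>l\<le>k. g l (P x) *\<^sub>R w l x)"
      for g :: "nat \<Rightarrow> real \<times> (real ^ 'n) \<Rightarrow> real" and x
    \<comment> \<open>\<open>nab\<close> is d/dx written on coefficients, including the contribution
      of the scalar factor.\<close>
    define nab where "nab g l p = total_deriv (g l) p + (if 0 < l then g (l - 1) p else 0)
        + (if l = 0 then \<Sum>m\<le>k. base_coef m p * g m p else 0) - \<tau> 0 p * g l p" for g l p
    have sec': "(sec g has_vector_derivative sec (nab g) x) (at x)" if "\<And>l. smooth_on D (g l)" "x \<in> I" for g x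
      using section_deriv[where t = "\<tau> 0" and w = w and \<rho> = \<rho> and g = g, OF y that(2) w'[OF that(2)] \<rho>(3)[OF that(2)] that(1)]
      unfolding sec_def[abs_def] nab_def P_def by simp
    have sm_nab: "smooth_on D (nab g l)" if "\<And>l. smooth_on D (g l)" for g l
    proof -
      have "smooth_on D (\<lambda>p. if 0 < l then g (l - 1) p else 0)"
        using that by (cases "0 < l") auto
      moreover have "smooth_on D (\<lambda>p. if l = 0 then \<Sum>m\<le>k. base_coef m p * g m p else 0)"
        using that by (cases "l = 0") (auto intro!: smooth_on_sum smooth_on_mult open_D smooth_base_coef)
      ultimately show ?thesis
        unfolding nab_def[abs_def]
        by (intro smooth_on_diff smooth_on_add smooth_on_mult open_D smooth_total_deriv that sm) auto
    qed
    have sm_sec: "smooth_on I (sec g)" if "\<And>l. smooth_on D (g l)" for g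
    proof (rule smooth_on_curve_coinduct[where P = "\<lambda>F. \<exists>g. (\<forall>l. smooth_on D (g l)) \<and> F = sec g"])
      show "\<exists>G. (\<exists>g. (\<forall>l. smooth_on D (g l)) \<and> G = sec g) \<and> (\<forall>x\<in>I. (F has_vector_derivative G x) (at x))"
        if "\<exists>g. (\<forall>l. smooth_on D (g l)) \<and> F = sec g" for F
      proof -
        from that obtain g where g: "\<And>l. smooth_on D (g l)" "F = sec g" by auto
        have "\<forall>x\<in>I. (sec g has_vector_derivative sec (nab g) x) (at x)" "\<forall>l. smooth_on D (nab g l)"
          using sec'[of g] sm_nab[of g] g(1) by auto
        then show ?thesis unfolding g(2) by blast
      qed
    qed (use that open_I in auto)
    \<comment> \<open>The index shifts by one: \<open>\<tau> p\<close> multiplies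
      \<open>y^p\<close>, which carries the invariant with index \<open>p + 1\<close>.\<close>
    define \<theta> where "\<theta> m x = \<tau> (m - 1) (P x)" for m x
    define b where "b x = \<tau> 1 (P x)" for x
    define W where "W x = wilczynski_matrix k (\<lambda>m. \<theta> m x) 0 (b x)" for x
    have W: "W x i j = (if i = Suc j then 1 else if i < j then \<tau> (j - i) (P x) * ycoef k i (j - i) else 0)"
      if "i \<le> k" "j \<le> k" for x i j
      using that unfolding W_def \<theta>_def b_def by (auto simp: wilczynski_matrix_eq)
    define e where "e j = sec (\<lambda>l. \<phi> l j)" for j
    define c where "c i x v = inverse (\<rho> x) * (\<Sum>m\<le>k. \<psi> i m (P x) * q m x v)" for i x v
    have e': "(e j has_vector_derivative (\<Sum>i\<le>k. W x i j *\<^sub>R e i x)) (at x)" if x: "x \<in> I" and j: "j \<le> k" for x j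
    proof -
      have nab: "nab (\<lambda>l. \<phi> l j) l p = (\<Sum>i\<le>k. \<phi> l i p *
          (if i = Suc j then 1 else if i < j then \<tau> (j - i) p * ycoef k i (j - i) else 0))" if l: "l \<le> k" for l p
      proof -
        \<comment> \<open>The normal-form equation \<open>eq\<close> is solved for the terms
          occurring in \<open>nab\<close>; its summand \<open>r = 0\<close> will cancel the
          subtracted \<open>\<tau> 0\<close>.\<close>
        have "nab (\<lambda>l. \<phi> l j) l p = (if j < k then \<phi> l (j + 1) p else 0)
            + (\<Sum>r\<le>j. \<tau> r p * ycoef k (j - r) r * \<phi> l (j - r) p) - \<tau> 0 p * \<phi> l j p"
          unfolding eq[OF l j] nab_def by simp
        also have "(\<Sum>r\<le>j. \<tau> r p * ycoef k (j - r) r * \<phi> l (j - r) p) =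
            (\<Sum>i\<le>j. \<tau> (j - i) p * ycoef k i (j - i) * \<phi> l i p)"
          by (rule sum.reindex_bij_witness[where i = "\<lambda>i. j - i" and j = "\<lambda>i. j - i"]) auto
        also have "\<dots> = (\<Sum>i<j. \<tau> (j - i) p * ycoef k i (j - i) * \<phi> l i p) + \<tau> 0 p * \<phi> l j p"
          by (simp add: lessThan_Suc_atMost[symmetric])
        also have "(\<Sum>i<j. \<tau> (j - i) p * ycoef k i (j - i) * \<phi> l i p) =
            (\<Sum>i\<le>k. if i < j then \<tau> (j - i) p * ycoef k i (j - i) * \<phi> l i p else 0)"
          using j by (intro sum.mono_neutral_cong_left) auto
        also have "(if j < k then \<phi> l (j + 1) p else 0) = (\<Sum>i\<le>k. if i = Suc j then \<phi> l i p else 0)"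
          by simp
        finally have "nab (\<lambda>l. \<phi> l j) l p = (\<Sum>i\<le>k. (if i = Suc j then \<phi> l i p else 0)
            + (if i < j then \<tau> (j - i) p * ycoef k i (j - i) * \<phi> l i p else 0))"
          by (simp add: sum.distrib)
        also have "\<dots> = (\<Sum>i\<le>k. \<phi> l i p *
          (if i = Suc j then 1 else if i < j then \<tau> (j - i) p * ycoef k i (j - i) else 0))"
          by (intro sum.cong refl) auto
        finally show ?thesis .
      qed
      have "sec (nab (\<lambda>l. \<phi> l j)) x = \<rho> x *\<^sub>R (\<Sum>l\<le>k. (\<Sum>i\<le>k. \<phi> l i (P x) * W x i j) *\<^sub>R w l x)"
        unfolding sec_def using j by (intro arg_cong[where f = "\<lambda>z. \<rho> x *\<^sub>R z"] sum.cong refl) (simp add: nab W)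
      also have "\<dots> = (\<Sum>i\<le>k. W x i j *\<^sub>R e i x)"
        unfolding e_def sec_def scaleR_sum_right scaleR_sum_left
        by (subst sum.swap) (simp add: mult.commute mult.left_commute)
      finally show ?thesis using sec'[of "\<lambda>l. \<phi> l j", OF sm(1) x] unfolding e_def by simp
    qed
    have qlin: "linear (q m x)" if "x \<in> I" "m \<le> k" for m x using moving_frame.lin[OF mf that] .
    have dual: "c i x (e j x) = (if i = j then 1 else 0)" if x: "x \<in> I" and ij: "i \<le> k" "j \<le> k" for x i j
    proof -
      have "q m x (e j x) = \<rho> x * \<phi> m j (P x)" if m: "m \<le> k" for m
      proof -
        have "q m x (e j x) = \<rho> x * (\<Sum>l\<le>k. if l = m then \<phi> m j (P x) else 0)"
          unfolding e_def sec_def linear_scale[OF qlin[OF x m]] linear_sum[OF qlin[OF x m]] real_scaleR_def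
          by (intro arg_cong[where f = "\<lambda>z. \<rho> x * z"] sum.cong refl)
            (auto simp: linear_scale[OF qlin[OF x m]] moving_frame.dual[OF mf x m])
        then show ?thesis using m by simp
      qed
      then have "c i x (e j x) = inverse (\<rho> x) * (\<rho> x * (\<Sum>m\<le>k. \<psi> i m (P x) * \<phi> m j (P x)))"
        unfolding c_def sum_distrib_left by (intro arg_cong[where f = "\<lambda>z. inverse (\<rho> x) * z"] sum.cong refl) simp_all
      also have "\<dots> = (if i = j then 1 else 0)"
        using unitriangular_inverse_mult[of k "\<lambda>i j. \<phi> i j (P x)" i j] diag low ij \<rho>(2)[of x]
        unfolding \<psi>_def by simp
      finally show ?thesis .
    qed
    have mf': "moving_frame k I e c W"
    proof (rule moving_frameI)
      show "DIM(real ^ 'n) = k + 1" using card by simp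
      show "linear (c i x)" if "x \<in> I" "i \<le> k" for x i
        by (rule linearI) (auto simp: c_def linear_add[OF qlin[OF that(1)]] linear_scale[OF qlin[OF that(1)]]
            algebra_simps sum.distrib sum_distrib_left)
      show "(\<lambda>x. c i x v) differentiable (at x)" if x: "x \<in> I" and "i \<le> k" for x i v
      proof -
        have "(\<lambda>x. q m x v) differentiable (at x)" if "m \<le> k" for m
          using moving_frame.deriv_c[OF mf x that] real_differentiable_def by blast
        moreover have "(\<lambda>x. \<psi> i m (P x)) differentiable (at x)" for m
          using along_solution[OF y x sm\<psi>] real_differentiable_def unfolding P_def by blast
        moreover have "\<rho> differentiable (at x)" using \<rho>(3)[OF x] real_differentiable_def by blast
        moreover have "\<rho> x \<noteq> 0" using \<rho>(2)[of x] by simp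
        ultimately show ?thesis
          unfolding c_def by (intro differentiable_mult differentiable_sum differentiable_inverse) auto
      qed
    qed (use open_I dual e' in auto)
    have ofr: "osculating_frame k I e c W (linearization_curve f I x0 y)"
    proof (rule osculating_frame.intro[OF mf' osculating_frame_axioms.intro])
      show "smooth_on I (e 0)" unfolding e_def by (intro sm_sec sm)
      show "linearization_curve f I x0 y x = span {e 0 x}" if x: "x \<in> I" for x
      proof -
        have "e 0 x = \<rho> x *\<^sub>R (\<Sum>l\<le>k. if l = 0 then w 0 x else 0)"
          unfolding e_def sec_def
          by (intro arg_cong[where f = "\<lambda>z. \<rho> x *\<^sub>R z"] sum.cong refl) (auto simp: diag low)
        then have "e 0 x = \<rho> x *\<^sub>R w 0 x" by simp
        moreover have "\<rho> x \<noteq> 0" using \<rho>(2)[of x] by simp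
        ultimately have "span {e 0 x} = span {w 0 x}"
          using span_image_scale[of "{w 0 x}" "\<lambda>_. \<rho> x"] by simp
        then show ?thesis using curve[OF x] by simp
      qed
    qed (use W in auto)
    have "wilczynski_frame k I (linearization_curve f I x0 y) e \<theta>"
      unfolding wilczynski_frame_def
    proof (intro conjI)
      show "\<forall>i\<le>k. smooth_on I (e i)" unfolding e_def by (intro allI impI sm_sec sm)
      show "\<forall>t\<in>I. is_basis k (\<lambda>i. e i t)" using moving_frame.frame_basis[OF mf'] by blast
      show "\<forall>t\<in>I. \<forall>i\<le>k. osculating (linearization_curve f I x0 y) i t = span ((\<lambda>j. e j t) ` {..i})"
        using osculating_frame.osculating_eq[OF ofr] moving_frame.frame_span[OF mf'] by simp
      show "\<exists>a b. \<forall>t\<in>I. \<forall>j\<le>k. (e j has_vector_derivative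
          (\<Sum>i\<le>k. wilczynski_matrix k (\<lambda>m. \<theta> m t) (a t) (b t) i j *\<^sub>R e i t)) (at t)"
        using e' unfolding W_def by (intro exI[of _ "\<lambda>_. 0"] exI[of _ b]) auto
    qed
    moreover have "e i x0 = E i (jet y x0) \<and> c i x0 = C i (jet y x0)" if "i \<le> k" for i
      unfolding e_def sec_def c_def[abs_def] E_def C_def[abs_def] P_def \<rho>(1) using q0
      by (auto simp: w0 fun_eq_iff)
    ultimately show "has_adapted_frame E C y"
      using ofr unfolding W_def has_adapted_frame_def by blast
  qed
qed

end

subsection \<open>Compatible bilinear forms\<close>

lemma wilczynski_frame_osculating:
  assumes "wilczynski_frame k J \<gamma> e \<theta>" "t \<in> J" "j \<le> i" "i \<le> k"
  shows "e j t \<in> osculating \<gamma> i t"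
proof -
  have "osculating \<gamma> i t = span ((\<lambda>j. e j t) ` {..i})"
    using assms unfolding wilczynski_frame_def by blast
  then show ?thesis using assms(3) by (auto intro: span_base)
qed

definition gram_constant ::
  "nat \<Rightarrow> real set \<Rightarrow> ('v \<Rightarrow> 'v \<Rightarrow> real) \<Rightarrow> (nat \<Rightarrow> real \<Rightarrow> 'v) \<Rightarrow> real \<Rightarrow> bool" where
  "gram_constant k J b e c \<longleftrightarrow>
    (\<forall>t\<in>J. \<forall>i\<le>k. \<forall>j\<le>k. b (e i t) (e j t) = (if i + j = k then (- 1) ^ i * c else 0))"

text \<open>The parity is that of the power \<open>p\<close> of \<open>y\<close>; the indices
  \<open>p + 1\<close> of the invariants concerned are odd.\<close>

definition even_vanishing :: "nat \<Rightarrow> real set \<Rightarrow> (nat \<Rightarrow> real \<Rightarrow> real) \<Rightarrow> bool" where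
  "even_vanishing k J \<theta> \<longleftrightarrow> (\<forall>t\<in>J. \<forall>p. 2 \<le> p \<longrightarrow> p \<le> k \<longrightarrow> even p \<longrightarrow> \<theta> (p + 1) t = 0)"

lemma compatible_form_gram:
  fixes e :: "nat \<Rightarrow> real \<Rightarrow> 'v::euclidean_space"
  assumes fr: "wilczynski_frame k J \<gamma> e \<theta>" and J: "open J" "is_interval J" "J \<subseteq> I"
    and cf: "compatible_form k I \<gamma> b"
  obtains c where "gram_constant k J b e c"
    and "even_vanishing k J \<theta>"
    and "J \<noteq> {} \<longrightarrow> c \<noteq> 0"
proof -
  have bil: "bilinear b" using cf unfolding compatible_form_def nondegenerate_form_def by blast
  then have bb: "bounded_bilinear b" by (simp add: bilinear_conv_bounded_bilinear)
  obtain a b' where e': "\<And>t j. t \<in> J \<Longrightarrow> j \<le> k \<Longrightarrow> (e j has_vector_derivative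
      (\<Sum>i\<le>k. wilczynski_matrix k (\<lambda>m. \<theta> m t) (a t) (b' t) i j *\<^sub>R e i t)) (at t)"
    using fr unfolding wilczynski_frame_def by blast
  obtain c where c: "\<And>i j t. i \<le> k \<Longrightarrow> j \<le> k \<Longrightarrow> t \<in> J \<Longrightarrow> b (e i t) (e j t) = (if i + j = k then (- 1) ^ i * c else 0)"
      "\<And>p t. 2 \<le> p \<Longrightarrow> p \<le> k \<Longrightarrow> even p \<Longrightarrow> t \<in> J \<Longrightarrow> \<theta> (p + 1) t * c = 0"
  proof (rule gram_matrix_levels[OF J(1,2), where k = k and B = "\<lambda>i j t. b (e i t) (e j t)" and \<theta> = \<theta> and a = a and b = b'],
      goal_cases)
    case (1 i j t)
    have "((\<lambda>t. b (e i t) (e j t)) has_vector_derivative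
        b (e i t) (\<Sum>l\<le>k. wilczynski_matrix k (\<lambda>m. \<theta> m t) (a t) (b' t) l j *\<^sub>R e l t) +
        b (\<Sum>l\<le>k. wilczynski_matrix k (\<lambda>m. \<theta> m t) (a t) (b' t) l i *\<^sub>R e l t) (e j t)) (at t)"
      using 1 by (intro bounded_bilinear.has_vector_derivative[OF bb] e') auto
    then show ?case
      by (simp add: has_real_derivative_iff_has_vector_derivative bounded_bilinear.sum_left[OF bb]
          bounded_bilinear.sum_right[OF bb] bounded_bilinear.scaleR_left[OF bb] bounded_bilinear.scaleR_right[OF bb] add.commute)
  next
    case (2 i j t)
    then have "e i t \<in> osculating \<gamma> i t" "e j t \<in> osculating \<gamma> (k - 1 - i) t"
      using wilczynski_frame_osculating[OF fr] by auto
    moreover have "t \<in> I" "i \<le> k - 1" using 2 J(3) by auto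
    ultimately show ?case using cf unfolding compatible_form_def by blast
  next
    case 3
    show ?case by (rule 3(1)[OF 3(2-)])
  qed
  \<comment> \<open>Otherwise \<open>e 0\<close> is orthogonal to the whole basis and hence 0 by
    nondegeneracy.\<close>
  have "c \<noteq> 0" if "J \<noteq> {}"
  proof
    assume "c = 0"
    obtain t where t: "t \<in> J" using \<open>J \<noteq> {}\<close> by auto
    have basis: "is_basis k (\<lambda>i. e i t)" using fr t unfolding wilczynski_frame_def by blast
    have "b (e 0 t) w = 0" for w
    proof (rule linear_eq_0_on_span[where f = "b (e 0 t)" and b = "(\<lambda>i. e i t) ` {..k}"])
      show "linear (b (e 0 t))" using bil unfolding bilinear_def by blast
      show "b (e 0 t) x = 0" if "x \<in> (\<lambda>i. e i t) ` {..k}" for x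
        using that c(1)[OF _ _ t] \<open>c = 0\<close> by auto
      show "w \<in> span ((\<lambda>i. e i t) ` {..k})" using basis unfolding is_basis_def by simp
    qed
    then have "e 0 t = 0" using cf unfolding compatible_form_def nondegenerate_form_def by blast
    moreover have "e 0 t \<in> (\<lambda>i. e i t) ` {..k}" by auto
    ultimately show False using basis dependent_zero unfolding is_basis_def by metis
  qed
  then show ?thesis using that[of c] c unfolding gram_constant_def even_vanishing_def by force
qed

text \<open>In one frame both Gram matrices are multiples of the same constant matrix, so the
  comparison at the single point \<open>x\<close> decides.\<close>

lemma compatible_forms_proportional:
  fixes e :: "nat \<Rightarrow> real \<Rightarrow> 'v::euclidean_space"
  assumes fr: "wilczynski_frame k I \<gamma> e \<theta>" and I: "open I" "is_interval I" "x \<in> I"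
    and cf: "compatible_form k I \<gamma> b" "compatible_form k I \<gamma> b'"
  obtains r where "r \<noteq> 0" "\<And>v w. b' v w = r * b v w"
proof -
  have ne: "I \<noteq> {}" using I(3) by auto
  obtain c where c: "gram_constant k I b e c"
    "even_vanishing k I \<theta>" "I \<noteq> {} \<longrightarrow> c \<noteq> 0"
    by (rule compatible_form_gram[OF fr I(1,2) subset_refl cf(1)])
  obtain c' where c': "gram_constant k I b' e c'"
    "even_vanishing k I \<theta>" "I \<noteq> {} \<longrightarrow> c' \<noteq> 0"
    by (rule compatible_form_gram[OF fr I(1,2) subset_refl cf(2)])
  have basis: "span ((\<lambda>i. e i x) ` {..k}) = UNIV" using fr I(3) unfolding wilczynski_frame_def is_basis_def by blast
  have bil: "bilinear b" "bilinear b'" using cf unfolding compatible_form_def nondegenerate_form_def by auto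
  have bil2: "bilinear (\<lambda>v w. (c' / c) * b v w)"
    unfolding bilinear_def
    by (intro conjI allI linearI)
      (simp_all add: bilinear_ladd[OF bil(1)] bilinear_radd[OF bil(1)] bilinear_lmul[OF bil(1)]
        bilinear_rmul[OF bil(1)] distrib_left)
  have "c \<noteq> 0" using c(3) ne by simp
  then have "b' (e i x) (e j x) = (c' / c) * b (e i x) (e j x)" if "i \<le> k" "j \<le> k" for i j
    using c(1) c'(1) I(3) that unfolding gram_constant_def by simp
  then have on_basis: "b' v w = (c' / c) * b v w"
    if "v \<in> (\<lambda>i. e i x) ` {..k}" "w \<in> (\<lambda>i. e i x) ` {..k}" for v w
    using that by auto
  have "b' v w = (c' / c) * b v w" for v w
    by (rule bilinear_eq[OF bil(2) bil2, where S = UNIV and T = UNIV and B = "(\<lambda>i. e i x) ` {..k}"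
          and C = "(\<lambda>i. e i x) ` {..k}"])
      (simp_all only: basis subset_refl UNIV_I on_basis)
  then show ?thesis using that[of "c' / c"] c(3) c'(3) ne by auto
qed

text \<open>Infinitesimal invariance of the antidiagonal form. The matrices \<open>x\<close> and
  \<open>y^p\<close> with \<open>p\<close> odd are skew for it, and the even powers are excluded by
  the hypothesis.\<close>

lemma wilczynski_matrix_skew:
  assumes \<theta>: "\<And>p. 2 \<le> p \<Longrightarrow> p \<le> k \<Longrightarrow> even p \<Longrightarrow> \<theta> (p + 1) = 0" and jl: "j \<le> k" "l \<le> k"
  shows "(- 1) ^ (k - l) * wilczynski_matrix k \<theta> 0 b (k - l) j + (- 1) ^ j * wilczynski_matrix k \<theta> 0 b (k - j) l = 0"
proof -
  consider "k - l = j + 1" | "k - l > j + 1 \<or> k - l = j" | "k - l < j" by linarith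
  then show ?thesis
  proof cases
    case 1
    then have "k - j = l + 1" using jl by linarith
    then show ?thesis using 1 jl by (simp add: wilczynski_matrix_eq)
  next
    case 2
    then have "k - j > l + 1 \<or> k - j = l" using jl by linarith
    then show ?thesis using 2 jl by (auto simp: wilczynski_matrix_eq)
  next
    case 3
    \<comment> \<open>The common degree, column minus row, of the two matrix entries
      compared.\<close>
    define p where "p = j + l - k"
    have p: "p \<ge> 1" "p \<le> k" "j = k - l + p" "l = k - j + p" "k - j < l" using 3 jl unfolding p_def by linarith+
    define \<tau> where "\<tau> = (if p = 1 then b else \<theta> (p + 1))"
    have "k - l < j" "j - (k - l) = p" "j = k - l + 1 \<longleftrightarrow> p = 1" "k - l \<noteq> j + 1" "k - l \<noteq> j"
      and "k - j < l" "l - (k - j) = p" "l = k - j + 1 \<longleftrightarrow> p = 1" "k - j \<noteq> l + 1" "k - j \<noteq> l"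
      using 3 jl unfolding p_def by linarith+
    then have "wilczynski_matrix k \<theta> 0 b (k - l) j = \<tau> * ycoef k (k - l) p"
        "wilczynski_matrix k \<theta> 0 b (k - j) l = \<tau> * ycoef k (k - j) p"
      using jl by (simp_all add: \<tau>_def wilczynski_matrix_eq)
    moreover have "ycoef k (k - j) p = ycoef k (k - l) p"
      using ycoef_sym[of "k - l" p k] p(3)[symmetric] jl by simp
    moreover have "\<tau> = 0 \<or> (- 1 :: real) ^ (k - l) + (- 1) ^ j = 0"
    proof (cases "even p")
      case True
      then show ?thesis using \<theta>[of p] p(1,2) unfolding \<tau>_def by (cases "p = 1") auto
    next
      case False
      then have "(- 1 :: real) ^ (k - l) + (- 1) ^ (k - l + p) = 0" by (simp add: power_add)
      then show ?thesis unfolding p(3)[symmetric] by blast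
    qed
    moreover have "(- 1) ^ (k - l) * (\<tau> * ycoef k (k - l) p) + (- 1) ^ j * (\<tau> * ycoef k (k - l) p) =
        \<tau> * ((- 1) ^ (k - l) + (- 1) ^ j) * ycoef k (k - l) p" by (simp add: algebra_simps)
    ultimately show ?thesis by auto
  qed
qed

text \<open>In frame coordinates, the sl(2)-invariant bilinear form of the irreducible
  representation.\<close>

definition antidiagonal_form :: "nat \<Rightarrow> (nat \<Rightarrow> 'v \<Rightarrow> real) \<Rightarrow> 'v \<Rightarrow> 'v \<Rightarrow> real" where
  "antidiagonal_form k c v w = (\<Sum>i\<le>k. (- 1) ^ i * c i v * c (k - i) w)"

lemma antidiagonal_form_swap: "antidiagonal_form k c w v = (- 1) ^ k * antidiagonal_form k c v w"
  unfolding antidiagonal_form_def sum_distrib_left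
proof (rule sum.reindex_bij_witness[where i = "\<lambda>i. k - i" and j = "\<lambda>i. k - i"])
  fix i assume "i \<in> {..k}"
  then obtain m where m: "k = i + m" using le_Suc_ex by auto
  have "(- 1 :: real) ^ k * (- 1) ^ (k - i) = (- 1) ^ i"
    unfolding m by (simp add: power_add mult.assoc)
  then show "(- 1) ^ k * ((- 1) ^ (k - i) * c (k - i) v * c (k - (k - i)) w) = (- 1) ^ i * c i w * c (k - i) v"
    using \<open>i \<in> {..k}\<close> by (simp add: mult.assoc[symmetric])
qed auto

text \<open>By skewness of \<open>W\<close> the coframe at any point of \<open>I\<close> defines the
  same form. Its vanishing on the flag at \<open>t\<close> can thus be read off in the frame at
  \<open>t\<close>.\<close>

lemma (in osculating_frame) antidiagonal_form_compatible:
  assumes x0: "x0 \<in> I" and I: "is_interval I"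
    and W: "\<And>x. x \<in> I \<Longrightarrow> W x = wilczynski_matrix k (\<lambda>m. \<theta> m x) 0 (b x)"
    and \<theta>: "\<And>p x. 2 \<le> p \<Longrightarrow> p \<le> k \<Longrightarrow> even p \<Longrightarrow> x \<in> I \<Longrightarrow> \<theta> (p + 1) x = 0"
    and k: "1 \<le> k"
  shows "compatible_form k I \<gamma> (antidiagonal_form k (\<lambda>i. c i x0))"
proof -
  define B where "B v w x = antidiagonal_form k (\<lambda>i. c i x) v w" for v w x
  have B': "(B v w has_real_derivative 0) (at x)" if x: "x \<in> I" for v w x
  proof -
    have "(B v w has_real_derivative (\<Sum>i\<le>k. ((- 1) ^ i * (- (\<Sum>j\<le>k. W x i j * c j x v))) * c (k - i) x w
        + (- (\<Sum>j\<le>k. W x (k - i) j * c j x w)) * ((- 1) ^ i * c i x v))) (at x)"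
      unfolding B_def antidiagonal_form_def
      by (intro DERIV_sum DERIV_mult DERIV_cmult deriv_c x) auto
    moreover have "(\<Sum>i\<le>k. ((- 1) ^ i * (- (\<Sum>j\<le>k. W x i j * c j x v))) * c (k - i) x w
        + (- (\<Sum>j\<le>k. W x (k - i) j * c j x w)) * ((- 1) ^ i * c i x v)) = 0"
    proof -
      have "(\<Sum>i\<le>k. (- 1) ^ i * (\<Sum>j\<le>k. W x i j * c j x v) * c (k - i) x w) =
          (\<Sum>l\<le>k. (- 1) ^ (k - l) * (\<Sum>j\<le>k. W x (k - l) j * c j x v) * c l x w)"
        by (rule sum.reindex_bij_witness[where i = "\<lambda>i. k - i" and j = "\<lambda>i. k - i"]) auto
      also have "\<dots> = (\<Sum>j\<le>k. \<Sum>l\<le>k. (- 1) ^ (k - l) * W x (k - l) j * (c j x v * c l x w))"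
        by (subst sum.swap) (simp add: sum_distrib_left sum_distrib_right ac_simps)
      finally have 1: "(\<Sum>i\<le>k. (- 1) ^ i * (\<Sum>j\<le>k. W x i j * c j x v) * c (k - i) x w) = \<dots>" .
      have 2: "(\<Sum>i\<le>k. (\<Sum>j\<le>k. W x (k - i) j * c j x w) * ((- 1) ^ i * c i x v)) =
          (\<Sum>j\<le>k. \<Sum>l\<le>k. (- 1) ^ j * W x (k - j) l * (c j x v * c l x w))"
        by (simp add: sum_distrib_left sum_distrib_right ac_simps)
      have "(\<Sum>j\<le>k. \<Sum>l\<le>k. (- 1) ^ (k - l) * W x (k - l) j * (c j x v * c l x w)) +
          (\<Sum>j\<le>k. \<Sum>l\<le>k. (- 1) ^ j * W x (k - j) l * (c j x v * c l x w)) =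
          (\<Sum>j\<le>k. \<Sum>l\<le>k. ((- 1) ^ (k - l) * W x (k - l) j + (- 1) ^ j * W x (k - j) l) * (c j x v * c l x w))"
        by (simp add: sum.distrib[symmetric] distrib_right)
      also have "\<dots> = 0"
        using wilczynski_matrix_skew[where k = k and \<theta> = "\<lambda>m. \<theta> m x" and b = "b x"] \<theta> x
        by (intro sum.neutral ballI) (simp add: W[OF x])
      finally show ?thesis using 1 2 by (simp add: sum_subtractf sum_negf)
    qed
    ultimately show ?thesis by simp
  qed
  have const: "antidiagonal_form k (\<lambda>i. c i x0) v w = antidiagonal_form k (\<lambda>i. c i x) v w" if x: "x \<in> I" for v w x
  proof -
    have "convex I" using I by (simp add: is_interval_convex)
    then have "\<exists>r. \<forall>x\<in>I. B v w x = r"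
      by (rule has_field_derivative_zero_constant) (rule has_field_derivative_at_within[OF B'])
    then show ?thesis using x x0 unfolding B_def by auto
  qed
  have lin0: "linear (c i x0)" if "i \<le> k" for i using lin[OF x0 that] .
  have "bilinear (antidiagonal_form k (\<lambda>i. c i x0))"
    unfolding bilinear_def antidiagonal_form_def
    by (intro conjI allI linearI)
      (auto simp: linear_add[OF lin0] linear_scale[OF lin0] algebra_simps sum.distrib sum_distrib_left)
  moreover have "v = 0" if "\<forall>w. antidiagonal_form k (\<lambda>i. c i x0) v w = 0" for v
  proof (rule zeroI[OF x0])
    fix l assume l: "l \<le> k"
    have "antidiagonal_form k (\<lambda>i. c i x0) v (e (k - l) x0) = (\<Sum>i\<le>k. if i = l then (- 1) ^ l * c l x0 v else 0)"
      unfolding antidiagonal_form_def by (intro sum.cong refl) (use l in \<open>auto simp: dual[OF x0]\<close>)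
    then show "c l x0 v = 0" using that l by simp
  qed
  ultimately have "nondegenerate_form (antidiagonal_form k (\<lambda>i. c i x0))"
    unfolding nondegenerate_form_def by blast
  moreover have "antidiagonal_form k (\<lambda>i. c i x0) v w = 0"
    if "t \<in> I" "i \<le> k - 1" "v \<in> osculating \<gamma> i t" "w \<in> osculating \<gamma> (k - 1 - i) t" for t i v w
  proof -
    have v: "c l t v = 0" if "l \<le> k" "i < l" for l
      using osculating_eq[of t i] that \<open>t \<in> I\<close> \<open>v \<in> osculating \<gamma> i t\<close> by auto
    have w: "c l t w = 0" if "l \<le> k" "k - 1 - i < l" for l
      using osculating_eq[of t "k - 1 - i"] that \<open>t \<in> I\<close> \<open>w \<in> osculating \<gamma> (k - 1 - i) t\<close> by auto
    \<comment> \<open>Non-zero coordinates have index at most \<open>i\<close> for \<open>v\<close>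
      and at most \<open>k - 1 - i\<close> for \<open>w\<close>, while the indices \<open>l\<close>
      and \<open>k - l\<close> add up to \<open>k\<close>.\<close>
    have "c l t v = 0 \<or> c (k - l) t w = 0" if "l \<le> k" for l
      using v[of l] w[of "k - l"] that k \<open>i \<le> k - 1\<close> by (cases "i < l") auto
    then show ?thesis
      unfolding const[OF \<open>t \<in> I\<close>] unfolding antidiagonal_form_def by (intro sum.neutral) auto
  qed
  ultimately show ?thesis
    unfolding compatible_form_def using nondegenerate by blast
qed

section \<open>Proportionality of forms\<close>

lemma proportional_on_sym: "proportional_on U g h \<Longrightarrow> proportional_on U h g"
proof -
  assume "proportional_on U g h"
  then obtain c where c: "\<And>u. u \<in> U \<Longrightarrow> c u \<noteq> 0" "\<And>u v w. u \<in> U \<Longrightarrow> h u v w = c u * g u v w"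
    unfolding proportional_on_def by metis
  then show ?thesis unfolding proportional_on_def by (intro exI[of _ "\<lambda>u. inverse (c u)"]) auto
qed

lemma proportional_on_trans: "proportional_on U g h \<Longrightarrow> proportional_on U h l \<Longrightarrow> proportional_on U g l"
proof -
  assume "proportional_on U g h" "proportional_on U h l"
  then obtain c d where c: "\<And>u. u \<in> U \<Longrightarrow> c u \<noteq> 0" "\<And>u v w. u \<in> U \<Longrightarrow> h u v w = c u * g u v w"
    and d: "\<And>u. u \<in> U \<Longrightarrow> d u \<noteq> 0" "\<And>u v w. u \<in> U \<Longrightarrow> l u v w = d u * h u v w"
    unfolding proportional_on_def by metis
  then show ?thesis unfolding proportional_on_def by (intro exI[of _ "\<lambda>u. d u * c u"]) auto
qed

lemma proportional_on_refl: "proportional_on U g g"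
  unfolding proportional_on_def by (intro exI[of _ "\<lambda>u. 1"]) auto

subsection \<open>Compatible three-forms\<close>

lemma soct_three_form_eq:
  "soct_three_form (\<alpha>, a, b) (\<alpha>', a', b') (\<alpha>'', a'', b'') =
    (\<alpha>'' * (b \<bullet> a' - a \<bullet> b') - \<alpha> * (a' \<bullet> b'') + \<alpha>' * (a \<bullet> b'') - \<alpha>' * (a'' \<bullet> b) + \<alpha> * (a'' \<bullet> b')
      - cross3 b b' \<bullet> b'' + cross3 a a' \<bullet> a'') / 2"
  by (simp add: soct_three_form_def inner_diff_left inner_diff_right inner_add_left inner_add_right
      inner_scaleR_left inner_scaleR_right inner_commute algebra_simps)

text \<open>
  The factors are such that the octonionic 3-form becomes \<open>g2_poly\<close>, which is the 3-form invariant under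
  the matrices \<open>x\<close>, \<open>y\<close> and \<open>y\<^sup>5\<close> of size 7.
\<close>

definition soct_coord :: "(nat \<Rightarrow> real) \<Rightarrow> real \<times> (real ^ 3) \<times> (real ^ 3)" where
  "soct_coord c = (c 3, vector [c 1, c 2, - 2 * c 6], vector [2 * c 5, - 2 * c 4, c 0])"

text \<open>The 3-by-3 minor with columns \<open>i\<close>, \<open>j\<close>, \<open>l\<close>, that
  is, the value of an elementary 3-form.\<close>

definition alt3 :: "(nat \<Rightarrow> real) \<Rightarrow> (nat \<Rightarrow> real) \<Rightarrow> (nat \<Rightarrow> real) \<Rightarrow> nat \<Rightarrow> nat \<Rightarrow> nat \<Rightarrow> real" where
  "alt3 a b c i j l = a i * (b j * c l - b l * c j) - a j * (b i * c l - b l * c i) + a l * (b i * c j - b j * c i)"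

text \<open>Each index triple has sum 9, so the weights \<open>6 - 2 i\<close> of \<open>h\<close>
  add up to 0: the form is invariant under \<open>h\<close> too.\<close>

definition g2_poly :: "(nat \<Rightarrow> real) \<Rightarrow> (nat \<Rightarrow> real) \<Rightarrow> (nat \<Rightarrow> real) \<Rightarrow> real" where
  "g2_poly a b c = alt3 a b c 0 3 6 - alt3 a b c 1 2 6 + alt3 a b c 1 3 5 - alt3 a b c 2 3 4 - 2 * alt3 a b c 0 4 5"

lemma soct_three_form_coord:
  "soct_three_form (soct_coord a) (soct_coord b) (soct_coord c) = g2_poly a b c"
  unfolding soct_coord_def soct_three_form_eq g2_poly_def alt3_def
  by (simp add: cross3_simps inner_vec_def sum_3 field_simps)

lemma soct_three_form_linear:
  "linear (\<lambda>p. soct_three_form p q r)" "linear (\<lambda>q. soct_three_form p q r)" "linear (\<lambda>r. soct_three_form p q r)"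
proof -
  obtain pa pb pc where p: "p = (pa, pb, pc)" by (cases p)
  obtain qa qb qc where q: "q = (qa, qb, qc)" by (cases q)
  obtain ra rb rc where r: "r = (ra, rb, rc)" by (cases r)
  show "linear (\<lambda>p. soct_three_form p q r)"
    by (rule linearI; clarsimp simp: q r soct_three_form_eq cross3_simps inner_vec_def sum_3 field_simps)
  show "linear (\<lambda>q. soct_three_form p q r)"
    by (rule linearI; clarsimp simp: p r soct_three_form_eq cross3_simps inner_vec_def sum_3 field_simps)
  show "linear (\<lambda>r. soct_three_form p q r)"
    by (rule linearI; clarsimp simp: p q soct_three_form_eq cross3_simps inner_vec_def sum_3 field_simps)
qed

lemma soct_three_form_alternating:
  "soct_three_form q p r = - soct_three_form p q r" "soct_three_form p r q = - soct_three_form p q r"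
  by (cases p; cases q; cases r; simp add: soct_three_form_eq cross3_simps inner_vec_def sum_3 field_simps)+

lemma soct_three_form_nonzero: "soct_three_form (1, 0, 0) (0, axis 1 1, 0) (0, 0, axis 1 1) \<noteq> 0"
  by (simp add: soct_three_form_eq inner_axis_axis)

locale alternating_trilinear =
  fixes \<Omega> :: "'v::euclidean_space \<Rightarrow> 'v \<Rightarrow> 'v \<Rightarrow> real"
  assumes lin1: "\<And>q r. linear (\<lambda>p. \<Omega> p q r)" and lin2: "\<And>p r. linear (\<lambda>q. \<Omega> p q r)"
    and lin3: "\<And>p q. linear (\<lambda>r. \<Omega> p q r)"
    and alt1: "\<And>p q r. \<Omega> q p r = - \<Omega> p q r" and alt2: "\<And>p q r. \<Omega> p r q = - \<Omega> p q r"
begin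

lemma eq_same: "\<Omega> p p r = 0" "\<Omega> p r r = 0" "\<Omega> p r p = 0"
  using alt1[of p p r] alt2[of p r r] alt1[of r p p] alt2[of r p p] by simp_all

text \<open>Expanding the first argument in the standard basis reduces the product rule to that of
  bilinear maps.\<close>

lemma has_derivative_trilinear:
  assumes p: "(p has_vector_derivative p') (at t)" and q: "(q has_vector_derivative q') (at t)"
    and r: "(r has_vector_derivative r') (at t)"
  shows "((\<lambda>t. \<Omega> (p t) (q t) (r t)) has_real_derivative
    \<Omega> p' (q t) (r t) + \<Omega> (p t) q' (r t) + \<Omega> (p t) (q t) r') (at t)"
proof -
  have ex: "\<Omega> x y z = (\<Sum>b\<in>Basis. (x \<bullet> b) * \<Omega> b y z)" for x y z
    using linear_sum[OF lin1, of "\<lambda>b. (x \<bullet> b) *\<^sub>R b" Basis y z]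
    by (simp add: linear_scale[OF lin1] euclidean_representation)
  have bil: "bounded_bilinear (\<Omega> b)" for b
    unfolding bilinear_conv_bounded_bilinear[symmetric] bilinear_def using lin2 lin3 by auto
  have d: "((\<lambda>t. p t \<bullet> b) has_real_derivative p' \<bullet> b) (at t)" for b
    using bounded_linear.has_vector_derivative[OF bounded_linear_inner_left p]
    by (simp add: has_real_derivative_iff_has_vector_derivative)
  have "((\<lambda>t. \<Omega> b (q t) (r t)) has_real_derivative \<Omega> b (q t) r' + \<Omega> b q' (r t)) (at t)" for b
    using bounded_bilinear.has_vector_derivative[OF bil q r]
    by (simp add: has_real_derivative_iff_has_vector_derivative)
  then have "((\<lambda>t. \<Sum>b\<in>Basis. (p t \<bullet> b) * \<Omega> b (q t) (r t)) has_real_derivative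
      (\<Sum>b\<in>Basis. (p' \<bullet> b) * \<Omega> b (q t) (r t) + (\<Omega> b (q t) r' + \<Omega> b q' (r t)) * (p t \<bullet> b))) (at t)"
    by (intro DERIV_sum DERIV_mult d)
  moreover have "(\<Sum>b\<in>Basis. (p' \<bullet> b) * \<Omega> b (q t) (r t) + (\<Omega> b (q t) r' + \<Omega> b q' (r t)) * (p t \<bullet> b))
      = \<Omega> p' (q t) (r t) + \<Omega> (p t) q' (r t) + \<Omega> (p t) (q t) r'"
    unfolding ex[of p'] ex[of "p t"] by (simp add: sum.distrib algebra_simps)
  ultimately show ?thesis unfolding ex[of "p _"] by simp
qed

end

lemma G2_form_alternating: "G2_form \<Omega> \<Longrightarrow> alternating_trilinear \<Omega>"
proof -
  assume "G2_form \<Omega>"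
  then obtain \<phi> where \<phi>: "linear \<phi>" "\<And>u v w. \<Omega> u v w = soct_three_form (\<phi> u) (\<phi> v) (\<phi> w)"
    unfolding G2_form_def by blast
  show ?thesis
  proof (rule alternating_trilinear.intro)
    show "linear (\<lambda>p. \<Omega> p q r)" "linear (\<lambda>q. \<Omega> p q r)" "linear (\<lambda>r. \<Omega> p q r)" for p q r
      unfolding \<phi>(2) using linear_compose[OF \<phi>(1) soct_three_form_linear(1)]
        linear_compose[OF \<phi>(1) soct_three_form_linear(2)] linear_compose[OF \<phi>(1) soct_three_form_linear(3)]
      by (simp_all add: o_def)
    show "\<Omega> q p r = - \<Omega> p q r" "\<Omega> p r q = - \<Omega> p q r" for p q r
      unfolding \<phi>(2) by (rule soct_three_form_alternating)+
  qed
qed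

lemma G2_form_nonzero:
  assumes "G2_form \<Omega>" obtains p q r where "\<Omega> p q r \<noteq> 0"
proof -
  from assms obtain \<phi> where \<phi>: "bij \<phi>" "\<And>u v w. \<Omega> u v w = soct_three_form (\<phi> u) (\<phi> v) (\<phi> w)"
    unfolding G2_form_def by blast
  then have "\<Omega> (inv \<phi> (1, 0, 0)) (inv \<phi> (0, axis 1 1, 0)) (inv \<phi> (0, 0, axis 1 1)) \<noteq> 0"
    using soct_three_form_nonzero by (simp add: bij_is_surj surj_f_inv_f)
  then show ?thesis by (rule that)
qed

lemma ycoef_numeral: "ycoef k i (numeral n) =
    ycoef k i (pred_numeral n) * (real (i + pred_numeral n + 1) * (real k + 1 - real (i + pred_numeral n + 1)))"
  unfolding numeral_eq_Suc by (rule ycoef_Suc)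

lemma sum_atMost_6: "(\<Sum>i\<le>6. g i) = g 0 + g 1 + g 2 + g 3 + g 4 + g 5 + g (6 :: nat)"
  for g :: "nat \<Rightarrow> 'a::comm_monoid_add"
  by (simp add: eval_nat_numeral add.assoc)

lemma ycoef_6_1: "ycoef 6 i (Suc 0) = real (i + 1) * (6 - real i)"
  using ycoef_Suc[of 6 i 0] by simp

text \<open>The numerical factors are products of consecutive terms of 6, 10, 12, 12, 10, 6, the
  entries \<open>i (7 - i)\<close> of \<open>y\<close>.\<close>

lemma wilczynski_matrix_6:
  fixes \<theta> :: "nat \<Rightarrow> real" and a b :: real and e :: "nat \<Rightarrow> 'v::real_vector"
  defines "W \<equiv> wilczynski_matrix 6 \<theta> a b"
  shows "(\<Sum>i\<le>6. W i 0 *\<^sub>R e i) = (6 * a) *\<^sub>R e 0 + e 1"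
    "(\<Sum>i\<le>6. W i 1 *\<^sub>R e i) = (6 * b) *\<^sub>R e 0 + (4 * a) *\<^sub>R e 1 + e 2"
    "(\<Sum>i\<le>6. W i 2 *\<^sub>R e i) = (60 * \<theta> 3) *\<^sub>R e 0 + (10 * b) *\<^sub>R e 1 + (2 * a) *\<^sub>R e 2 + e 3"
    "(\<Sum>i\<le>6. W i 3 *\<^sub>R e i) = (720 * \<theta> 4) *\<^sub>R e 0 + (120 * \<theta> 3) *\<^sub>R e 1 + (12 * b) *\<^sub>R e 2 + e 4"
    "(\<Sum>i\<le>6. W i 4 *\<^sub>R e i) = (8640 * \<theta> 5) *\<^sub>R e 0 + (1440 * \<theta> 4) *\<^sub>R e 1 + (144 * \<theta> 3) *\<^sub>R e 2
       + (12 * b) *\<^sub>R e 3 + (- 2 * a) *\<^sub>R e 4 + e 5"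
    "(\<Sum>i\<le>6. W i 5 *\<^sub>R e i) = (86400 * \<theta> 6) *\<^sub>R e 0 + (14400 * \<theta> 5) *\<^sub>R e 1 + (1440 * \<theta> 4) *\<^sub>R e 2
       + (120 * \<theta> 3) *\<^sub>R e 3 + (10 * b) *\<^sub>R e 4 + (- 4 * a) *\<^sub>R e 5 + e 6"
    "(\<Sum>i\<le>6. W i 6 *\<^sub>R e i) = (518400 * \<theta> 7) *\<^sub>R e 0 + (86400 * \<theta> 6) *\<^sub>R e 1 + (8640 * \<theta> 5) *\<^sub>R e 2
       + (720 * \<theta> 4) *\<^sub>R e 3 + (60 * \<theta> 3) *\<^sub>R e 4 + (6 * b) *\<^sub>R e 5 + (- 6 * a) *\<^sub>R e 6"
  unfolding sum_atMost_6 W_def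
  by (simp_all add: wilczynski_matrix_eq ycoef_numeral ycoef_6_1 mult.commute)

text \<open>The derivative of a component of level \<open>s = i + j + l\<close> involves level
  \<open>s + 1\<close> through \<open>x\<close>, and level \<open>s - p\<close> through
  \<open>y^p\<close>. The form is zero below level 9, a multiple of the model on level 9 and zero
  above. The invariant with index \<open>p + 1\<close> thus meets the constant in the equations of
  level \<open>9 + p\<close>; at \<open>p = 5\<close> it drops out because \<open>y^5\<close>
  preserves the model.\<close>

lemma (in alternating_trilinear) compatible_three_form:
  fixes e :: "nat \<Rightarrow> real \<Rightarrow> 'v"
  assumes J: "open J" "is_interval J"
    and e': "\<And>t j. t \<in> J \<Longrightarrow> j \<le> 6 \<Longrightarrow> (e j has_vector_derivative
      (\<Sum>i\<le>6. wilczynski_matrix 6 (\<lambda>m. \<theta> m t) (a t) (b t) i j *\<^sub>R e i t)) (at t)"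
    and flag: "\<And>t z. t \<in> J \<Longrightarrow> \<Omega> (e 0 t) (e 1 t) z = 0" "\<And>t z. t \<in> J \<Longrightarrow> \<Omega> (e 0 t) (e 2 t) z = 0"
  obtains c where "\<And>t u v w. t \<in> J \<Longrightarrow>
      \<Omega> (\<Sum>i\<le>6. u i *\<^sub>R e i t) (\<Sum>i\<le>6. v i *\<^sub>R e i t) (\<Sum>i\<le>6. w i *\<^sub>R e i t) = c * g2_poly u v w"
    "\<And>t. t \<in> J \<Longrightarrow> \<theta> 3 t * c = 0 \<and> \<theta> 4 t * c = 0 \<and> \<theta> 5 t * c = 0 \<and> \<theta> 7 t * c = 0"
    "\<And>t. t \<in> J \<Longrightarrow> \<Omega> (e 0 t) (e 3 t) (e 6 t) = c"
proof -
  define O3 where "O3 i j l t = \<Omega> (e i t) (e j t) (e l t)" for i j l :: nat and t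
  define de where "de j t = (\<Sum>i\<le>6. wilczynski_matrix 6 (\<lambda>m. \<theta> m t) (a t) (b t) i j *\<^sub>R e i t)" for j t
  define S where "S i j l t = \<Omega> (de i t) (e j t) (e l t) + \<Omega> (e i t) (de j t) (e l t) + \<Omega> (e i t) (e j t) (de l t)" for i j l t
  have O': "(O3 i j l has_real_derivative S i j l t) (at t)" if "t \<in> J" "i \<le> 6" "j \<le> 6" "l \<le> 6" for i j l t
    unfolding O3_def S_def de_def using that by (intro has_derivative_trilinear e') auto
  have ratio: "S i j l t = r * S 0 3 6 t"
    if "\<And>s. s \<in> J \<Longrightarrow> O3 i j l s = r * O3 0 3 6 s" "t \<in> J" "i \<le> 6" "j \<le> 6" "l \<le> 6" for i j l t r
  proof -
    have "((\<lambda>s. r * O3 0 3 6 s) has_real_derivative S i j l t) (at t)"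
      using has_field_derivative_transform_within_open[OF O'[OF that(2-5)] J(1) that(2) that(1)] by simp
    moreover have "((\<lambda>s. r * O3 0 3 6 s) has_real_derivative r * S 0 3 6 t) (at t)"
      using that(2) by (intro DERIV_cmult O') auto
    ultimately show ?thesis by (rule DERIV_unique)
  qed
  have zero: "S i j l t = 0"
    if "\<And>s. s \<in> J \<Longrightarrow> O3 i j l s = 0" "t \<in> J" "i \<le> 6" "j \<le> 6" "l \<le> 6" for i j l t
    using ratio[of i j l 0] that by simp
  note lin = linear_add[OF lin1] linear_add[OF lin2] linear_add[OF lin3]
    linear_scale[OF lin1] linear_scale[OF lin2] linear_scale[OF lin3]
    linear_diff[OF lin1] linear_diff[OF lin2] linear_diff[OF lin3]
    linear_neg[OF lin1] linear_neg[OF lin2] linear_neg[OF lin3]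
  \<comment> \<open>These rules put the indices in increasing order, so that simplification sees
    each component in one form only.\<close>
  have sort: "j < i \<Longrightarrow> O3 i j l t = - O3 j i l t" "l < j \<Longrightarrow> O3 i j l t = - O3 i l j t"
    "O3 i i l t = 0" "O3 i j j t = 0" for i j l t
    unfolding O3_def by (rule alt1 alt2 eq_same)+
  have fold: "\<Omega> (e i t) (e j t) (e l t) = O3 i j l t" for i j l t by (simp add: O3_def)
  note Ssimps = S_def de_def wilczynski_matrix_6 wilczynski_matrix_6(2)[unfolded One_nat_def] lin fold sort
  have f: "O3 0 (Suc 0) l t = 0" "O3 0 1 l t = 0" "O3 0 2 l t = 0" if "t \<in> J" for l t
    using flag[OF that] by (simp_all add: O3_def)
  \<comment> \<open>The components \<open>O3 0 2 l\<close> vanish identically. Differentiating them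
    gives \<open>O3 1 2 l + O3 0 3 l = 0\<close>.\<close>
  have L1: "O3 1 2 3 t = 0 \<and> O3 1 2 4 t = - O3 0 3 4 t \<and> O3 1 2 5 t = - O3 0 3 5 t \<and> O3 1 2 6 t = - O3 0 3 6 t"
    if t: "t \<in> J" for t
    using zero[of 0 2 3 t] zero[of 0 2 4 t] zero[of 0 2 5 t] zero[of 0 2 6 t] t f
    by (simp add: Ssimps)
  have L2: "O3 1 2 4 t = 0" "O3 0 3 4 t = 0" if t: "t \<in> J" for t
    using zero[of 1 2 3 t] t f L1 by (simp_all add: Ssimps)
  have L3: "O3 1 2 5 t = 0" "O3 0 3 5 t = 0" "O3 1 3 4 t = 0" if t: "t \<in> J" for t
    using zero[of 1 2 4 t] zero[of 0 3 4 t] t f L1 L2 by (simp_all add: Ssimps)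
  note low = f L1[THEN conjunct1] L2 L3
  have L4: "O3 1 2 6 t = - O3 0 3 6 t" "O3 1 3 5 t = O3 0 3 6 t" "O3 2 3 4 t = - O3 0 3 6 t" "O3 0 4 5 t = - 2 * O3 0 3 6 t"
    if t: "t \<in> J" for t
    using zero[of 0 2 6 t] zero[of 0 3 5 t] zero[of 1 2 5 t] zero[of 1 3 4 t] t low by (simp_all add: Ssimps)
  \<comment> \<open>The other level 9 components are constant multiples of \<open>O3 0 3 6\<close>.
    Comparing derivatives gives a linear system that kills the four components of level 10 together
    with the derivative of \<open>O3 0 3 6\<close>.\<close>
  have L5: "O3 1 3 6 t = 0" "O3 0 4 6 t = 0" "O3 2 3 5 t = 0" "O3 1 4 5 t = 0" "S 0 3 6 t = 0"
    if t: "t \<in> J" for t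
    using ratio[of 1 2 6 "-1" t] ratio[of 1 3 5 1 t] ratio[of 2 3 4 "-1" t] ratio[of 0 4 5 "-2" t] t L4 low
    by (simp_all add: Ssimps)
  note low = low L4 L5(1-4)
  have L6: "O3 1 4 6 t = 0" "O3 0 5 6 t = 0" "O3 2 3 6 t = 0" "O3 2 4 5 t = 0" if t: "t \<in> J" for t
    using zero[of 0 4 6 t] zero[of 1 3 6 t] zero[of 2 3 5 t] zero[of 1 4 5 t] t low by (simp_all add: Ssimps)
  note low = low L6
  \<comment> \<open>From here on the equations outnumber the remaining components by one as long as
    \<open>p < 5\<close>; the surplus equation yields the vanishing of an invariant times the
    constant.\<close>
  have L7: "O3 1 5 6 t = 0 \<and> O3 2 4 6 t = 0 \<and> O3 3 4 5 t = 0 \<and> \<theta> 3 t * O3 0 3 6 t = 0" if t: "t \<in> J" for t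
    using zero[of 0 5 6 t] zero[of 1 4 6 t] zero[of 2 3 6 t] zero[of 2 4 5 t] t low
    by (simp add: Ssimps, intro iffD1[OF mult_eq_0_iff], simp only: mult.assoc)
  have L7': "O3 1 5 6 t = 0" "O3 2 4 6 t = 0" "O3 3 4 5 t = 0" "\<theta> 3 t * O3 0 3 6 t = 0" if "t \<in> J" for t
    using L7[OF that] by blast+
  note low = low L7'
  have L8: "O3 2 5 6 t = 0" "O3 3 4 6 t = 0" "\<theta> 4 t * O3 0 3 6 t = 0" if t: "t \<in> J" for t
    using zero[of 1 5 6 t] zero[of 2 4 6 t] zero[of 3 4 5 t] t low
    by (simp_all add: Ssimps)
  note low = low L8
  have L9: "O3 3 5 6 t = 0" "\<theta> 5 t * O3 0 3 6 t = 0" if t: "t \<in> J" for t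
    using zero[of 2 5 6 t] zero[of 3 4 6 t] t low
    by (simp_all add: Ssimps)
  note low = low L9
  have L10: "O3 4 5 6 t = 0" if t: "t \<in> J" for t
    using zero[of 3 5 6 t] t low by (simp add: Ssimps)
  \<comment> \<open>No component lies above level 15, so this equation contains only the invariant
    with index 7.\<close>
  have L11: "\<theta> 7 t * O3 0 3 6 t = 0" if t: "t \<in> J" for t
    using zero[of 4 5 6 t] t low L10 by (simp add: Ssimps)
  have "\<exists>c. \<forall>t\<in>J. O3 0 3 6 t = c"
  proof (rule has_field_derivative_zero_constant)
    show "convex J" using J(2) by (simp add: is_interval_convex)
    show "(O3 0 3 6 has_real_derivative 0) (at t within J)" if "t \<in> J" for t
      using O'[of t 0 3 6] L5(5)[OF that] that by (simp add: has_field_derivative_at_within)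
  qed
  then obtain c where c: "\<And>t. t \<in> J \<Longrightarrow> O3 0 3 6 t = c" by auto
  show ?thesis
  proof (rule that[of c])
    fix t assume t: "t \<in> J"
    show "\<theta> 3 t * c = 0 \<and> \<theta> 4 t * c = 0 \<and> \<theta> 5 t * c = 0 \<and> \<theta> 7 t * c = 0"
      using L7[OF t] L8[OF t] L9[OF t] L11[OF t] c[OF t] by simp
    show "\<Omega> (e 0 t) (e 3 t) (e 6 t) = c" using c[OF t] by (simp add: O3_def)
    fix u v w :: "nat \<Rightarrow> real"
    show "\<Omega> (\<Sum>i\<le>6. u i *\<^sub>R e i t) (\<Sum>i\<le>6. v i *\<^sub>R e i t) (\<Sum>i\<le>6. w i *\<^sub>R e i t) = c * g2_poly u v w"
      unfolding sum_atMost_6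
      by (simp add: lin fold sort low[OF t] low[OF t, unfolded One_nat_def] L10[OF t] c[OF t] g2_poly_def alt3_def algebra_simps)
  qed
qed

lemma basis_expansion_coefficients:
  assumes "is_basis k e" obtains u where "p = (\<Sum>i\<le>k. u i *\<^sub>R e i)"
proof -
  have inj: "inj_on e {..k}" and "p \<in> span (e ` {..k})" using assms unfolding is_basis_def by auto
  then have "p \<in> range (\<lambda>u. \<Sum>w\<in>e ` {..k}. u w *\<^sub>R w)"
    using span_finite[of "e ` {..k}"] by auto
  then obtain u where "p = (\<Sum>w\<in>e ` {..k}. u w *\<^sub>R w)" by auto
  then show ?thesis using that[of "\<lambda>i. u (e i)"] by (simp add: sum.reindex[OF inj])
qed

definition g2_gram ::
  "real set \<Rightarrow> ('v::real_vector \<Rightarrow> 'v \<Rightarrow> 'v \<Rightarrow> real) \<Rightarrow> (nat \<Rightarrow> real \<Rightarrow> 'v) \<Rightarrow> real \<Rightarrow> bool" where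
  "g2_gram J \<Omega> e c \<longleftrightarrow> (\<forall>t\<in>J. \<forall>u v w. \<Omega> (\<Sum>i\<le>6. u i *\<^sub>R e i t) (\<Sum>i\<le>6. v i *\<^sub>R e i t)
    (\<Sum>i\<le>6. w i *\<^sub>R e i t) = c * g2_poly u v w)"

text \<open>The constant is non-zero because a G2-form is not the zero form. Its expression as the
  value on \<open>e 0\<close>, \<open>e 3\<close>, \<open>e 6\<close> later shows that it depends
  smoothly on the initial jet.\<close>

lemma compatible_G2_gram:
  fixes e :: "nat \<Rightarrow> real \<Rightarrow> 'v::euclidean_space"
  assumes fr: "wilczynski_frame 6 J \<gamma> e \<theta>" and J: "open J" "is_interval J" "J \<subseteq> I" "J \<noteq> {}"
    and cf: "compatible_G2 I \<gamma> \<Omega>"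
  obtains c where "c \<noteq> 0" "\<forall>t\<in>J. \<theta> 3 t = 0 \<and> \<theta> 4 t = 0 \<and> \<theta> 5 t = 0 \<and> \<theta> 7 t = 0"
    "g2_gram J \<Omega> e c"
    "\<forall>t\<in>J. \<Omega> (e 0 t) (e 3 t) (e 6 t) = c"
proof -
  have g2: "G2_form \<Omega>" using cf unfolding compatible_G2_def by blast
  interpret alternating_trilinear \<Omega> by (rule G2_form_alternating[OF g2])
  obtain a b where e': "\<And>t j. t \<in> J \<Longrightarrow> j \<le> 6 \<Longrightarrow> (e j has_vector_derivative
      (\<Sum>i\<le>6. wilczynski_matrix 6 (\<lambda>m. \<theta> m t) (a t) (b t) i j *\<^sub>R e i t)) (at t)"
    using fr unfolding wilczynski_frame_def by blast
  have osc: "e j t \<in> osculating \<gamma> i t" if "t \<in> J" "j \<le> i" "i \<le> 6" for i j t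
  proof -
    have "osculating \<gamma> i t = span ((\<lambda>j. e j t) ` {..i})"
      using fr that unfolding wilczynski_frame_def by blast
    then show ?thesis using that(2) by (auto intro: span_base)
  qed
  have "e 0 t \<in> \<gamma> t" if "t \<in> J" for t
    using osc[of t 0 0] that unfolding osculating_def curve_lift_def by auto
  then have flag: "\<Omega> (e 0 t) (e j t) z = 0" if "t \<in> J" "j \<le> 2" for t j z
    using cf osc[of t j 2] that J(3) unfolding compatible_G2_def by auto
  obtain c where c: "\<And>t u v w. t \<in> J \<Longrightarrow>
      \<Omega> (\<Sum>i\<le>6. u i *\<^sub>R e i t) (\<Sum>i\<le>6. v i *\<^sub>R e i t) (\<Sum>i\<le>6. w i *\<^sub>R e i t) = c * g2_poly u v w"
    "\<And>t. t \<in> J \<Longrightarrow> \<theta> 3 t * c = 0 \<and> \<theta> 4 t * c = 0 \<and> \<theta> 5 t * c = 0 \<and> \<theta> 7 t * c = 0"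
    "\<And>t. t \<in> J \<Longrightarrow> \<Omega> (e 0 t) (e 3 t) (e 6 t) = c"
  proof (rule compatible_three_form[OF J(1,2) e'], goal_cases)
    case (5)
    show ?case by (rule 5(1)[OF 5(2-)])
  qed (auto intro: flag)
  obtain t where t: "t \<in> J" using J(4) by auto
  have "c \<noteq> 0"
  proof
    assume "c = 0"
    obtain p q r where pqr: "\<Omega> p q r \<noteq> 0" using G2_form_nonzero[OF g2] .
    have basis: "is_basis 6 (\<lambda>i. e i t)" using fr t unfolding wilczynski_frame_def by blast
    obtain u where "p = (\<Sum>i\<le>6. u i *\<^sub>R e i t)" using basis_expansion_coefficients[OF basis] .
    moreover obtain v where "q = (\<Sum>i\<le>6. v i *\<^sub>R e i t)" using basis_expansion_coefficients[OF basis] .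
    moreover obtain w where "r = (\<Sum>i\<le>6. w i *\<^sub>R e i t)" using basis_expansion_coefficients[OF basis] .
    ultimately show False using c(1)[OF t, of u v w] pqr \<open>c = 0\<close> by simp
  qed
  then show ?thesis using that[of c] c unfolding g2_gram_def by auto
qed

section \<open>Invariance of the model 3-form\<close>

lemma alt3_deriv:
  assumes "\<And>m. m \<in> {i, j, l} \<Longrightarrow> ((\<lambda>x. a x m) has_real_derivative a' m) (at x)"
    "\<And>m. m \<in> {i, j, l} \<Longrightarrow> ((\<lambda>x. b x m) has_real_derivative b' m) (at x)"
    "\<And>m. m \<in> {i, j, l} \<Longrightarrow> ((\<lambda>x. c x m) has_real_derivative c' m) (at x)"
  shows "((\<lambda>x. alt3 (a x) (b x) (c x) i j l) has_real_derivative
    alt3 a' (b x) (c x) i j l + alt3 (a x) b' (c x) i j l + alt3 (a x) (b x) c' i j l) (at x)"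
  unfolding alt3_def by (rule derivative_eq_intros assms refl | simp)+ (simp add: algebra_simps)

lemma g2_poly_deriv:
  assumes "\<And>i. i \<le> 6 \<Longrightarrow> ((\<lambda>x. a x i) has_real_derivative a' i) (at x)"
    "\<And>i. i \<le> 6 \<Longrightarrow> ((\<lambda>x. b x i) has_real_derivative b' i) (at x)"
    "\<And>i. i \<le> 6 \<Longrightarrow> ((\<lambda>x. c x i) has_real_derivative c' i) (at x)"
  shows "((\<lambda>x. g2_poly (a x) (b x) (c x)) has_real_derivative
    g2_poly a' (b x) (c x) + g2_poly (a x) b' (c x) + g2_poly (a x) (b x) c') (at x)"
proof -
  define d where "d i j l = alt3 a' (b x) (c x) i j l + alt3 (a x) b' (c x) i j l + alt3 (a x) (b x) c' i j l" for i j l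
  have d: "((\<lambda>x. alt3 (a x) (b x) (c x) i j l) has_real_derivative d i j l) (at x)" if "i \<le> 6" "j \<le> 6" "l \<le> 6" for i j l
    unfolding d_def using that assms by (intro alt3_deriv) auto
  have "((\<lambda>x. g2_poly (a x) (b x) (c x)) has_real_derivative d 0 3 6 - d 1 2 6 + d 1 3 5 - d 2 3 4 - 2 * d 0 4 5) (at x)"
    unfolding g2_poly_def by (intro DERIV_diff DERIV_add DERIV_cmult d) simp_all
  then show ?thesis by (simp add: d_def g2_poly_def algebra_simps)
qed

lemma wilczynski_matrix_6_rows:
  fixes \<theta> :: "nat \<Rightarrow> real" and b :: real and g :: "nat \<Rightarrow> real"
  assumes "\<theta> 3 = 0" "\<theta> 4 = 0" "\<theta> 5 = 0" "\<theta> 7 = 0"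
  defines "W \<equiv> wilczynski_matrix 6 \<theta> 0 b"
  shows "(\<Sum>j\<le>6. W 0 j * g j) = 6 * b * g 1 + 86400 * \<theta> 6 * g 5"
    "(\<Sum>j\<le>6. W 1 j * g j) = g 0 + 10 * b * g 2 + 86400 * \<theta> 6 * g 6"
    "(\<Sum>j\<le>6. W 2 j * g j) = g 1 + 12 * b * g 3"
    "(\<Sum>j\<le>6. W 3 j * g j) = g 2 + 12 * b * g 4"
    "(\<Sum>j\<le>6. W 4 j * g j) = g 3 + 10 * b * g 5"
    "(\<Sum>j\<le>6. W 5 j * g j) = g 4 + 6 * b * g 6"
    "(\<Sum>j\<le>6. W 6 j * g j) = g 5"
  unfolding sum_atMost_6 W_def
  by (simp_all add: wilczynski_matrix_eq ycoef_numeral ycoef_6_1 mult.commute assms(1-4))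

lemma soct_coord_linear:
  "soct_coord (\<lambda>i. a i + b i) = soct_coord a + soct_coord b" "soct_coord (\<lambda>i. r * a i) = r *\<^sub>R soct_coord a"
  by (simp_all add: soct_coord_def vec_eq_iff forall_3 algebra_simps)

text \<open>With only \<open>b\<close> and the invariant of index 6 left, \<open>W\<close> preserves
  \<open>g2_poly\<close>. The 3-form is then the same in the coframe at every point, and
  compatibility at \<open>t\<close> is checked in the frame at \<open>t\<close>.\<close>

lemma (in osculating_frame) g2_form_compatible:
  assumes k6: "k = 6" and x0: "x0 \<in> I" and I: "is_interval I"
    and W: "\<And>x. x \<in> I \<Longrightarrow> W x = wilczynski_matrix 6 (\<lambda>m. \<theta> m x) 0 (b x)"
    and \<theta>: "\<And>x. x \<in> I \<Longrightarrow> \<theta> 3 x = 0" "\<And>x. x \<in> I \<Longrightarrow> \<theta> 4 x = 0" "\<And>x. x \<in> I \<Longrightarrow> \<theta> 5 x = 0"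
      "\<And>x. x \<in> I \<Longrightarrow> \<theta> 7 x = 0"
  shows "compatible_G2 I \<gamma> (\<lambda>u v w. soct_three_form (soct_coord (\<lambda>i. c i x0 u))
    (soct_coord (\<lambda>i. c i x0 v)) (soct_coord (\<lambda>i. c i x0 w)))"
proof -
  define P where "P u v w x = g2_poly (\<lambda>i. c i x u) (\<lambda>i. c i x v) (\<lambda>i. c i x w)" for u v w x
  have P': "(P u v w has_real_derivative 0) (at x)" if x: "x \<in> I" for u v w x
  proof -
    let ?N = "\<lambda>v i. - (\<Sum>j\<le>6. W x i j * c j x v)"
    have "(P u v w has_real_derivative
        g2_poly (?N u) (\<lambda>i. c i x v) (\<lambda>i. c i x w) + g2_poly (\<lambda>i. c i x u) (?N v) (\<lambda>i. c i x w)
        + g2_poly (\<lambda>i. c i x u) (\<lambda>i. c i x v) (?N w)) (at x)"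
      unfolding P_def[abs_def] using deriv_c[OF x] k6 by (intro g2_poly_deriv) auto
    \<comment> \<open>Infinitesimal invariance under \<open>x\<close>, \<open>y\<close> and
      \<open>y^5\<close>, a polynomial identity in the coordinates of the three vectors.\<close>
    moreover have "g2_poly (?N u) (\<lambda>i. c i x v) (\<lambda>i. c i x w) + g2_poly (\<lambda>i. c i x u) (?N v) (\<lambda>i. c i x w)
        + g2_poly (\<lambda>i. c i x u) (\<lambda>i. c i x v) (?N w) = 0"
      unfolding g2_poly_def alt3_def W[OF x]
        wilczynski_matrix_6_rows[where \<theta> = "\<lambda>m. \<theta> m x", OF \<theta>[OF x]]
      by (simp only: minus_add_distrib) algebra
    ultimately show ?thesis by simp
  qed
  have const: "P u v w x0 = P u v w x" if x: "x \<in> I" for u v w x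
  proof -
    have "convex I" using I by (simp add: is_interval_convex)
    then have "\<exists>r. \<forall>x\<in>I. P u v w x = r"
      by (rule has_field_derivative_zero_constant) (rule has_field_derivative_at_within[OF P'])
    then show ?thesis using x x0 by auto
  qed
  define \<phi> where "\<phi> v = soct_coord (\<lambda>i. c i x0 v)" for v
  have form: "soct_three_form (\<phi> u) (\<phi> v) (\<phi> w) = P u v w x0" for u v w
    unfolding \<phi>_def P_def by (rule soct_three_form_coord)
  have lin0: "linear (c i x0)" if "i \<le> 6" for i using lin[OF x0] that k6 by simp
  have G2: "G2_form (\<lambda>u v w. soct_three_form (\<phi> u) (\<phi> v) (\<phi> w))"
    unfolding G2_form_def
  proof (intro exI[of _ \<phi>] conjI allI refl)
    have "soct_coord (\<lambda>i. c i x0 (v + w)) = soct_coord (\<lambda>i. c i x0 v + c i x0 w)"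
      "soct_coord (\<lambda>i. c i x0 (r *\<^sub>R v)) = soct_coord (\<lambda>i. r * c i x0 v)" for v w r
      unfolding soct_coord_def by (simp_all add: linear_add[OF lin0] linear_scale[OF lin0])
    then show lin\<phi>: "linear \<phi>"
      unfolding \<phi>_def by (intro linearI) (simp_all add: soct_coord_linear)
    show "bij \<phi>"
    proof (rule bijI)
      show "inj \<phi>"
        unfolding linear_injective_0[OF lin\<phi>]
      proof (intro allI impI)
        fix v assume "\<phi> v = 0"
        then have z: "c 0 x0 v = 0" "c 1 x0 v = 0" "c 2 x0 v = 0" "c 3 x0 v = 0" "c 4 x0 v = 0" "c 5 x0 v = 0" "c 6 x0 v = 0"
          unfolding \<phi>_def soct_coord_def by (simp_all add: zero_prod_def vec_eq_iff forall_3)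
        show "v = 0"
        proof (rule zeroI[OF x0])
          fix l assume "l \<le> k"
          then have "l = 0 \<or> l = 1 \<or> l = 2 \<or> l = 3 \<or> l = 4 \<or> l = 5 \<or> l = 6" using k6 by arith
          then show "c l x0 v = 0" using z by auto
        qed
      qed
      show "surj \<phi>"
      \<comment> \<open>The preimage solves the defining equations of \<open>soct_coord\<close> for
        the seven coordinates.\<close>
      proof (rule surjI[of \<phi> "\<lambda>(r, p, q). \<Sum>i\<le>6. (if i = 0 then q $ 3 else if i = 1 then p $ 1
          else if i = 2 then p $ 2 else if i = 3 then r else if i = 4 then - q $ 2 / 2 else if i = 5 then q $ 1 / 2
          else - p $ 3 / 2) *\<^sub>R e i x0"])
        fix s :: "real \<times> (real ^ 3) \<times> (real ^ 3)"
        obtain r p q where s: "s = (r, p, q)" by (cases s)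
        have cs: "c l x0 (\<Sum>i\<le>6. g i *\<^sub>R e i x0) = g l" if "l \<le> 6" for g l
        proof -
          have "c l x0 (\<Sum>i\<le>6. g i *\<^sub>R e i x0) = (\<Sum>i\<le>6. if i = l then g l else 0)"
            unfolding linear_sum[OF lin0[OF that]] using that k6
            by (intro sum.cong refl) (auto simp: linear_scale[OF lin0[OF that]] dual[OF x0])
          then show ?thesis using that by simp
        qed
        show "\<phi> (case s of (r, p, q) \<Rightarrow> \<Sum>i\<le>6. (if i = 0 then q $ 3 else if i = 1 then p $ 1
          else if i = 2 then p $ 2 else if i = 3 then r else if i = 4 then - q $ 2 / 2 else if i = 5 then q $ 1 / 2
          else - p $ 3 / 2) *\<^sub>R e i x0) = s"
          unfolding s \<phi>_def soct_coord_def prod.case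
          by (simp add: cs vec_eq_iff forall_3)
      qed
    qed
  qed
  \<comment> \<open>\<open>u\<close> has only coordinate 0 and \<open>v\<close> only coordinates 0
    to 2, whereas the triples of \<open>g2_poly\<close> containing 0 are 0, 3, 6 and 0, 4,
    5.\<close>
  have "P u v w x0 = 0" if t: "t \<in> I" and u: "u \<in> \<gamma> t" and v: "v \<in> osculating \<gamma> 2 t" for t u v w
  proof -
    have "c l t v = 0" if "l \<le> 6" "2 < l" for l
      using osculating_eq[OF t, of 2] v that k6 by auto
    moreover have "c l t u = 0" if "l \<le> 6" "0 < l" for l
      using frame_span[OF t, of 0] gamma[OF t] u that k6 by auto
    ultimately show ?thesis
      unfolding const[OF t] unfolding P_def g2_poly_def alt3_def by simp
  qed
  then show ?thesis
    unfolding compatible_G2_def using G2 form nondegenerate k6 unfolding \<phi>_def by auto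
qed

subsection \<open>Natural structures on the solution space\<close>

locale solution_family = jet_ode f D I x0 k
  for f :: "real \<times> (real ^ 'n::finite) \<Rightarrow> real" and D I x0 k +
  fixes U :: "(real ^ 'n) set"
  assumes k: "2 \<le> k" and open_U: "open U" and U_ne: "U \<noteq> {}"
    and U_sol: "\<And>u. u \<in> U \<Longrightarrow> \<exists>y. ode_solution f D I y \<and> jet y x0 = u"
begin

abbreviation curve :: "(real \<Rightarrow> real) \<Rightarrow> real \<Rightarrow> (real ^ 'n) set" where
  "curve y \<equiv> linearization_curve f I x0 y"

abbreviation sols :: "(real \<Rightarrow> real) set" where
  "sols \<equiv> solution_space f D I x0 U"

lemma sols_iff: "y \<in> sols \<longleftrightarrow> ode_solution f D I y \<and> jet y x0 \<in> U"
  unfolding solution_space_def by simp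

lemma obtain_solution:
  assumes "u \<in> U" obtains y where "y \<in> sols" "ode_solution f D I y" "jet y x0 = u"
  using U_sol[OF assms] assms sols_iff by blast

lemma in_D: "u \<in> U \<Longrightarrow> (x0, u) \<in> D"
  using U_sol[of u] x0 unfolding ode_solution_def by blast

definition frame_family :: "(nat \<Rightarrow> real ^ 'n \<Rightarrow> real ^ 'n) \<Rightarrow> (nat \<Rightarrow> real ^ 'n \<Rightarrow> real ^ 'n \<Rightarrow> real) \<Rightarrow> bool" where
  "frame_family E C \<longleftrightarrow> (\<forall>i m. smooth_on U (\<lambda>u. E i u $ m)) \<and> (\<forall>i v. smooth_on U (\<lambda>u. C i u v)) \<and>
    (\<forall>y\<in>sols. has_adapted_frame E C y)"

lemma frame_family_exists: "\<exists>E C. frame_family E C"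
proof (rule natural_frame, goal_cases)
  case (1 E C)
  have "frame_family E C"
    unfolding frame_family_def
  proof (intro conjI allI ballI)
    show "smooth_on U (\<lambda>u. E i u $ m)" "smooth_on U (\<lambda>u. C i u v)" for i m v
      by (rule 1 open_U in_D | assumption)+
    show "has_adapted_frame E C y" if "y \<in> sols" for y
      using that by (intro 1(3)) (simp add: sols_iff)
  qed
  then show ?case by blast
qed

lemma frame_familyE:
  assumes "frame_family E C" "y \<in> sols"
  obtains e c \<theta> b where
    "osculating_frame k I e c (\<lambda>x. wilczynski_matrix k (\<lambda>m. \<theta> m x) 0 (b x)) (curve y)"
    "wilczynski_frame k I (curve y) e \<theta>"
    "\<forall>i\<le>k. e i x0 = E i (jet y x0)" "\<forall>i\<le>k. c i x0 = C i (jet y x0)"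
proof -
  have "has_adapted_frame E C y" using assms unfolding frame_family_def by blast
  then show ?thesis unfolding has_adapted_frame_def by (elim exE conjE) (rule that)
qed

lemma obtain_frame:
  assumes "y \<in> sols"
  obtains e \<theta> where "wilczynski_frame k I (curve y) e \<theta>"
proof -
  obtain E C where "frame_family E C" using frame_family_exists by blast
  from this assms show ?thesis by (rule frame_familyE) (rule that)
qed

lemma compatible_imp_vanishes:
  assumes "\<And>y. y \<in> sols \<Longrightarrow> compatible_form k I (curve y) (g (jet y x0))" "1 \<le> i" "2 * i + 1 \<le> k + 1"
  shows "generalized_wilczynski_vanishes k f D I x0 U (2 * i + 1)"
  unfolding generalized_wilczynski_vanishes_def wilczynski_vanishes_def
proof (intro ballI allI impI)
  fix y J e \<theta> t
  assume y: "y \<in> sols" and J: "open J" "is_interval J" "J \<subseteq> I" and fr: "wilczynski_frame k J (curve y) e \<theta>" and t: "t \<in> J"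
  obtain c where "gram_constant k J (g (jet y x0)) e c"
    "even_vanishing k J \<theta>" "J \<noteq> {} \<longrightarrow> c \<noteq> 0"
    by (rule compatible_form_gram[OF fr J assms(1)[OF y]])
  then have "2 \<le> p \<Longrightarrow> p \<le> k \<Longrightarrow> even p \<Longrightarrow> \<theta> (p + 1) t = 0" for p
    using t unfolding even_vanishing_def by blast
  from this[of "2 * i"] show "\<theta> (2 * i + 1) t = 0" using assms(2,3) by simp
qed

text \<open>The Gram entries at \<open>(0, k)\<close> and \<open>(k, 0)\<close> are non-zero and
  differ by the factor \<open>(- 1) ^ k\<close>.\<close>

lemma parity:
  assumes y: "y \<in> sols" and cf: "compatible_form k I (curve y) b"
  shows "(\<And>v w. b v w = b w v) \<Longrightarrow> even k" "(\<And>v w. b v w = - b w v) \<Longrightarrow> odd k"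
proof -
  obtain e \<theta> where fr: "wilczynski_frame k I (curve y) e \<theta>" using obtain_frame[OF y] .
  obtain c where c: "gram_constant k I b e c"
    "even_vanishing k I \<theta>" "I \<noteq> {} \<longrightarrow> c \<noteq> 0"
    by (rule compatible_form_gram[OF fr open_I int_I subset_refl cf])
  have "b (e 0 x0) (e k x0) = c" "b (e k x0) (e 0 x0) = (- 1) ^ k * c" "c \<noteq> 0"
    using c x0 unfolding gram_constant_def by auto
  then have "b (e 0 x0) (e k x0) = b (e k x0) (e 0 x0) \<longleftrightarrow> even k"
    "b (e 0 x0) (e k x0) = - b (e k x0) (e 0 x0) \<longleftrightarrow> odd k"
    by (simp_all add: minus_one_power_iff)
  then show "(\<And>v w. b v w = b w v) \<Longrightarrow> even k" "(\<And>v w. b v w = - b w v) \<Longrightarrow> odd k"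
    by blast+
qed

lemma proportional:
  assumes "\<And>y. y \<in> sols \<Longrightarrow> compatible_form k I (curve y) (g (jet y x0))"
    and "\<And>y. y \<in> sols \<Longrightarrow> compatible_form k I (curve y) (h (jet y x0))"
  shows "proportional_on U g h"
proof -
  have "\<exists>r. r \<noteq> 0 \<and> (\<forall>v w. h u v w = r * g u v w)" if u: "u \<in> U" for u
  proof -
    obtain y where y: "y \<in> sols" "jet y x0 = u" using obtain_solution[OF u] by metis
    obtain e \<theta> where fr: "wilczynski_frame k I (curve y) e \<theta>" using obtain_frame[OF y(1)] .
    show ?thesis
      using compatible_forms_proportional[OF fr open_I int_I x0 assms(1)[OF y(1)] assms(2)[OF y(1)]] y(2) by metis
  qed
  then show ?thesis unfolding proportional_on_def by metis
qed

text \<open>One construction serves both parities; the sign rule for swapping the arguments later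
  decides between metric and 2-form. Smoothness comes from the coframe at \<open>x0\<close> being a
  smooth function of the initial jet.\<close>

lemma vanishes_imp_form:
  assumes van: "\<And>i. 1 \<le> i \<Longrightarrow> 2 * i + 1 \<le> k + 1 \<Longrightarrow> generalized_wilczynski_vanishes k f D I x0 U (2 * i + 1)"
  obtains g where "\<And>v w. smooth_on U (\<lambda>u. g u v w)"
    "\<And>y. y \<in> sols \<Longrightarrow> compatible_form k I (curve y) (g (jet y x0))"
    "\<And>u v w. g u w v = (- 1) ^ k * g u v w"
proof -
  obtain E C where EC: "frame_family E C" using frame_family_exists by blast
  then have smC: "\<And>i v. smooth_on U (\<lambda>u. C i u v)"
    unfolding frame_family_def by blast
  define g where "g u = antidiagonal_form k (\<lambda>i. C i u)" for u
  show ?thesis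
  proof (rule that[of g])
    show "smooth_on U (\<lambda>u. g u v w)" for v w
      unfolding g_def antidiagonal_form_def
      by (intro smooth_on_sum smooth_on_mult open_U smooth_on_const smC)
    show "g u w v = (- 1) ^ k * g u v w" for u v w
      unfolding g_def by (rule antidiagonal_form_swap)
    fix y assume y: "y \<in> sols"
    obtain e c \<theta> b where of: "osculating_frame k I e c (\<lambda>x. wilczynski_matrix k (\<lambda>m. \<theta> m x) 0 (b x)) (curve y)"
      and wf: "wilczynski_frame k I (curve y) e \<theta>"
      and e: "\<forall>i\<le>k. e i x0 = E i (jet y x0)" and c: "\<forall>i\<le>k. c i x0 = C i (jet y x0)"
      by (rule frame_familyE[OF EC y])
    have "\<theta> (p + 1) x = 0" if "2 \<le> p" "p \<le> k" "even p" "x \<in> I" for p x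
    proof -
      obtain i where "p = 2 * i" using \<open>even p\<close> by auto
      then show ?thesis
        using van[of i] that y wf open_I int_I
        unfolding generalized_wilczynski_vanishes_def wilczynski_vanishes_def by auto
    qed
    then have "compatible_form k I (curve y) (antidiagonal_form k (\<lambda>i. c i x0))"
      using k by (intro osculating_frame.antidiagonal_form_compatible[OF of x0 int_I refl]) auto
    moreover have "antidiagonal_form k (\<lambda>i. c i x0) = g (jet y x0)"
      unfolding g_def antidiagonal_form_def fun_eq_iff by (simp add: c)
    ultimately show "compatible_form k I (curve y) (g (jet y x0))" by simp
  qed
qed

abbreviation odd_vanishing :: bool where
  "odd_vanishing \<equiv> (\<forall>i\<ge>1. 2 * i + 1 \<le> k + 1 \<longrightarrow> generalized_wilczynski_vanishes k f D I x0 U (2 * i + 1))"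

lemma compatible_class:
  assumes "\<And>y. y \<in> sols \<Longrightarrow> compatible_form k I (curve y) (g (jet y x0))" "proportional_on U g h"
    "\<And>u. u \<in> U \<Longrightarrow> nondegenerate_form (h u)" "y \<in> sols"
  shows "compatible_form k I (curve y) (h (jet y x0))"
proof -
  obtain r where "\<And>v w. h (jet y x0) v w = r * g (jet y x0) v w"
    using assms(2,4) unfolding proportional_on_def sols_iff by auto
  then show ?thesis
    using assms(1)[OF assms(4)] assms(3)[of "jet y x0"] assms(4) unfolding compatible_form_def sols_iff by simp
qed

text \<open>\<open>M\<close> stands for being a metric or a nondegenerate 2-form. Two compatible
  representatives are proportional, so they generate the same class.\<close>

lemma compatible_class_unique:
  assumes C: "C = {h. M h \<and> proportional_on U g h}" "M g"
      "\<forall>h\<in>C. \<forall>y\<in>sols. compatible_form k I (curve y) (h (jet y x0))"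
    and C': "C' = {h. M h \<and> proportional_on U g' h}" "M g'"
      "\<forall>h\<in>C'. \<forall>y\<in>sols. compatible_form k I (curve y) (h (jet y x0))"
  shows "C = C'"
proof -
  have "g \<in> C" "g' \<in> C'" using C(1,2) C'(1,2) proportional_on_refl by auto
  then have "proportional_on U g g'" using C(3) C'(3) by (intro proportional) blast+
  then have "proportional_on U g h \<longleftrightarrow> proportional_on U g' h" for h
    using proportional_on_trans proportional_on_sym by metis
  then show ?thesis unfolding C(1) C'(1) by simp
qed

lemma natural_pseudo_conformal_iff:
  "(\<exists>C. natural_pseudo_conformal k f D I x0 U C) \<longleftrightarrow>
    even k \<and> odd_vanishing"
proof
  assume "\<exists>C. natural_pseudo_conformal k f D I x0 U C"
  then obtain C where C: "natural_pseudo_conformal k f D I x0 U C" by blast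
  then obtain g where g: "pseudo_riemannian_metric U g" and C_eq: "C = {h. pseudo_riemannian_metric U h \<and> proportional_on U g h}"
    unfolding natural_pseudo_conformal_def pseudo_conformal_structure_def by blast
  then have "g \<in> C" by (simp add: proportional_on_refl)
  then have cf: "compatible_form k I (curve y) (g (jet y x0))" if "y \<in> sols" for y
    using C that unfolding natural_pseudo_conformal_def by blast
  obtain u where u: "u \<in> U" using U_ne by auto
  obtain y where y: "y \<in> sols" "jet y x0 = u" using obtain_solution[OF u] by metis
  have "even k"
    using parity(1)[OF y(1) cf[OF y(1)]] g u y(2) unfolding pseudo_riemannian_metric_def by blast
  then show "even k \<and> odd_vanishing"
    using compatible_imp_vanishes[OF cf] by blast
next
  assume *: "even k \<and> odd_vanishing"
  then obtain g where g: "\<And>v w. smooth_on U (\<lambda>u. g u v w)"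
    and cf: "\<And>y. y \<in> sols \<Longrightarrow> compatible_form k I (curve y) (g (jet y x0))"
    and sym: "\<And>u v w. g u w v = (- 1) ^ k * g u v w" using vanishes_imp_form by metis
  have "nondegenerate_form (g u)" if u: "u \<in> U" for u
    using obtain_solution[OF u] cf unfolding compatible_form_def by metis
  moreover have "g u v w = g u w v" for u v w using sym[of u w v] * by simp
  ultimately have met: "pseudo_riemannian_metric U g"
    unfolding pseudo_riemannian_metric_def using g by blast
  have "natural_pseudo_conformal k f D I x0 U {h. pseudo_riemannian_metric U h \<and> proportional_on U g h}"
    unfolding natural_pseudo_conformal_def pseudo_conformal_structure_def
  proof (intro conjI ballI)
    fix h y assume "h \<in> {h. pseudo_riemannian_metric U h \<and> proportional_on U g h}" "y \<in> sols"
    then show "compatible_form k I (curve y) (h (jet y x0))"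
      by (intro compatible_class[OF cf]) (auto simp: pseudo_riemannian_metric_def)
  qed (use met in blast)
  then show "\<exists>C. natural_pseudo_conformal k f D I x0 U C" by blast
qed

lemma natural_pseudo_conformal_unique: "\<exists>\<^sub>\<le>\<^sub>1 C. natural_pseudo_conformal k f D I x0 U C"
  unfolding Uniq_def
proof (intro allI impI)
  fix C C' assume *: "natural_pseudo_conformal k f D I x0 U C" "natural_pseudo_conformal k f D I x0 U C'"
  then obtain g where g: "pseudo_riemannian_metric U g" "C = {h. pseudo_riemannian_metric U h \<and> proportional_on U g h}"
    unfolding natural_pseudo_conformal_def pseudo_conformal_structure_def by blast
  from *(2) obtain g' where g': "pseudo_riemannian_metric U g'" "C' = {h. pseudo_riemannian_metric U h \<and> proportional_on U g' h}"
    unfolding natural_pseudo_conformal_def pseudo_conformal_structure_def by blast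
  show "C = C'"
    using * unfolding natural_pseudo_conformal_def
    by (elim conjE) (rule compatible_class_unique[OF g(2,1) _ g'(2,1)])
qed

lemma natural_pseudo_symplectic_iff:
  "(\<exists>C. natural_pseudo_symplectic k f D I x0 U C) \<longleftrightarrow>
    odd k \<and> odd_vanishing"
proof
  assume "\<exists>C. natural_pseudo_symplectic k f D I x0 U C"
  then obtain C where C: "natural_pseudo_symplectic k f D I x0 U C" by blast
  then obtain g where g: "nondegenerate_two_form U g" and C_eq: "C = {h. nondegenerate_two_form U h \<and> proportional_on U g h}"
    unfolding natural_pseudo_symplectic_def pseudo_symplectic_structure_def by blast
  then have "g \<in> C" by (simp add: proportional_on_refl)
  then have cf: "compatible_form k I (curve y) (g (jet y x0))" if "y \<in> sols" for y
    using C that unfolding natural_pseudo_symplectic_def by blast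
  obtain u where u: "u \<in> U" using U_ne by auto
  obtain y where y: "y \<in> sols" "jet y x0 = u" using obtain_solution[OF u] by metis
  have "g u v w = - g u w v" for v w
  proof -
    have bil: "bilinear (g u)" and alt: "\<And>v. g u v v = 0"
      using g u unfolding nondegenerate_two_form_def nondegenerate_form_def by auto
    show ?thesis
      using alt[of "v + w"] alt[of v] alt[of w] by (simp add: bilinear_ladd[OF bil] bilinear_radd[OF bil])
  qed
  then have "odd k"
    using parity(2)[OF y(1) cf[OF y(1)]] y(2) by blast
  then show "odd k \<and> odd_vanishing"
    using compatible_imp_vanishes[OF cf] by blast
next
  assume *: "odd k \<and> odd_vanishing"
  then obtain g where g: "\<And>v w. smooth_on U (\<lambda>u. g u v w)"
    and cf: "\<And>y. y \<in> sols \<Longrightarrow> compatible_form k I (curve y) (g (jet y x0))"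
    and sym: "\<And>u v w. g u w v = (- 1) ^ k * g u v w" using vanishes_imp_form by metis
  have "nondegenerate_form (g u)" if u: "u \<in> U" for u
    using obtain_solution[OF u] cf unfolding compatible_form_def by metis
  moreover have "g u v v = 0" for u v using sym[of u v v] * by simp
  ultimately have met: "nondegenerate_two_form U g"
    unfolding nondegenerate_two_form_def using g by simp
  have "natural_pseudo_symplectic k f D I x0 U {h. nondegenerate_two_form U h \<and> proportional_on U g h}"
    unfolding natural_pseudo_symplectic_def pseudo_symplectic_structure_def
  proof (intro conjI ballI)
    fix h y assume "h \<in> {h. nondegenerate_two_form U h \<and> proportional_on U g h}" "y \<in> sols"
    then show "compatible_form k I (curve y) (h (jet y x0))"
      by (intro compatible_class[OF cf]) (auto simp: nondegenerate_two_form_def)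
  qed (use met in blast)
  then show "\<exists>C. natural_pseudo_symplectic k f D I x0 U C" by blast
qed

lemma natural_pseudo_symplectic_unique: "\<exists>\<^sub>\<le>\<^sub>1 C. natural_pseudo_symplectic k f D I x0 U C"
  unfolding Uniq_def
proof (intro allI impI)
  fix C C' assume *: "natural_pseudo_symplectic k f D I x0 U C" "natural_pseudo_symplectic k f D I x0 U C'"
  then obtain g where g: "nondegenerate_two_form U g" "C = {h. nondegenerate_two_form U h \<and> proportional_on U g h}"
    unfolding natural_pseudo_symplectic_def pseudo_symplectic_structure_def by blast
  from *(2) obtain g' where g': "nondegenerate_two_form U g'" "C' = {h. nondegenerate_two_form U h \<and> proportional_on U g' h}"
    unfolding natural_pseudo_symplectic_def pseudo_symplectic_structure_def by blast
  show "C = C'"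
    using * unfolding natural_pseudo_symplectic_def
    by (elim conjE) (rule compatible_class_unique[OF g(2,1) _ g'(2,1)])
qed

lemma natural_G2_iff:
  assumes k6: "k = 6"
  shows "(\<exists>\<Omega>. natural_G2 f D I x0 U \<Omega>) \<longleftrightarrow> (\<forall>m\<in>{3, 4, 5, 7}. generalized_wilczynski_vanishes k f D I x0 U m)"
proof
  assume "\<exists>\<Omega>. natural_G2 f D I x0 U \<Omega>"
  then obtain \<Omega> where "natural_G2 f D I x0 U \<Omega>" by blast
  then have cf: "compatible_G2 I (curve y) (\<Omega> (jet y x0))" if "y \<in> sols" for y
    using that unfolding natural_G2_def by blast
  have "\<theta> m t = 0" if "m \<in> {3, 4, 5, 7}" "y \<in> sols" "open J" "is_interval J" "J \<subseteq> I"
    "wilczynski_frame k J (curve y) e \<theta>" "t \<in> J" for m y J e \<theta> t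
  proof -
    note h = that
    have "J \<noteq> {}" using h(7) by auto
    then obtain c where "c \<noteq> 0" "\<forall>t\<in>J. \<theta> 3 t = 0 \<and> \<theta> 4 t = 0 \<and> \<theta> 5 t = 0 \<and> \<theta> 7 t = 0"
      "g2_gram J (\<Omega> (jet y x0)) e c"
      "\<forall>t\<in>J. \<Omega> (jet y x0) (e 0 t) (e 3 t) (e 6 t) = c"
      by (rule compatible_G2_gram[OF h(6)[unfolded k6] h(3-5) _ cf[OF h(2)]])
    then show ?thesis using h(1,7) by auto
  qed
  then show "\<forall>m\<in>{3, 4, 5, 7}. generalized_wilczynski_vanishes k f D I x0 U m"
    unfolding generalized_wilczynski_vanishes_def wilczynski_vanishes_def by blast
next
  assume van: "\<forall>m\<in>{3, 4, 5, 7}. generalized_wilczynski_vanishes k f D I x0 U m"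
  obtain E C where EC: "frame_family E C" using frame_family_exists by blast
  then have smC: "\<And>i v. smooth_on U (\<lambda>u. C i u v)"
    unfolding frame_family_def by blast
  define \<phi> where "\<phi> u v = soct_coord (\<lambda>i. C i u v)" for u v
  define \<Omega> where "\<Omega> u v w z = soct_three_form (\<phi> u v) (\<phi> u w) (\<phi> u z)" for u v w z
  have cf: "compatible_G2 I (curve y) (\<Omega> (jet y x0))" if y: "y \<in> sols" for y
  proof -
    obtain e c \<theta> b where of: "osculating_frame k I e c (\<lambda>x. wilczynski_matrix k (\<lambda>m. \<theta> m x) 0 (b x)) (curve y)"
      and wf: "wilczynski_frame k I (curve y) e \<theta>"
      and e: "\<forall>i\<le>k. e i x0 = E i (jet y x0)" and c: "\<forall>i\<le>k. c i x0 = C i (jet y x0)"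
      by (rule frame_familyE[OF EC y])
    have "\<theta> m x = 0" if "m \<in> {3, 4, 5, 7}" "x \<in> I" for m x
      using van that y wf open_I int_I
      unfolding generalized_wilczynski_vanishes_def wilczynski_vanishes_def by blast
    then have "compatible_G2 I (curve y) (\<lambda>u v w. soct_three_form (soct_coord (\<lambda>i. c i x0 u))
        (soct_coord (\<lambda>i. c i x0 v)) (soct_coord (\<lambda>i. c i x0 w)))"
      by (intro osculating_frame.g2_form_compatible[OF of k6 x0 int_I, where \<theta> = \<theta> and b = b]) (simp_all add: k6)
    moreover have "soct_coord (\<lambda>i. c i x0 u) = \<phi> (jet y x0) u" for u
      unfolding \<phi>_def soct_coord_def by (simp add: c k6)
    ultimately show ?thesis unfolding \<Omega>_def[abs_def] by simp
  qed
  have "G2_structure U \<Omega>"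
    unfolding G2_structure_def
  proof (intro conjI allI ballI)
    show "smooth_on U (\<lambda>u. \<Omega> u v w z)" for v w z
      unfolding \<Omega>_def \<phi>_def soct_three_form_coord g2_poly_def alt3_def
      by (intro smooth_on_add smooth_on_diff smooth_on_mult open_U smooth_on_const smC)
    show "G2_form (\<Omega> u)" if u: "u \<in> U" for u
      using obtain_solution[OF u] cf unfolding compatible_G2_def by metis
  qed
  then show "\<exists>\<Omega>. natural_G2 f D I x0 U \<Omega>"
    unfolding natural_G2_def using cf by blast
qed

text \<open>At each point both 3-forms are multiples of the same model in the same frame, so their
  values on \<open>E 0\<close>, \<open>E 3\<close>, \<open>E 6\<close> give the factor. These values
  never vanish, and the quotient is smooth.\<close>

lemma natural_G2_unique:
  assumes k6: "k = 6" and \<Omega>: "natural_G2 f D I x0 U \<Omega>" and \<Omega>': "natural_G2 f D I x0 U \<Omega>'"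
  shows "\<exists>c. smooth_on U c \<and> (\<forall>u\<in>U. c u \<noteq> 0 \<and> (\<forall>v w z. \<Omega>' u v w z = c u * \<Omega> u v w z))"
proof -
  obtain E C where EC: "frame_family E C" using frame_family_exists by blast
  then have smE: "\<And>i m. smooth_on U (\<lambda>u. E i u $ m)"
    unfolding frame_family_def by blast
  define N where "N \<Omega> u = \<Omega> u (E 0 u) (E 3 u) (E 6 u)"
    for \<Omega> :: "real ^ 'n \<Rightarrow> real ^ 'n \<Rightarrow> real ^ 'n \<Rightarrow> real ^ 'n \<Rightarrow> real" and u
  have smN: "smooth_on U (N \<Omega>)" if "natural_G2 f D I x0 U \<Omega>" for \<Omega>
  proof -
    have st: "G2_structure U \<Omega>" using that unfolding natural_G2_def by blast
    have G1: "smooth_on U (\<lambda>u. \<Omega> u v w z)" for v w z using st unfolding G2_structure_def by blast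
    have G2: "alternating_trilinear (\<Omega> u)" if "u \<in> U" for u
      using st that unfolding G2_structure_def by (intro G2_form_alternating) blast
    have ex: "v = (\<Sum>m\<in>UNIV. (v $ m) *\<^sub>R axis m 1)" for v :: "real ^ 'n"
      using basis_expansion[of v] by (simp add: scalar_mult_eq_scaleR)
    \<comment> \<open>The arguments \<open>E\<close> move with \<open>u\<close>, while smoothness of
      the 3-form is given for fixed arguments; hence the expansion in the standard basis.\<close>
    have eq: "(\<Sum>a\<in>UNIV. \<Sum>b\<in>UNIV. \<Sum>c\<in>UNIV. E 6 u $ a * (E 3 u $ b * (E 0 u $ c * \<Omega> u (axis c 1) (axis b 1) (axis a 1)))) = N \<Omega> u"
      if u: "u \<in> U" for u
    proof -
      interpret alternating_trilinear "\<Omega> u" using G2[OF u] .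
      have "N \<Omega> u = \<Omega> u (\<Sum>m\<in>UNIV. (E 0 u $ m) *\<^sub>R axis m 1) (\<Sum>m\<in>UNIV. (E 3 u $ m) *\<^sub>R axis m 1)
          (\<Sum>m\<in>UNIV. (E 6 u $ m) *\<^sub>R axis m 1)"
        unfolding N_def using ex by simp
      then show ?thesis
        by (simp add: linear_sum[OF lin1] linear_sum[OF lin2] linear_sum[OF lin3] linear_scale[OF lin1]
            linear_scale[OF lin2] linear_scale[OF lin3] sum_distrib_left)
    qed
    have "smooth_on U (\<lambda>u. \<Sum>a\<in>UNIV. \<Sum>b\<in>UNIV. \<Sum>c\<in>UNIV. E 6 u $ a * (E 3 u $ b * (E 0 u $ c * \<Omega> u (axis c 1) (axis b 1) (axis a 1))))"
      by (intro smooth_on_sum smooth_on_mult open_U smE G1)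
    from smooth_on_cong[OF open_U eq this] show ?thesis by simp
  qed
  have main: "N \<Omega> u \<noteq> 0 \<and> N \<Omega>' u \<noteq> 0 \<and> (\<forall>v w z. \<Omega>' u v w z = (N \<Omega>' u * inverse (N \<Omega> u)) * \<Omega> u v w z)" if u: "u \<in> U" for u
  proof -
    obtain y where y: "y \<in> sols" "ode_solution f D I y" "jet y x0 = u" using obtain_solution[OF u] .
    obtain e c \<theta> b where "osculating_frame k I e c (\<lambda>x. wilczynski_matrix k (\<lambda>m. \<theta> m x) 0 (b x)) (curve y)"
      and wf: "wilczynski_frame k I (curve y) e \<theta>"
      and e: "\<forall>i\<le>k. e i x0 = E i (jet y x0)" and "\<forall>i\<le>k. c i x0 = C i (jet y x0)"
      by (rule frame_familyE[OF EC y(1)])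
    note wf = wf[unfolded k6] and e = e[unfolded k6 y(3)]
    have I_ne: "I \<noteq> {}" using x0 by auto
    have cf: "compatible_G2 I (curve y) (\<Omega> u)" "compatible_G2 I (curve y) (\<Omega>' u)"
      using \<Omega> \<Omega>' y unfolding natural_G2_def by auto
    obtain c where c: "c \<noteq> 0" "\<forall>t\<in>I. \<theta> 3 t = 0 \<and> \<theta> 4 t = 0 \<and> \<theta> 5 t = 0 \<and> \<theta> 7 t = 0"
      "g2_gram I (\<Omega> u) e c"
      "\<forall>t\<in>I. \<Omega> u (e 0 t) (e 3 t) (e 6 t) = c"
      by (rule compatible_G2_gram[OF wf open_I int_I subset_refl I_ne cf(1)])
    obtain c' where c': "c' \<noteq> 0" "\<forall>t\<in>I. \<theta> 3 t = 0 \<and> \<theta> 4 t = 0 \<and> \<theta> 5 t = 0 \<and> \<theta> 7 t = 0"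
      "g2_gram I (\<Omega>' u) e c'"
      "\<forall>t\<in>I. \<Omega>' u (e 0 t) (e 3 t) (e 6 t) = c'"
      by (rule compatible_G2_gram[OF wf open_I int_I subset_refl I_ne cf(2)])
    have N: "N \<Omega> u = c" "N \<Omega>' u = c'"
      using bspec[OF c(4) x0] bspec[OF c'(4) x0] e by (auto simp: N_def)
    have basis: "is_basis 6 (\<lambda>i. e i x0)" using wf x0 unfolding wilczynski_frame_def by blast
    have "\<Omega>' u v w z = (c' * inverse c) * \<Omega> u v w z" for v w z
    proof -
      obtain p where "v = (\<Sum>i\<le>6. p i *\<^sub>R e i x0)" using basis_expansion_coefficients[OF basis] .
      moreover obtain q where "w = (\<Sum>i\<le>6. q i *\<^sub>R e i x0)" using basis_expansion_coefficients[OF basis] .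
      moreover obtain r where "z = (\<Sum>i\<le>6. r i *\<^sub>R e i x0)" using basis_expansion_coefficients[OF basis] .
      ultimately show ?thesis using c(1,3) c'(3) x0 unfolding g2_gram_def by simp
    qed
    then show ?thesis using N c(1) c'(1) by simp
  qed
  have "smooth_on U (\<lambda>u. N \<Omega>' u * inverse (N \<Omega> u))"
    using main by (intro smooth_on_mult smooth_on_inverse open_U smN \<Omega> \<Omega>') auto
  then show ?thesis using main by (intro exI[of _ "\<lambda>u. N \<Omega>' u * inverse (N \<Omega> u)"]) auto
qed

end

theorem theorem2:
  fixes f :: "real \<times> (real ^ 'n) \<Rightarrow> real"
    and D :: "(real \<times> (real ^ 'n)) set"
    and I :: "real set" and x0 :: real
    and U :: "(real ^ 'n) set" and k :: nat
  assumes "k + 1 \<ge> 3" and "CARD('n) = k + 1"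
    and "open D" and "smooth_on D f"
    and "open I" and "is_interval I" and "x0 \<in> I"
    and "open U" and "U \<noteq> {}"
    and "\<forall>u\<in>U. \<exists>y. ode_solution f D I y \<and> jet y x0 = u"
  shows
    "((\<exists>C. natural_pseudo_conformal k f D I x0 U C) \<longleftrightarrow>
        even k \<and> (\<forall>i\<ge>1. 2 * i + 1 \<le> k + 1 \<longrightarrow>
                    generalized_wilczynski_vanishes k f D I x0 U (2 * i + 1)))
     \<and> (\<exists>\<^sub>\<le>\<^sub>1 C. natural_pseudo_conformal k f D I x0 U C)
     \<and> ((\<exists>C. natural_pseudo_symplectic k f D I x0 U C) \<longleftrightarrow>
        odd k \<and> (\<forall>i\<ge>1. 2 * i + 1 \<le> k + 1 \<longrightarrow>
                    generalized_wilczynski_vanishes k f D I x0 U (2 * i + 1)))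
     \<and> (\<exists>\<^sub>\<le>\<^sub>1 C. natural_pseudo_symplectic k f D I x0 U C)
     \<and> (k + 1 = 7 \<longrightarrow>
        ((\<exists>\<Omega>. natural_G2 f D I x0 U \<Omega>) \<longleftrightarrow>
           (\<forall>m\<in>{3, 4, 5, 7}. generalized_wilczynski_vanishes k f D I x0 U m))
        \<and> (\<forall>\<Omega> \<Omega>'. natural_G2 f D I x0 U \<Omega> \<longrightarrow> natural_G2 f D I x0 U \<Omega>' \<longrightarrow>
             (\<exists>c :: real ^ 'n \<Rightarrow> real. smooth_on U c \<and>
                (\<forall>u\<in>U. c u \<noteq> 0 \<and> (\<forall>v w z. \<Omega>' u v w z = c u * \<Omega> u v w z)))))"
proof -
  interpret solution_family f D I x0 k U
    using assms by unfold_locales auto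
  have "(\<exists>\<Omega>. natural_G2 f D I x0 U \<Omega>) \<longleftrightarrow> (\<forall>m\<in>{3, 4, 5, 7}. generalized_wilczynski_vanishes k f D I x0 U m)"
    "natural_G2 f D I x0 U \<Omega> \<Longrightarrow> natural_G2 f D I x0 U \<Omega>' \<Longrightarrow>
      \<exists>c. smooth_on U c \<and> (\<forall>u\<in>U. c u \<noteq> 0 \<and> (\<forall>v w z. \<Omega>' u v w z = c u * \<Omega> u v w z))"
    if "k + 1 = 7" for \<Omega> \<Omega>'
    using natural_G2_iff natural_G2_unique that by simp_all
  then show ?thesis
    using natural_pseudo_conformal_iff natural_pseudo_conformal_unique
      natural_pseudo_symplectic_iff natural_pseudo_symplectic_unique by blast
qed

end
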